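(* Let $q\in(0,1)$, $t\in[0,1]$, and let $D$ be the self-adjoint operator on the Hilbert space of spinors $\mathcal H$ given on the orthonormal basis by $Dv^l_{m,\pm}=(l+\tfrac12)v^l_{m,\mp}$, $l=\tfrac12,\tfrac32,\dots$, $m=-l,\dots,l$. Then the spectral triple $(\mathcal A(S^2_{qt}),\mathcal H,D)$ is $2^+$-summable and regular.
   Context: Let $[n]=(q^n-q^{-n})/(q-q^{-1})$ for $n\in\mathbb R$. Algebra. $\mathcal A(S^2_{qt})$ is the unital complex $*$-algebra generated by $x_{-1},x_0,x_1$ with relations $x_{-1}(x_0-t)=q^2(x_0-t)x_{-1}$, $x_1(x_0-t)=q^{-2}(x_0-t)x_1$, $-[2]x_{-1}x_1+(q^2x_0+t)(x_0-t)=[2]^2(1-t)$, $-[2]x_1x_{-1}+(q^{-2}x_0+t)(x_0-t)=[2]^2(1-t)$, and involution $x_{-1}^*=-q^{-1}x_1$, $x_0^*=x_0$. Spinors. $\mathcal H$ is the Hilbert space with orthonormal basis $v^l_{m,\pm}$ ($l\in\tfrac12+\mathbb N_0$, $m=-l,\dots,l$). $\mathcal A(S^2_{qt})$ acts on $\mathcal H$ through the faithful bounded $*$-representation $\pi$ given by $$\pi(x_i)v^l_{m,\pm}=\alpha_i^-(l,m;\pm\tfrac12)v^{l-1}_{m+i,\pm}+\alpha_i^0(l,m;\pm\tfrac12)v^l_{m+i,\pm}+\alpha_i^+(l,m;\pm\tfrac12)v^{l+1}_{m+i,\pm},$$ where a term is $0$ if the vector in it does not exist (i.e. $l-1<\tfrac12$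 or $|m+i|$ exceeds the spin), and $\alpha^+_1(l,m;N)=q^{-l+m}[l+m+1]^{1/2}[l+m+2]^{1/2}[2l+1]^{-1/2}[2l+2]^{-1/2}\alpha_N(l+1)$, $\alpha^0_1(l,m;N)=-q^{m+2}[l-m]^{1/2}[l+m+1]^{1/2}[2]^{1/2}[2l]^{-1}\beta_N(l)$, $\alpha^-_1(l,m;N)=-q^{l+m+1}[l-m-1]^{1/2}[l-m]^{1/2}[2l-1]^{-1/2}[2l]^{-1/2}\alpha_N(l)$, $\alpha^+_0(l,m;N)=q^m[l-m+1]^{1/2}[l+m+1]^{1/2}[2]^{1/2}[2l+1]^{-1/2}[2l+2]^{-1/2}\alpha_N(l+1)$, $\alpha^0_0(l,m;N)=[2l]^{-1}\big([l-m+1][l+m]-q^2[l-m][l+m+1]\big)\beta_N(l)$, $\alpha^-_0(l,m;N)=q^m[l-m]^{1/2}[l+m]^{1/2}[2]^{1/2}[2l-1]^{-1/2}[2l]^{-1/2}\alpha_N(l)$, $\alpha^+_{-1}(l,m;N)=q^{l+m}[l-m+1]^{1/2}[l-m+2]^{1/2}[2l+1]^{-1/2}[2l+2]^{-1/2}\alpha_N(l+1)$, $\alpha^0_{-1}(l,m;N)=q^m[l-m+1]^{1/2}[l+m]^{1/2}[2]^{1/2}[2l]^{-1}\beta_N(l)$, $\alpha^-_{-1}(l,m;N)=-q^{-l+m-1}[l+m-1]^{1/2}[l+m]^{1/2}[2l-1]^{-1/2}[2l]^{-1/2}\alpha_N(l)$, with, for $\epsilon=\mathrm{sign}(N)$,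 $$\alpha_N(l)=\frac{[2]^{1/2}[l+N]^{1/2}[l-N]^{1/2}[2l]^{1/2}}{[2l+1]^{1/2}[l]}\Big(1-t+q^{-2N}[2l]^{-2}[l]^2(t-1+q^{2N})^2\Big)^{1/2},$$ $$\beta_N(l)=\frac{\epsilon[2|N|](q^{-1}+q-q^{\epsilon}t)+t(q-q^{-1})\{[|N|][|N|+1]-[l][l+1]\}}{q[2l+2]}.$$ Definitions. A spectral triple $(\mathcal A,\mathcal H,D)$: a complex unital $*$-algebra $\mathcal A$, a faithful $*$-representation by bounded operators on $\mathcal H$, and a self-adjoint $D$ with $(D+\mathrm i)^{-1}$ compact and $[D,a]$ bounded for all $a\in\mathcal A$. It is $\mu^+$-summable ($0<\mu<\infty$) if $(D^2+1)^{-1/2}$ lies in the Dixmier ideal $\mathcal L^{\mu+}(\mathcal H)$ (for $\mu>1$: compact operators with singular values $s_k=O(k^{-1/\mu})$). Let $\delta(a)=[|D|,a]$, an unbounded derivation on $\mathcal B(\mathcal H)$. The triple is regular if the algebra generated by $\mathcal A$ and $[D,\mathcal A]$ is contained in $\mathrm{OP}^0:=\bigcap_{j\in\mathbb N_0}\mathrm{dom}\,\delta^j$. *)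

theory Defs
  imports
    "HOL-Analysis.Analysis"
    "HOL-Algebra.QuotRing"
    "HOL-Algebra.Module"
    "HOL-Library.Poly_Mapping"
    "HOL-Library.Landau_Symbols"
begin

section \<open>Complex Hilbert spaces\<close>

text \<open>The inner product is conjugate-linear in the first argument; \<^const>\<open>scaleR\<close> is the
  restriction of the complex scaling.\<close>

class complex_hilbert = banach +
  fixes scaleC :: "complex \<Rightarrow> 'a \<Rightarrow> 'a" (infixr "*\<^sub>C" 75)
    and cinner :: "'a \<Rightarrow> 'a \<Rightarrow> complex"
  assumes scaleC_add_right: "a *\<^sub>C (x + y) = a *\<^sub>C x + a *\<^sub>C y"
    and scaleC_add_left: "(a + b) *\<^sub>C x = a *\<^sub>C x + b *\<^sub>C x"
    and scaleC_scaleC: "a *\<^sub>C b *\<^sub>C x = (a * b) *\<^sub>C x"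
    and scaleR_scaleC: "scaleR r x = complex_of_real r *\<^sub>C x"
    and cinner_commute: "cinner x y = cnj (cinner y x)"
    and cinner_add_right: "cinner x (y + z) = cinner x y + cinner x z"
    and cinner_scaleC_right: "cinner x (a *\<^sub>C y) = a * cinner x y"
    and cinner_self: "cinner x x = complex_of_real ((norm x)\<^sup>2)"

definition orthonormal_basis :: "'i set \<Rightarrow> ('i \<Rightarrow> 'h::complex_hilbert) \<Rightarrow> bool" where
  "orthonormal_basis I e \<longleftrightarrow>
     (\<forall>i\<in>I. \<forall>j\<in>I. cinner (e i) (e j) = (if i = j then 1 else 0)) \<and>
     closure {\<Sum>i\<in>F. c i *\<^sub>C e i | F c. finite F \<and> F \<subseteq> I} = UNIV"

section \<open>Operators\<close>

definition bounded_operator :: "('h::complex_hilbert \<Rightarrow> 'h) \<Rightarrow> bool" where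
  "bounded_operator f \<longleftrightarrow> bounded_linear f \<and> (\<forall>c x. f (c *\<^sub>C x) = c *\<^sub>C f x)"

definition compact_operator :: "('h::complex_hilbert \<Rightarrow> 'h) \<Rightarrow> bool" where
  "compact_operator f \<longleftrightarrow> bounded_operator f \<and> compact (closure (f ` cball 0 1))"

text \<open>Unbounded operators are represented by their graphs, so that domains are part of the
  data: the composite ``first \<open>S\<close>, then \<open>T\<close>'' is the relational composition \<open>S O T\<close>, with its
  natural domain, and the inverse of an injective operator is the converse.\<close>

definition op_graph :: "('h \<Rightarrow> 'h) \<Rightarrow> 'h rel" where
  "op_graph f = {(x, f x) | x. True}"

definition plus_scalar :: "'h::complex_hilbert rel \<Rightarrow> complex \<Rightarrow> 'h rel" where
  "plus_scalar T z = {(x, y + z *\<^sub>C x) | x y. (x, y) \<in> T}"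

definition adjoint_op :: "'h::complex_hilbert rel \<Rightarrow> 'h rel" where
  "adjoint_op T = {(y, z). \<forall>(x, w) \<in> T. cinner y w = cinner z x}"

text \<open>Linearity, single-valuedness and closedness of the graph follow from this: an adjoint is
  always a closed linear relation, and it is single-valued if the domain is dense.\<close>

definition self_adjoint :: "'h::complex_hilbert rel \<Rightarrow> bool" where
  "self_adjoint T \<longleftrightarrow> closure (Domain T) = UNIV \<and> adjoint_op T = T"

definition positive_op :: "'h::complex_hilbert rel \<Rightarrow> bool" where
  "positive_op T \<longleftrightarrow> self_adjoint T \<and> (\<forall>(x, y) \<in> T. 0 \<le> Re (cinner x y))"

text \<open>The square root is meant for positive self-adjoint \<open>S\<close>, for which it exists uniquely;
  the absolute value is \<open>(T* T)\<close> to the power \<open>1/2\<close>, for closed densely defined \<open>T\<close>.\<close>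

definition sqrt_op :: "'h::complex_hilbert rel \<Rightarrow> 'h rel" where
  "sqrt_op S = (THE R. positive_op R \<and> R O R = S)"

definition abs_op :: "'h::complex_hilbert rel \<Rightarrow> 'h rel" where
  "abs_op T = sqrt_op (T O adjoint_op T)"

text \<open>The pairs \<open>(a, b)\<close> of bounded operators such that \<open>a\<close> maps the domain of \<open>T\<close> into itself
  and \<open>[T, a] = T a - a T\<close>, defined on the domain of \<open>T\<close>, extends to \<open>b\<close>. For \<open>T\<close> densely
  defined, \<open>b\<close> is determined by \<open>a\<close>, so this is the graph of the unbounded derivation \<open>[T, -]\<close>.\<close>

definition commutator :: "'h::complex_hilbert rel \<Rightarrow> ('h \<Rightarrow> 'h) rel" where
  "commutator T = {(a, b). bounded_operator a \<and> bounded_operator b \<and>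
     (\<forall>(x, y) \<in> T. (a x, a y + b x) \<in> T)}"

section \<open>Singular values and the Dixmier ideals\<close>

text \<open>For compact \<open>T\<close>: \<open>s\<close> lists the eigenvalues of \<open>|T|\<close> in decreasing order, repeated according
  to multiplicity, and padded with zeros if \<open>T\<close> has finite rank. This determines \<open>s\<close>.\<close>

definition singular_values :: "('h::complex_hilbert \<Rightarrow> 'h) \<Rightarrow> (nat \<Rightarrow> real) \<Rightarrow> bool" where
  "singular_values T s \<longleftrightarrow> decseq s \<and> (\<forall>k. 0 \<le> s k) \<and>
     (\<forall>r>0. finite {k. s k = r} \<and>
        card {k. s k = r} =
          vector_space.dim scaleC {x. (x, complex_of_real r *\<^sub>C x) \<in> abs_op (op_graph T)})"

text \<open>Only to be used for \<open>\<mu> > 1\<close>.\<close>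

definition dixmier_ideal :: "real \<Rightarrow> ('h::complex_hilbert \<Rightarrow> 'h) set" where
  "dixmier_ideal \<mu> = {T. compact_operator T \<and>
     (\<exists>s. singular_values T s \<and> s \<in> O(\<lambda>k. real k powr (- 1 / \<mu>)))}"

section \<open>Complex *-algebras and their representations\<close>

record 'a star_algebra = "(complex, 'a) module" +
  star :: "'a \<Rightarrow> 'a"

locale complex_star_algebra = ring A for A :: "('a, 'b) star_algebra_scheme" (structure) +
  assumes smult_closed: "x \<in> carrier A \<Longrightarrow> c \<odot> x \<in> carrier A"
    and smult_add_right: "x \<in> carrier A \<Longrightarrow> y \<in> carrier A \<Longrightarrow> c \<odot> (x \<oplus> y) = c \<odot> x \<oplus> c \<odot> y"
    and smult_add_left: "x \<in> carrier A \<Longrightarrow> (c + d) \<odot> x = c \<odot> x \<oplus> d \<odot> x"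
    and smult_assoc: "x \<in> carrier A \<Longrightarrow> (c * d) \<odot> x = c \<odot> (d \<odot> x)"
    and smult_one: "x \<in> carrier A \<Longrightarrow> 1 \<odot> x = x"
    and smult_mult_left: "x \<in> carrier A \<Longrightarrow> y \<in> carrier A \<Longrightarrow> (c \<odot> x) \<otimes> y = c \<odot> (x \<otimes> y)"
    and smult_mult_right: "x \<in> carrier A \<Longrightarrow> y \<in> carrier A \<Longrightarrow> x \<otimes> (c \<odot> y) = c \<odot> (x \<otimes> y)"
    and star_closed: "x \<in> carrier A \<Longrightarrow> star A x \<in> carrier A"
    and star_star: "x \<in> carrier A \<Longrightarrow> star A (star A x) = x"
    and star_add: "x \<in> carrier A \<Longrightarrow> y \<in> carrier A \<Longrightarrow> star A (x \<oplus> y) = star A x \<oplus> star A y"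
    and star_smult: "x \<in> carrier A \<Longrightarrow> star A (c \<odot> x) = cnj c \<odot> star A x"
    and star_mult: "x \<in> carrier A \<Longrightarrow> y \<in> carrier A \<Longrightarrow> star A (x \<otimes> y) = star A y \<otimes> star A x"

definition star_representation ::
    "('a, 'b) star_algebra_scheme \<Rightarrow> ('a \<Rightarrow> 'h::complex_hilbert \<Rightarrow> 'h) \<Rightarrow> bool" where
  "star_representation A \<pi> \<longleftrightarrow>
     (\<forall>a\<in>carrier A. bounded_operator (\<pi> a)) \<and>
     \<pi> \<one>\<^bsub>A\<^esub> = (\<lambda>x. x) \<and>
     (\<forall>a\<in>carrier A. \<forall>b\<in>carrier A. \<pi> (a \<oplus>\<^bsub>A\<^esub> b) = (\<lambda>x. \<pi> a x + \<pi> b x)) \<and>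
     (\<forall>a\<in>carrier A. \<forall>b\<in>carrier A. \<pi> (a \<otimes>\<^bsub>A\<^esub> b) = (\<lambda>x. \<pi> a (\<pi> b x))) \<and>
     (\<forall>c. \<forall>a\<in>carrier A. \<pi> (c \<odot>\<^bsub>A\<^esub> a) = (\<lambda>x. c *\<^sub>C \<pi> a x)) \<and>
     (\<forall>a\<in>carrier A. \<forall>x y. cinner (\<pi> (star A a) x) y = cinner x (\<pi> a y))"

definition faithful_star_representation ::
    "('a, 'b) star_algebra_scheme \<Rightarrow> ('a \<Rightarrow> 'h::complex_hilbert \<Rightarrow> 'h) \<Rightarrow> bool" where
  "faithful_star_representation A \<pi> \<longleftrightarrow> star_representation A \<pi> \<and> inj_on \<pi> (carrier A)"

section \<open>Spectral triples\<close>

definition spectral_triple ::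
    "('a, 'b) star_algebra_scheme \<Rightarrow> ('a \<Rightarrow> 'h::complex_hilbert \<Rightarrow> 'h) \<Rightarrow> 'h rel \<Rightarrow> bool" where
  "spectral_triple A \<pi> D \<longleftrightarrow>
     complex_star_algebra A \<and>
     faithful_star_representation A \<pi> \<and>
     self_adjoint D \<and>
     (\<exists>R. compact_operator R \<and> op_graph R = (plus_scalar D \<i>)\<inverse>) \<and>
     (\<forall>a\<in>carrier A. \<exists>b. (\<pi> a, b) \<in> commutator D)"

text \<open>Only to be used for \<open>\<mu> > 1\<close>, like \<^const>\<open>dixmier_ideal\<close>.\<close>

definition summable_triple :: "real \<Rightarrow> 'h::complex_hilbert rel \<Rightarrow> bool" where
  "summable_triple \<mu> D \<longleftrightarrow>
     (\<exists>B. B \<in> dixmier_ideal \<mu> \<and> op_graph B = sqrt_op ((plus_scalar (D O D) 1)\<inverse>))"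

inductive_set generated_algebra :: "('h::complex_hilbert \<Rightarrow> 'h) set \<Rightarrow> ('h \<Rightarrow> 'h) set"
  for S where
  generator: "a \<in> S \<Longrightarrow> a \<in> generated_algebra S"
| add: "a \<in> generated_algebra S \<Longrightarrow> b \<in> generated_algebra S \<Longrightarrow>
    (\<lambda>x. a x + b x) \<in> generated_algebra S"
| mult: "a \<in> generated_algebra S \<Longrightarrow> b \<in> generated_algebra S \<Longrightarrow>
    (\<lambda>x. a (b x)) \<in> generated_algebra S"
| scale: "a \<in> generated_algebra S \<Longrightarrow> (\<lambda>x. c *\<^sub>C a x) \<in> generated_algebra S"

text \<open>The domain of the \<open>j\<close>-th power of \<open>\<delta> = [|D|, -]\<close> is the domain of the \<open>j\<close>-th relational
  power of its graph; for \<open>j = 0\<close> it is the set of all bounded operators.\<close>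

definition OP0 :: "'h::complex_hilbert rel \<Rightarrow> ('h \<Rightarrow> 'h) set" where
  "OP0 D = {a. bounded_operator a \<and> (\<forall>j. a \<in> Domain (commutator (abs_op D) ^^ j))}"

definition regular_triple ::
    "('a, 'b) star_algebra_scheme \<Rightarrow> ('a \<Rightarrow> 'h::complex_hilbert \<Rightarrow> 'h) \<Rightarrow> 'h rel \<Rightarrow> bool" where
  "regular_triple A \<pi> D \<longleftrightarrow>
     generated_algebra (\<pi> ` carrier A \<union> {b. \<exists>a\<in>carrier A. (\<pi> a, b) \<in> commutator D}) \<subseteq> OP0 D"

section \<open>The algebra of the quantum sphere\<close>

definition qnum :: "real \<Rightarrow> real \<Rightarrow> real" where
  "qnum q x = (q powr x - q powr (- x)) / (q - inverse q)"

text \<open>The generators \<open>Xm\<close>, \<open>X0\<close>, \<open>Xp\<close> stand for \<open>x\<^sub>i\<close> with \<open>i = -1, 0, 1\<close>. The free unital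
  complex algebra on them consists of the finitely supported functions on the monoid of words,
  with the convolution product.\<close>

datatype gen = Xm | X0 | Xp

fun gen_index :: "gen \<Rightarrow> real" where
  "gen_index Xm = -1"
| "gen_index X0 = 0"
| "gen_index Xp = 1"

datatype word = Word (letters: "gen list")

instantiation word :: monoid_add
begin

definition "0 = Word []"
definition "u + v = Word (letters u @ letters v)"

instance
  by standard (simp_all add: zero_word_def plus_word_def)

end

type_synonym free_alg = "word \<Rightarrow>\<^sub>0 complex"

definition var :: "gen \<Rightarrow> free_alg" where
  "var g = Poly_Mapping.single (Word [g]) 1"

definition const :: "complex \<Rightarrow> free_alg" where
  "const c = Poly_Mapping.single 0 c"

abbreviation rconst :: "real \<Rightarrow> free_alg" where
  "rconst r \<equiv> const (complex_of_real r)"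

text \<open>The involution of the free algebra is the conjugate-linear anti-automorphism with
  \<open>Xm* = - q\<^sup>-\<^sup>1 Xp\<close> and \<open>X0* = X0\<close>, whence \<open>Xp* = - q Xm\<close>.\<close>

fun star_gen :: "real \<Rightarrow> gen \<Rightarrow> free_alg" where
  "star_gen q Xm = rconst (- inverse q) * var Xp"
| "star_gen q X0 = var X0"
| "star_gen q Xp = rconst (- q) * var Xm"

fun star_letters :: "real \<Rightarrow> gen list \<Rightarrow> free_alg" where
  "star_letters q [] = 1"
| "star_letters q (g # w) = star_letters q w * star_gen q g"

definition star_free :: "real \<Rightarrow> free_alg \<Rightarrow> free_alg" where
  "star_free q p =
     (\<Sum>w\<in>Poly_Mapping.keys p. const (cnj (Poly_Mapping.lookup p w)) * star_letters q (letters w))"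

definition podles_relations :: "real \<Rightarrow> real \<Rightarrow> free_alg set" where
  "podles_relations q t =
    {var Xm * (var X0 - rconst t) - rconst (q\<^sup>2) * (var X0 - rconst t) * var Xm,
     var Xp * (var X0 - rconst t) - rconst (inverse (q\<^sup>2)) * (var X0 - rconst t) * var Xp,
     - rconst (qnum q 2) * var Xm * var Xp
       + (rconst (q\<^sup>2) * var X0 + rconst t) * (var X0 - rconst t)
       - rconst ((qnum q 2)\<^sup>2 * (1 - t)),
     - rconst (qnum q 2) * var Xp * var Xm
       + (rconst (inverse (q\<^sup>2)) * var X0 + rconst t) * (var X0 - rconst t)
       - rconst ((qnum q 2)\<^sup>2 * (1 - t))}"

definition free_ring :: "free_alg ring" where
  "free_ring = \<lparr>carrier = UNIV, mult = (*), one = 1, zero = 0, add = (+)\<rparr>"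

text \<open>Ideals of HOL-Algebra are two-sided. The ideal below is a complex subspace, as the
  free algebra is unital, and it is stable under \<open>star_free q\<close>; hence scaling and involution
  pass to cosets.\<close>

definition podles_ideal :: "real \<Rightarrow> real \<Rightarrow> free_alg set" where
  "podles_ideal q t = genideal free_ring (podles_relations q t)"

definition podles_coset :: "real \<Rightarrow> real \<Rightarrow> free_alg \<Rightarrow> free_alg set" where
  "podles_coset q t p = podles_ideal q t +>\<^bsub>free_ring\<^esub> p"

definition podles_algebra :: "real \<Rightarrow> real \<Rightarrow> free_alg set star_algebra" where
  "podles_algebra q t = (let Q = free_ring Quot podles_ideal q t in
     \<lparr>carrier = carrier Q, mult = mult Q, one = one Q, zero = zero Q, add = add Q,
      smult = (\<lambda>c X. \<Union>p\<in>X. podles_coset q t (const c * p)),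
      star = (\<lambda>X. \<Union>p\<in>X. podles_coset q t (star_free q p))\<rparr>)"

definition podles_gen :: "real \<Rightarrow> real \<Rightarrow> gen \<Rightarrow> free_alg set" where
  "podles_gen q t g = podles_coset q t (var g)"

section \<open>The spinor representation\<close>

text \<open>The basis vector \<open>v\<^sup>l\<^sub>m\<^sub>,\<^sub>\<plusminus>\<close> is written \<open>v (l, m, N)\<close> with \<open>N = \<plusminus> 1/2\<close>.\<close>

definition spinor_index :: "(real \<times> real \<times> real) set" where
  "spinor_index = {(l, m, N). (\<exists>n::nat. l = real n + 1/2) \<and>
     (\<exists>k::nat. m = - l + real k \<and> m \<le> l) \<and> N \<in> {1/2, - 1/2}}"

definition basis_or_zero :: "(real \<times> real \<times> real \<Rightarrow> 'h::zero) \<Rightarrow> real \<times> real \<times> real \<Rightarrow> 'h" where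
  "basis_or_zero v i = (if i \<in> spinor_index then v i else 0)"

context
  fixes q t :: real
begin

private abbreviation qn :: "real \<Rightarrow> real" where "qn \<equiv> qnum q"
private abbreviation qs :: "real \<Rightarrow> real" where "qs x \<equiv> sqrt (qnum q x)"

definition coef_alpha :: "real \<Rightarrow> real \<Rightarrow> real" where
  "coef_alpha N l =
     qs 2 * qs (l + N) * qs (l - N) * qs (2*l) / (qs (2*l + 1) * qn l)
     * sqrt (1 - t + q powr (- 2*N) * (qn l)\<^sup>2 / (qn (2*l))\<^sup>2 * (t - 1 + q powr (2*N))\<^sup>2)"

definition coef_beta :: "real \<Rightarrow> real \<Rightarrow> real" where
  "coef_beta N l =
     (sgn N * qn (2 * \<bar>N\<bar>) * (inverse q + q - q powr (sgn N) * t)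
       + t * (q - inverse q) * (qn \<bar>N\<bar> * qn (\<bar>N\<bar> + 1) - qn l * qn (l + 1)))
     / (q * qn (2*l + 2))"

fun alpha_plus :: "gen \<Rightarrow> real \<Rightarrow> real \<Rightarrow> real \<Rightarrow> real" where
  "alpha_plus Xp l m N = q powr (- l + m) * qs (l + m + 1) * qs (l + m + 2)
     / (qs (2*l + 1) * qs (2*l + 2)) * coef_alpha N (l + 1)"
| "alpha_plus X0 l m N = q powr m * qs (l - m + 1) * qs (l + m + 1) * qs 2
     / (qs (2*l + 1) * qs (2*l + 2)) * coef_alpha N (l + 1)"
| "alpha_plus Xm l m N = q powr (l + m) * qs (l - m + 1) * qs (l - m + 2)
     / (qs (2*l + 1) * qs (2*l + 2)) * coef_alpha N (l + 1)"

fun alpha_zero :: "gen \<Rightarrow> real \<Rightarrow> real \<Rightarrow> real \<Rightarrow> real" where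
  "alpha_zero Xp l m N = - (q powr (m + 2)) * qs (l - m) * qs (l + m + 1) * qs 2
     / qn (2*l) * coef_beta N l"
| "alpha_zero X0 l m N = (qn (l - m + 1) * qn (l + m) - q\<^sup>2 * qn (l - m) * qn (l + m + 1))
     / qn (2*l) * coef_beta N l"
| "alpha_zero Xm l m N = q powr m * qs (l - m + 1) * qs (l + m) * qs 2
     / qn (2*l) * coef_beta N l"

text \<open>For \<open>l = 1/2\<close> the factor \<open>[2l-1]\<close> vanishes; the corresponding term is absent, since
  there is no vector with spin \<open>l - 1 < 1/2\<close>.\<close>

fun alpha_minus :: "gen \<Rightarrow> real \<Rightarrow> real \<Rightarrow> real \<Rightarrow> real" where
  "alpha_minus Xp l m N = - (q powr (l + m + 1)) * qs (l - m - 1) * qs (l - m)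
     / (qs (2*l - 1) * qs (2*l)) * coef_alpha N l"
| "alpha_minus X0 l m N = q powr m * qs (l - m) * qs (l + m) * qs 2
     / (qs (2*l - 1) * qs (2*l)) * coef_alpha N l"
| "alpha_minus Xm l m N = - (q powr (- l + m - 1)) * qs (l + m - 1) * qs (l + m)
     / (qs (2*l - 1) * qs (2*l)) * coef_alpha N l"

end

definition spinor_representation ::
    "real \<Rightarrow> real \<Rightarrow> (real \<times> real \<times> real \<Rightarrow> 'h::complex_hilbert)
      \<Rightarrow> (free_alg set \<Rightarrow> 'h \<Rightarrow> 'h) \<Rightarrow> bool" where
  "spinor_representation q t v \<pi> \<longleftrightarrow>
     faithful_star_representation (podles_algebra q t) \<pi> \<and>
     (\<forall>g. \<forall>(l, m, N) \<in> spinor_index.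
        \<pi> (podles_gen q t g) (v (l, m, N)) =
          alpha_minus q t g l m N *\<^sub>R basis_or_zero v (l - 1, m + gen_index g, N)
          + alpha_zero q t g l m N *\<^sub>R basis_or_zero v (l, m + gen_index g, N)
          + alpha_plus q t g l m N *\<^sub>R basis_or_zero v (l + 1, m + gen_index g, N))"

end

theory Submission
  imports Defs
begin

text \<open>In the orthonormal basis \<open>(v (l, m, 1/2) \<plusminus> v (l, m, - 1/2)) / sqrt 2\<close> the operator \<open>D\<close> is diagonal
  with eigenvalues \<open>\<plusminus> (l + 1/2)\<close>. Hence \<open>|D|\<close> is the diagonal operator \<open>l + 1/2\<close> on the basis \<open>v\<close>, and its
  eigenvalue \<open>n\<close> has multiplicity \<open>4 n\<close>, which gives compactness of the resolvent and summability.

  Each generator is a sum of three weighted shifts that change \<open>l\<close> by \<open>s = - 1, 0, 1\<close>. Such a shift \<open>T\<close> is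
  bounded, its weights being matrix entries of the generator, and satisfies \<open>[|D|, T] = s T\<close>, so that it
  lies in the domain of all powers of the derivation. Its commutator with \<open>D\<close> is again a weighted shift;
  the new weights are bounded since those for the two signs of \<open>N\<close> differ by \<open>O(q\<^sup>l)\<close>. By the Leibniz rule,
  both properties pass from the generators to the algebra.\<close>

section \<open>Hilbert spaces with an orthonormal basis\<close>

text \<open>The shifts are simple in the basis \<open>v\<close>, the operator \<open>D\<close> only
  in the rotated one, so both coordinate systems are needed; they meet in \<open>D O D\<close>,
  which is diagonal in either. Square roots and absolute values are definite descriptions, and one
  principle stands in for the spectral theorem: a self-adjoint operator with an orthonormal basis of
  eigenvectors is the diagonal operator on its natural domain. It yields \<open>D\<close>, its
  square and the uniqueness of the positive root, hence |D|. The commutator of \<open>D\<close> with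
  a shift compares its weights at the two signs of \<open>N\<close> and multiplies their difference
  by the eigenvalue l + 1/2, so bounded weights are not enough. The factors free of \<open>N\<close>
  are bounded but need not decay; the gain \<open>q powr l\<close> has to come from
  \<open>coef_alpha\<close> and \<open>coef_beta\<close> themselves. This is why the estimates track
  the exponent of \<open>q\<close> and lump everything else into powers of one constant.\<close>

lemma vector_space_scaleC: "vector_space (scaleC :: complex \<Rightarrow> 'h::complex_hilbert \<Rightarrow> 'h)"
proof
  fix a b :: complex and x y :: 'h
  show "a *\<^sub>C (x + y) = a *\<^sub>C x + a *\<^sub>C y" by (rule scaleC_add_right)
  show "(a + b) *\<^sub>C x = a *\<^sub>C x + b *\<^sub>C x" by (rule scaleC_add_left)
  show "a *\<^sub>C b *\<^sub>C x = (a * b) *\<^sub>C x" by (rule scaleC_scaleC)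
  show "1 *\<^sub>C x = x" using scaleR_scaleC[of 1 x] by simp
qed

interpretation cvs: vector_space "scaleC :: complex \<Rightarrow> 'h::complex_hilbert \<Rightarrow> 'h"
  by (rule vector_space_scaleC)

lemma cinner_add_left: "cinner (x + y) z = cinner x z + cinner y z"
  by (metis cinner_add_right cinner_commute complex_cnj_add)

lemma cinner_scaleC_left: "cinner (a *\<^sub>C x) y = cnj a * cinner x y"
  by (metis cinner_commute cinner_scaleC_right complex_cnj_mult)

lemma cinner_zero_right [simp]: "cinner x 0 = 0"
  using cinner_scaleC_right[of x 0 0] by simp

lemma cinner_zero_left [simp]: "cinner 0 x = 0"
  using cinner_scaleC_left[of 0 0 x] by simp

lemma cinner_minus_right: "cinner x (- y) = - cinner x y"
  using cinner_add_right[of x "- y" y] by (simp add: eq_neg_iff_add_eq_0)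

lemma cinner_minus_left: "cinner (- x) y = - cinner x y"
  by (metis cinner_commute cinner_minus_right complex_cnj_minus)

lemma cinner_diff_right: "cinner x (y - z) = cinner x y - cinner x z"
  using cinner_add_right[of x y "- z"] by (simp add: cinner_minus_right)

lemma cinner_diff_left: "cinner (x - y) z = cinner x z - cinner y z"
  using cinner_add_left[of x "- y" z] by (simp add: cinner_minus_left)

lemma cinner_scaleR_right: "cinner x (r *\<^sub>R y) = of_real r * cinner x y"
  by (simp add: scaleR_scaleC cinner_scaleC_right)

lemma cinner_scaleR_left: "cinner (r *\<^sub>R x) y = of_real r * cinner x y"
  by (simp add: scaleR_scaleC cinner_scaleC_left)

lemma cinner_sum_right: "cinner x (sum f F) = (\<Sum>i\<in>F. cinner x (f i))"
  by (induction F rule: infinite_finite_induct) (simp_all add: cinner_add_right)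

lemma cinner_sum_left: "cinner (sum f F) x = (\<Sum>i\<in>F. cinner (f i) x)"
  by (induction F rule: infinite_finite_induct) (simp_all add: cinner_add_left)

lemma cinner_self_eq_0: "cinner x x = 0 \<longleftrightarrow> x = 0"
  by (simp add: cinner_self)

lemma norm_scaleC: "norm (c *\<^sub>C x) = cmod c * norm (x::'h::complex_hilbert)"
proof -
  have "complex_of_real ((norm (c *\<^sub>C x))\<^sup>2) = c * cnj c * complex_of_real ((norm x)\<^sup>2)"
    unfolding cinner_self[symmetric] cinner_scaleC_left cinner_scaleC_right by (simp only: mult_ac)
  also have "\<dots> = complex_of_real ((cmod c * norm x)\<^sup>2)"
    by (simp only: complex_norm_square power_mult_distrib of_real_mult)
  finally have "(norm (c *\<^sub>C x))\<^sup>2 = (cmod c * norm x)\<^sup>2"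
    by (simp only: of_real_eq_iff)
  thus ?thesis by (simp add: power2_eq_iff_nonneg)
qed

lemma cmod_cinner_le: "cmod (cinner x y) \<le> norm x * norm (y::'h::complex_hilbert)"
proof (cases "x = 0")
  case False
  define z where "z = y - (cinner x y / cinner x x) *\<^sub>C x"
  have nz: "cinner x x \<noteq> 0" using False by (simp add: cinner_self_eq_0)
  have "cinner x z = 0"
    using nz by (simp add: z_def cinner_diff_right cinner_scaleC_right)
  hence zx: "cinner z x = 0" using cinner_commute[of z x] by simp
  have "cinner z z = cinner z (y - (cinner x y / cinner x x) *\<^sub>C x)" by (simp add: z_def)
  also have "\<dots> = cinner z y" by (simp add: cinner_diff_right cinner_scaleC_right zx)
  also have "cinner z y = cinner y y - cnj (cinner x y / cinner x x) * cinner x y"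
    by (simp add: z_def cinner_diff_left cinner_scaleC_left)
  also have "\<dots> = complex_of_real ((norm y)\<^sup>2 - (cmod (cinner x y))\<^sup>2 / (norm x)\<^sup>2)"
    by (simp only: cinner_self complex_norm_square of_real_diff of_real_divide complex_cnj_divide
        complex_cnj_complex_of_real times_divide_eq_left times_divide_eq_right mult.commute)
  finally have "(norm z)\<^sup>2 = (norm y)\<^sup>2 - (cmod (cinner x y))\<^sup>2 / (norm x)\<^sup>2"
    by (simp only: cinner_self of_real_eq_iff)
  hence "(cmod (cinner x y))\<^sup>2 / (norm x)\<^sup>2 \<le> (norm y)\<^sup>2"
    by (metis diff_ge_0_iff_ge zero_le_power2)
  hence "(cmod (cinner x y))\<^sup>2 \<le> (norm x * norm y)\<^sup>2"
    using False by (simp add: field_simps power_mult_distrib)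
  thus ?thesis by (rule power2_le_imp_le) simp
qed simp

lemma bounded_linear_cinner_right: "bounded_linear (cinner (x::'h::complex_hilbert))"
  by (rule bounded_linear_intro[of _ "norm x"])
    (simp_all add: cinner_add_right cinner_scaleR_right scaleR_conv_of_real
      cmod_cinner_le mult.commute[of _ "norm x"])

lemma bounded_linear_scaleC_right: "bounded_linear (\<lambda>x::'h::complex_hilbert. c *\<^sub>C x)"
  by (rule bounded_linear_intro[of _ "cmod c"])
    (simp_all add: scaleC_add_right scaleR_scaleC scaleC_scaleC norm_scaleC mult.commute)

lemma bounded_linear_scaleC_left: "bounded_linear (\<lambda>c. c *\<^sub>C (x::'h::complex_hilbert))"
  by (rule bounded_linear_intro[of _ "norm x"])
    (simp_all add: scaleC_add_left scaleR_scaleC scaleC_scaleC norm_scaleC scaleR_conv_of_real)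

lemma bounded_operator_linear: "bounded_operator f \<Longrightarrow> bounded_linear f"
  by (simp add: bounded_operator_def)

lemma bounded_operator_scaleC: "bounded_operator f \<Longrightarrow> f (c *\<^sub>C x) = c *\<^sub>C f x"
  by (simp add: bounded_operator_def)

lemma bounded_operator_add_right: "bounded_operator f \<Longrightarrow> f (x + y) = f x + f y"
  by (simp add: bounded_operator_def bounded_linear_def linear_add)

lemma bounded_operator_id: "bounded_operator (\<lambda>x. x)"
  by (simp add: bounded_operator_def bounded_linear_ident)

lemma bounded_operator_zero: "bounded_operator (\<lambda>x. 0)"
  by (simp add: bounded_operator_def bounded_linear_zero)

lemma bounded_operator_plus:
  "bounded_operator f \<Longrightarrow> bounded_operator g \<Longrightarrow> bounded_operator (\<lambda>x. f x + g x)"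
  by (simp add: bounded_operator_def bounded_linear_add scaleC_add_right)

lemma bounded_operator_compose:
  "bounded_operator f \<Longrightarrow> bounded_operator g \<Longrightarrow> bounded_operator (\<lambda>x. f (g x))"
  by (simp add: bounded_operator_def bounded_linear_compose)

lemma bounded_operator_scale:
  "bounded_operator f \<Longrightarrow> bounded_operator (\<lambda>x. c *\<^sub>C f x)"
  by (simp add: bounded_operator_def bounded_linear_compose[OF bounded_linear_scaleC_right]
      scaleC_scaleC mult.commute)

section \<open>Compactness and unconditional sums in Banach spaces\<close>

lemma compact_closure_if_approx:
  fixes S :: "'a::banach set"
  assumes "\<And>e. e > 0 \<Longrightarrow> \<exists>K. compact K \<and> (\<forall>x\<in>S. \<exists>y\<in>K. dist x y \<le> e)"
  shows "compact (closure S)"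
  unfolding compact_eq_totally_bounded
proof (intro conjI allI impI)
  show "complete (closure S)" by (simp add: complete_eq_closed)
  fix e :: real assume "e > 0"
  \<comment> \<open>A quarter is spent three times: from the closure to \<open>S\<close>, from
    \<open>S\<close> to \<open>K\<close>, and from \<open>K\<close> to its finite net.\<close>
  hence e4: "e/4 > 0" by simp
  obtain K where K: "compact K" "\<And>x. x \<in> S \<Longrightarrow> \<exists>y\<in>K. dist x y \<le> e/4"
    using assms[OF e4] by blast
  obtain k where k: "finite k" "K \<subseteq> (\<Union>x\<in>k. ball x (e/4))"
    using K(1) e4 unfolding compact_eq_totally_bounded by blast
  have "closure S \<subseteq> (\<Union>x\<in>k. ball x e)"
  proof
    fix x assume "x \<in> closure S"
    then obtain x' where x': "x' \<in> S" "dist x' x < e/4"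
      using \<open>e > 0\<close> unfolding closure_approachable by (meson divide_pos_pos zero_less_numeral)
    obtain y where y: "y \<in> K" "dist x' y \<le> e/4" using K(2) x'(1) by blast
    obtain z where z: "z \<in> k" "dist z y < e/4" using k(2) y(1) by auto
    have "dist z x < e"
      using dist_triangle[of z x y] dist_triangle[of y x x'] x' y z \<open>e > 0\<close>
      by (simp add: dist_commute)
    thus "x \<in> (\<Union>x\<in>k. ball x e)" using z(1) by auto
  qed
  thus "\<exists>k. finite k \<and> closure S \<subseteq> (\<Union>x\<in>k. ball x e)" using k(1) by blast
qed

text \<open>Orthogonal expansions need not converge absolutely, so summability is drawn from
  completeness. The hypothesis speaks of finite sets disjoint from \<open>G\<close> because
  Pythagoras estimates exactly such blocks.\<close>

lemma summable_on_Cauchy_criterion: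
  fixes f :: "'i \<Rightarrow> 'a::banach"
  assumes "\<And>e. e > 0 \<Longrightarrow> \<exists>G. finite G \<and> G \<subseteq> A \<and>
             (\<forall>F. finite F \<longrightarrow> F \<subseteq> A \<longrightarrow> F \<inter> G = {} \<longrightarrow> norm (sum f F) \<le> e)"
  shows "f summable_on A"
proof -
  have "\<exists>P. eventually P (finite_subsets_at_top A) \<and>
              (\<forall>F F'. P F \<and> P F' \<longrightarrow> dist (sum f F) (sum f F') < e)" if "e > 0" for e
  proof -
    obtain G where G: "finite G" "G \<subseteq> A"
      "\<And>F. finite F \<Longrightarrow> F \<subseteq> A \<Longrightarrow> F \<inter> G = {} \<Longrightarrow> norm (sum f F) \<le> e/4"
      using assms[of "e/4"] \<open>e > 0\<close> by auto
    define P where "P F \<longleftrightarrow> finite F \<and> G \<subseteq> F \<and> F \<subseteq> A" for F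
    have "eventually P (finite_subsets_at_top A)"
      unfolding eventually_finite_subsets_at_top P_def using G by blast
    moreover have "dist (sum f F) (sum f F') < e" if "P F" "P F'" for F F'
    proof -
      have *: "norm (sum f F - sum f G) \<le> e/4" if "P F" for F
        using G(3)[of "F - G"] that unfolding P_def by (auto simp: sum_diff)
      have "dist (sum f F) (sum f F') \<le> dist (sum f F) (sum f G) + dist (sum f F') (sum f G)"
        by (rule dist_triangle2)
      also have "\<dots> \<le> e/4 + e/4"
        unfolding dist_norm by (intro add_mono * that)
      finally show ?thesis using \<open>e > 0\<close> by simp
    qed
    ultimately show ?thesis by blast
  qed
  hence "cauchy_filter (filtermap (sum f) (finite_subsets_at_top A))"
    by (simp add: cauchy_filter_metric_filtermap)
  moreover have "complete (UNIV::'a set)"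
    by (meson Cauchy_convergent UNIV_I complete_def convergent_def)
  ultimately obtain L where "(sum f \<longlongrightarrow> L) (finite_subsets_at_top A)"
    using complete_uniform[where S=UNIV] by (force simp add: filterlim_def)
  thus ?thesis using summable_on_def has_sum_def by blast
qed

lemma has_sum_approx_complement:
  fixes f :: "'i \<Rightarrow> real"
  assumes "(f has_sum s) A" "\<And>i. i \<in> A \<Longrightarrow> 0 \<le> f i" "e > 0"
  shows "\<exists>G. finite G \<and> G \<subseteq> A \<and> (\<forall>F. finite F \<longrightarrow> F \<subseteq> A \<longrightarrow> F \<inter> G = {} \<longrightarrow> sum f F \<le> e)"
proof -
  obtain G where G: "finite G" "G \<subseteq> A" "dist (sum f G) s \<le> e"
    using has_sum_finite_approximation[OF assms(1,3)] by blast
  have "sum f F \<le> e" if F: "finite F" "F \<subseteq> A" "F \<inter> G = {}" for F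
  proof -
    have "sum f (F \<union> G) \<le> s"
      by (rule has_sum_mono2[OF has_sum_finite assms(1)]) (use F G assms(2) in auto)
    thus ?thesis using F G by (simp add: sum.union_disjoint dist_real_def)
  qed
  thus ?thesis using G by blast
qed

text \<open>Totality is stated as a trivial orthogonal complement, not as a dense span: in this form
  it can be verified coordinatewise for the eigenvectors of \<open>D\<close>.\<close>

locale onb =
  fixes I :: "'i set" and e :: "'i \<Rightarrow> 'h::complex_hilbert"
  assumes orthonormal: "\<And>i j. i \<in> I \<Longrightarrow> j \<in> I \<Longrightarrow> cinner (e i) (e j) = (if i = j then 1 else 0)"
    and total: "\<And>x. (\<And>i. i \<in> I \<Longrightarrow> cinner (e i) x = 0) \<Longrightarrow> x = 0"
begin

text \<open>Extending the coordinates by zero outside \<open>I\<close> makes shifts that leave the index set total.\<close>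

definition coef :: "'h \<Rightarrow> 'i \<Rightarrow> complex" where
  "coef x i = (if i \<in> I then cinner (e i) x else 0)"

lemma coef_add: "coef (x + y) i = coef x i + coef y i"
  by (simp add: coef_def cinner_add_right)

lemma coef_diff: "coef (x - y) i = coef x i - coef y i"
  by (simp add: coef_def cinner_diff_right)

lemma coef_scaleC: "coef (c *\<^sub>C x) i = c * coef x i"
  by (simp add: coef_def cinner_scaleC_right)

lemma coef_scaleR: "coef (c *\<^sub>R x) i = of_real c * coef x i"
  by (simp add: coef_def cinner_scaleR_right)

lemma coef_zero [simp]: "coef 0 i = 0"
  by (simp add: coef_def)

lemma coef_sum: "coef (sum f F) i = (\<Sum>j\<in>F. coef (f j) i)"
  by (simp add: coef_def cinner_sum_right)

lemma coef_outside: "i \<notin> I \<Longrightarrow> coef x i = 0"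
  by (simp add: coef_def)

lemma coef_basis: "j \<in> I \<Longrightarrow> coef (e j) i = (if i = j then 1 else 0)"
  by (auto simp: coef_def orthonormal)

lemma coef_eqI: "(\<And>i. i \<in> I \<Longrightarrow> coef x i = coef y i) \<Longrightarrow> x = y"
  using total[of "x - y"] by (simp add: coef_def cinner_diff_right)

lemma norm_basis: "i \<in> I \<Longrightarrow> norm (e i) = 1"
  using cinner_self[of "e i"] orthonormal[of i i]
  by (metis norm_ge_zero of_real_eq_1_iff one_power2 power2_eq_iff_nonneg zero_le_one)

lemma cmod_coef_le: "cmod (coef x i) \<le> norm x"
  using cmod_cinner_le[of "e i" x] by (cases "i \<in> I") (simp_all add: coef_def norm_basis)

lemma norm_finite_combination:
  assumes "finite F" "F \<subseteq> I"
  shows "(norm (\<Sum>i\<in>F. c i *\<^sub>C e i))\<^sup>2 = (\<Sum>i\<in>F. (cmod (c i))\<^sup>2)"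
proof -
  have "complex_of_real ((norm (\<Sum>i\<in>F. c i *\<^sub>C e i))\<^sup>2)
      = (\<Sum>i\<in>F. \<Sum>j\<in>F. cnj (c i) * c j * (if i = j then 1 else 0))"
    unfolding cinner_self[symmetric] cinner_sum_left cinner_sum_right
    using assms(2) by (intro sum.cong refl)
      (simp add: cinner_scaleC_left cinner_scaleC_right orthonormal subset_iff)
  also have "\<dots> = (\<Sum>i\<in>F. cnj (c i) * c i)"
    using assms(1) by (intro sum.cong refl) (simp add: if_distrib cong: if_cong)
  also have "\<dots> = complex_of_real (\<Sum>i\<in>F. (cmod (c i))\<^sup>2)"
    by (simp only: of_real_sum complex_norm_square mult.commute)
  finally show ?thesis by (simp only: of_real_eq_iff)
qed

lemma bessel:
  assumes "finite F" "F \<subseteq> I"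
  shows "(\<Sum>i\<in>F. (cmod (coef x i))\<^sup>2) \<le> (norm x)\<^sup>2"
proof -
  define y where "y = (\<Sum>i\<in>F. coef x i *\<^sub>C e i)"
  have yx: "cinner y x = complex_of_real (\<Sum>i\<in>F. (cmod (coef x i))\<^sup>2)"
    unfolding y_def cinner_sum_left of_real_sum
  proof (intro sum.cong refl)
    fix i assume "i \<in> F"
    hence "cinner (e i) x = coef x i" using assms by (auto simp: coef_def)
    thus "cinner (coef x i *\<^sub>C e i) x = complex_of_real ((cmod (coef x i))\<^sup>2)"
      by (simp only: cinner_scaleC_left complex_norm_square mult.commute)
  qed
  have yy: "cinner y y = complex_of_real (\<Sum>i\<in>F. (cmod (coef x i))\<^sup>2)"
    using norm_finite_combination[OF assms, of "coef x"] by (simp add: cinner_self y_def del: of_real_power)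
  have xy: "cinner x y = complex_of_real (\<Sum>i\<in>F. (cmod (coef x i))\<^sup>2)"
    using yx cinner_commute[of x y] by simp
  have "cinner (x - y) (x - y)
      = complex_of_real ((norm x)\<^sup>2 - (\<Sum>i\<in>F. (cmod (coef x i))\<^sup>2))"
    unfolding cinner_diff_left cinner_diff_right yx yy xy cinner_self[of x] by simp
  hence "(norm (x - y))\<^sup>2 = (norm x)\<^sup>2 - (\<Sum>i\<in>F. (cmod (coef x i))\<^sup>2)"
    by (simp only: cinner_self of_real_eq_iff)
  thus ?thesis by (metis diff_ge_0_iff_ge zero_le_power2)
qed

lemma summable_coef: "(\<lambda>i. (cmod (coef x i))\<^sup>2) summable_on I"
proof (rule nonneg_bdd_above_summable_on)
  show "bdd_above (sum (\<lambda>i. (cmod (coef x i))\<^sup>2) ` {F. F \<subseteq> I \<and> finite F})"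
    by (rule bdd_aboveI2[where M = "(norm x)\<^sup>2"]) (simp add: bessel)
qed simp

lemma riesz_fischer_has_sum:
  assumes "(\<lambda>i. (cmod (c i))\<^sup>2) summable_on I"
  shows "\<exists>x. ((\<lambda>i. c i *\<^sub>C e i) has_sum x) I \<and> (\<forall>i\<in>I. coef x i = c i)"
proof -
  have "(\<lambda>i. c i *\<^sub>C e i) summable_on I"
  proof (rule summable_on_Cauchy_criterion)
    \<comment> \<open>The tails are taken at level d^2, since Pythagoras turns a sum of squares into
      a squared norm.\<close>
    fix d :: real assume "d > 0"
    then obtain G where G: "finite G" "G \<subseteq> I"
      "\<And>F. finite F \<Longrightarrow> F \<subseteq> I \<Longrightarrow> F \<inter> G = {} \<Longrightarrow> (\<Sum>i\<in>F. (cmod (c i))\<^sup>2) \<le> d\<^sup>2"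
      using has_sum_approx_complement[OF has_sum_infsum[OF assms], of "d\<^sup>2"] by auto
    have "norm (\<Sum>i\<in>F. c i *\<^sub>C e i) \<le> d" if "finite F" "F \<subseteq> I" "F \<inter> G = {}" for F
    proof (rule power2_le_imp_le)
      show "(norm (\<Sum>i\<in>F. c i *\<^sub>C e i))\<^sup>2 \<le> d\<^sup>2"
        using G(3)[OF that] norm_finite_combination[OF that(1,2), of c] by simp
      show "0 \<le> d" using \<open>d > 0\<close> by simp
    qed
    thus "\<exists>G. finite G \<and> G \<subseteq> I \<and> (\<forall>F. finite F \<longrightarrow> F \<subseteq> I \<longrightarrow> F \<inter> G = {} \<longrightarrow>
        norm (\<Sum>i\<in>F. c i *\<^sub>C e i) \<le> d)"
      using G by blast
  qed
  then obtain x where x: "((\<lambda>i. c i *\<^sub>C e i) has_sum x) I"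
    by (auto simp: summable_on_def)
  have "coef x j = c j" if "j \<in> I" for j
  proof -
    have "((\<lambda>i. cinner (e j) (c i *\<^sub>C e i)) has_sum cinner (e j) x) I"
      by (rule has_sum_bounded_linear[OF bounded_linear_cinner_right x])
    moreover have "((\<lambda>i. cinner (e j) (c i *\<^sub>C e i)) has_sum c j) I"
      by (rule has_sum_finite_neutralI[of "{j}"])
        (use that in \<open>auto simp: cinner_scaleC_right orthonormal\<close>)
    ultimately show ?thesis using that has_sum_unique by (auto simp: coef_def)
  qed
  thus ?thesis using x by blast
qed

lemma riesz_fischer:
  assumes "(\<lambda>i. (cmod (c i))\<^sup>2) summable_on I"
  obtains x where "\<And>i. i \<in> I \<Longrightarrow> coef x i = c i"
  using riesz_fischer_has_sum[OF assms] by blast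

lemma has_sum_coef: "((\<lambda>i. coef x i *\<^sub>C e i) has_sum x) I"
  using riesz_fischer_has_sum[OF summable_coef[of x]] coef_eqI by metis

lemma parseval: "((\<lambda>i. cnj (coef x i) * coef y i) has_sum cinner x y) I"
proof -
  have "((\<lambda>i. cinner x (coef y i *\<^sub>C e i)) has_sum cinner x y) I"
    by (rule has_sum_bounded_linear[OF bounded_linear_cinner_right has_sum_coef])
  moreover have "cinner x (coef y i *\<^sub>C e i) = cnj (coef x i) * coef y i" if "i \<in> I" for i
    using that cinner_commute[of x "e i"] by (simp add: cinner_scaleC_right coef_def)
  ultimately show ?thesis by (simp cong: has_sum_cong)
qed

lemma parseval_norm: "((\<lambda>i. (cmod (coef x i))\<^sup>2) has_sum (norm x)\<^sup>2) I"
proof -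
  have "((\<lambda>i. complex_of_real ((cmod (coef x i))\<^sup>2)) has_sum complex_of_real ((norm x)\<^sup>2)) I"
    using parseval[of x x] by (simp only: complex_norm_square cinner_self mult.commute)
  thus ?thesis by (simp only: has_sum_of_real_iff)
qed

lemma norm_le_if_coef_le:
  assumes "0 \<le> M" "\<And>i. i \<in> I \<Longrightarrow> cmod (coef y i) \<le> M * cmod (coef x i)"
  shows "norm y \<le> M * norm x"
proof -
  have "(norm y)\<^sup>2 \<le> M\<^sup>2 * (norm x)\<^sup>2"
  proof (rule has_sum_mono[OF parseval_norm has_sum_cmult_right[OF parseval_norm]])
    fix i assume "i \<in> I"
    thus "(cmod (coef y i))\<^sup>2 \<le> M\<^sup>2 * (cmod (coef x i))\<^sup>2"
      using assms(2) by (simp add: power_mono flip: power_mult_distrib)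
  qed
  hence "(norm y)\<^sup>2 \<le> (M * norm x)\<^sup>2" by (simp add: power_mult_distrib)
  thus ?thesis by (rule power2_le_imp_le) (simp add: assms(1))
qed

text \<open>A weighted partial shift; the inverse of the map on indices is used, as vectors are described
  by coordinates.\<close>

definition wshift :: "('i \<Rightarrow> 'i) \<Rightarrow> ('i \<Rightarrow> complex) \<Rightarrow> 'h \<Rightarrow> 'h" where
  "wshift \<phi> a x = (SOME y. \<forall>j\<in>I. coef y j = a j * coef x (\<phi> j))"

text \<open>The weight is constrained only where \<open>\<phi> j\<close> stays in \<open>I\<close>;
  elsewhere \<open>coef x (\<phi> j)\<close> is 0, and a coefficient formula may take any value
  there.\<close>

definition shift_bounded :: "('i \<Rightarrow> 'i) \<Rightarrow> ('i \<Rightarrow> complex) \<Rightarrow> bool" where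
  "shift_bounded \<phi> a \<longleftrightarrow> inj_on \<phi> I \<and> (\<exists>M. \<forall>j\<in>I. \<phi> j \<in> I \<longrightarrow> cmod (a j) \<le> M)"

text \<open>Bessel's inequality, after reindexing along the injective \<open>\<phi>\<close>. The
  absolute value of \<open>M\<close> appears because \<open>M\<close> may be negative if no index
  satisfies the premise.\<close>

lemma wshift_exists:
  assumes inj: "inj_on \<phi> I" and M: "\<And>j. j \<in> I \<Longrightarrow> \<phi> j \<in> I \<Longrightarrow> cmod (a j) \<le> M"
  shows "\<exists>y. (\<forall>j\<in>I. coef y j = a j * coef x (\<phi> j)) \<and> norm y \<le> \<bar>M\<bar> * norm x"
proof -
  have fin: "(\<Sum>j\<in>F. (cmod (a j * coef x (\<phi> j)))\<^sup>2) \<le> (\<bar>M\<bar> * norm x)\<^sup>2" if F: "finite F" "F \<subseteq> I" for F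
  proof -
    define F' where "F' = {j \<in> F. \<phi> j \<in> I}"
    have "(\<Sum>j\<in>F. (cmod (a j * coef x (\<phi> j)))\<^sup>2) = (\<Sum>j\<in>F'. (cmod (a j * coef x (\<phi> j)))\<^sup>2)"
      using F by (intro sum.mono_neutral_right) (auto simp: F'_def coef_outside)
    also have "\<dots> \<le> (\<Sum>j\<in>F'. M\<^sup>2 * (cmod (coef x (\<phi> j)))\<^sup>2)"
    proof (rule sum_mono)
      fix j assume "j \<in> F'"
      hence "cmod (a j) \<le> \<bar>M\<bar>" using M[of j] F by (force simp: F'_def)
      hence "(cmod (a j))\<^sup>2 \<le> M\<^sup>2" using abs_le_square_iff[of "cmod (a j)" M] by simp
      thus "(cmod (a j * coef x (\<phi> j)))\<^sup>2 \<le> M\<^sup>2 * (cmod (coef x (\<phi> j)))\<^sup>2"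
        by (simp add: norm_mult power_mult_distrib mult_right_mono)
    qed
    also have "\<dots> = M\<^sup>2 * (\<Sum>i\<in>\<phi> ` F'. (cmod (coef x i))\<^sup>2)"
      using inj F by (subst sum.reindex) (auto simp: F'_def sum_distrib_left inj_on_def)
    also have "\<dots> \<le> M\<^sup>2 * (norm x)\<^sup>2"
      using F by (intro mult_left_mono bessel) (auto simp: F'_def)
    finally show ?thesis by (simp add: power_mult_distrib)
  qed
  have sm: "(\<lambda>j. (cmod (a j * coef x (\<phi> j)))\<^sup>2) summable_on I"
  proof (rule nonneg_bdd_above_summable_on)
    show "bdd_above (sum (\<lambda>j. (cmod (a j * coef x (\<phi> j)))\<^sup>2) ` {F. F \<subseteq> I \<and> finite F})"
      by (rule bdd_aboveI2[where M = "(\<bar>M\<bar> * norm x)\<^sup>2"]) (use fin in blast)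
  qed simp
  obtain y where y: "\<And>j. j \<in> I \<Longrightarrow> coef y j = a j * coef x (\<phi> j)"
    using riesz_fischer[OF sm] by blast
  have "(norm y)\<^sup>2 \<le> (\<bar>M\<bar> * norm x)\<^sup>2"
  proof (rule has_sum_le_finite_sums[OF parseval_norm])
    fix F assume F: "finite F" "F \<subseteq> I"
    have "(\<Sum>i\<in>F. (cmod (coef y i))\<^sup>2) = (\<Sum>j\<in>F. (cmod (a j * coef x (\<phi> j)))\<^sup>2)"
      using F(2) by (intro sum.cong refl) (simp add: y subset_iff del: norm_mult)
    thus "(\<Sum>i\<in>F. (cmod (coef y i))\<^sup>2) \<le> (\<bar>M\<bar> * norm x)\<^sup>2" using fin[OF F] by simp
  qed
  hence "norm y \<le> \<bar>M\<bar> * norm x" by (rule power2_le_imp_le) simp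
  thus ?thesis using y by blast
qed

lemma coef_wshift:
  assumes "shift_bounded \<phi> a" "j \<in> I"
  shows "coef (wshift \<phi> a x) j = a j * coef x (\<phi> j)"
proof -
  obtain M where "inj_on \<phi> I" "\<And>j. j \<in> I \<Longrightarrow> \<phi> j \<in> I \<Longrightarrow> cmod (a j) \<le> M"
    using assms(1) by (auto simp: shift_bounded_def)
  hence "\<exists>y. \<forall>j\<in>I. coef y j = a j * coef x (\<phi> j)" using wshift_exists by metis
  hence "\<forall>j\<in>I. coef (wshift \<phi> a x) j = a j * coef x (\<phi> j)"
    unfolding wshift_def by (rule someI_ex)
  thus ?thesis using assms(2) by blast
qed

lemma bounded_operator_wshift:
  assumes "shift_bounded \<phi> a"
  shows "bounded_operator (wshift \<phi> a)"
proof -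
  note c = coef_wshift[OF assms]
  obtain M where M: "inj_on \<phi> I" "\<And>j. j \<in> I \<Longrightarrow> \<phi> j \<in> I \<Longrightarrow> cmod (a j) \<le> M"
    using assms by (auto simp: shift_bounded_def)
  have sc: "wshift \<phi> a (r *\<^sub>C x) = r *\<^sub>C wshift \<phi> a x" for r x
    by (rule coef_eqI) (simp add: c coef_scaleC)
  have "bounded_linear (wshift \<phi> a)"
  proof (rule bounded_linear_intro)
    show "wshift \<phi> a (x + y) = wshift \<phi> a x + wshift \<phi> a y" for x y
      by (rule coef_eqI) (simp add: c coef_add algebra_simps)
    show "wshift \<phi> a (r *\<^sub>R x) = r *\<^sub>R wshift \<phi> a x" for r x
      by (simp add: scaleR_scaleC sc)
    fix x
    obtain y where y: "\<forall>j\<in>I. coef y j = a j * coef x (\<phi> j)" "norm y \<le> \<bar>M\<bar> * norm x"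
      using wshift_exists[where \<phi> = \<phi> and a = a and M = M and x = x] M by metis
    have "wshift \<phi> a x = y" by (rule coef_eqI) (simp add: c y)
    thus "norm (wshift \<phi> a x) \<le> norm x * \<bar>M\<bar>" using y(2) by (simp add: mult.commute)
  qed
  thus ?thesis using sc by (simp add: bounded_operator_def)
qed

lemma bounded_operator_eqI:
  assumes "bounded_operator f" "bounded_operator g" "\<And>i. i \<in> I \<Longrightarrow> f (e i) = g (e i)"
  shows "f = g"
proof
  fix x
  have "((\<lambda>i. h (coef x i *\<^sub>C e i)) has_sum h x) I" if "bounded_operator h" for h
    by (rule has_sum_bounded_linear[OF bounded_operator_linear[OF that] has_sum_coef])
  from this[OF assms(1)] this[OF assms(2)] show "f x = g x"
    using assms by (simp add: bounded_operator_scaleC has_sum_unique cong: has_sum_cong)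
qed

lemma closure_superset_basis:
  assumes "\<And>F c. finite F \<Longrightarrow> F \<subseteq> I \<Longrightarrow> (\<Sum>i\<in>F. c i *\<^sub>C e i) \<in> S"
  shows "closure S = UNIV"
proof -
  have "x \<in> closure S" for x
    unfolding closure_approachable
  proof (intro allI impI)
    fix d :: real assume "d > 0"
    then obtain F where F: "finite F" "F \<subseteq> I" "dist (\<Sum>i\<in>F. coef x i *\<^sub>C e i) x \<le> d/2"
      using has_sum_finite_approximation[OF has_sum_coef, of "d/2" x] by auto
    thus "\<exists>y\<in>S. dist y x < d" using assms[OF F(1,2), of "coef x"] F(3) \<open>d > 0\<close>
      by (intro bexI[of _ "\<Sum>i\<in>F. coef x i *\<^sub>C e i"]) auto
  qed
  thus ?thesis by blast
qed

text \<open>Square-summability is implicit: x lies in the domain exactly if some vector has the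
  prescribed coordinates. This is the maximal domain, which makes the operator self-adjoint for real
  \<open>\<nu>\<close>.\<close>

definition Diag :: "('i \<Rightarrow> complex) \<Rightarrow> 'h rel" where
  "Diag \<nu> = {(x, y). \<forall>i\<in>I. coef y i = \<nu> i * coef x i}"

lemma mem_Diag: "(x, y) \<in> Diag \<nu> \<longleftrightarrow> (\<forall>i\<in>I. coef y i = \<nu> i * coef x i)"
  by (simp add: Diag_def)

lemma Diag_cong: "(\<And>i. i \<in> I \<Longrightarrow> \<nu> i = \<mu> i) \<Longrightarrow> Diag \<nu> = Diag \<mu>"
  by (auto simp: Diag_def)

lemma Diag_basis: "i \<in> I \<Longrightarrow> (e i, \<nu> i *\<^sub>C e i) \<in> Diag \<nu>"
  by (simp add: mem_Diag coef_scaleC coef_basis)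

lemma closure_Domain_Diag: "closure (Domain (Diag \<nu>)) = UNIV"
proof (rule closure_superset_basis)
  fix F c assume F: "finite F" "F \<subseteq> I"
  have "((\<Sum>i\<in>F. c i *\<^sub>C e i), (\<Sum>i\<in>F. (\<nu> i * c i) *\<^sub>C e i)) \<in> Diag \<nu>"
    unfolding mem_Diag using F
    by (auto simp: coef_sum coef_scaleC coef_basis sum_distrib_left subset_iff intro!: sum.cong)
  thus "(\<Sum>i\<in>F. c i *\<^sub>C e i) \<in> Domain (Diag \<nu>)" by blast
qed

lemma Diag_symmetric:
  assumes "\<And>i. i \<in> I \<Longrightarrow> cnj (\<nu> i) = \<nu> i" "(x, y) \<in> Diag \<nu>" "(x', y') \<in> Diag \<nu>"
  shows "cinner x y' = cinner y x'"
proof -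
  have "((\<lambda>i. cnj (coef x i) * coef y' i) has_sum cinner x y') I"
       "((\<lambda>i. cnj (coef y i) * coef x' i) has_sum cinner y x') I"
    by (rule parseval)+
  moreover have "cnj (coef x i) * coef y' i = cnj (coef y i) * coef x' i" if "i \<in> I" for i
    using assms that by (simp add: mem_Diag)
  ultimately show ?thesis by (simp add: has_sum_unique cong: has_sum_cong)
qed

text \<open>Testing a pair of the adjoint against the single vectors \<open>e i\<close> already
  forces the diagonal relation, so the adjoint is no larger.\<close>

lemma self_adjoint_Diag:
  assumes "\<And>i. i \<in> I \<Longrightarrow> cnj (\<nu> i) = \<nu> i"
  shows "self_adjoint (Diag \<nu>)"
proof -
  have "adjoint_op (Diag \<nu>) \<subseteq> Diag \<nu>"
  proof clarify
    fix y z assume *: "(y, z) \<in> adjoint_op (Diag \<nu>)"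
    have "coef z i = \<nu> i * coef y i" if "i \<in> I" for i
    proof -
      have "cinner y (\<nu> i *\<^sub>C e i) = cinner z (e i)"
        using * Diag_basis[OF that] by (auto simp: adjoint_op_def)
      hence "cnj (cinner z (e i)) = cnj (\<nu> i) * cnj (cinner y (e i))"
        by (metis cinner_scaleC_right complex_cnj_mult)
      thus ?thesis using that assms cinner_commute by (metis coef_def)
    qed
    thus "(y, z) \<in> Diag \<nu>" by (simp add: mem_Diag)
  qed
  moreover have "Diag \<nu> \<subseteq> adjoint_op (Diag \<nu>)"
    using Diag_symmetric[OF assms] by (auto simp: adjoint_op_def)
  ultimately show ?thesis by (auto simp: self_adjoint_def closure_Domain_Diag)
qed

text \<open>A self-adjoint operator has no proper symmetric extension.\<close>

lemma self_adjoint_eq_Diag: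
  assumes T: "self_adjoint T" and "\<And>i. i \<in> I \<Longrightarrow> cnj (\<nu> i) = \<nu> i"
    and ev: "\<And>i. i \<in> I \<Longrightarrow> (e i, \<nu> i *\<^sub>C e i) \<in> T"
  shows "T = Diag \<nu>"
proof -
  have adj: "adjoint_op T = T" using T by (simp add: self_adjoint_def)
  have sub: "T \<subseteq> Diag \<nu>"
  proof clarify
    fix x y assume "(x, y) \<in> T"
    hence "(x, y) \<in> adjoint_op T" by (simp add: adj)
    hence *: "\<forall>(u, w) \<in> T. cinner x w = cinner y u" by (simp add: adjoint_op_def)
    have "coef y i = \<nu> i * coef x i" if "i \<in> I" for i
    proof -
      have "cinner x (\<nu> i *\<^sub>C e i) = cinner y (e i)" using * ev[OF that] by auto
      hence "cnj (cinner y (e i)) = cnj (\<nu> i) * cnj (cinner x (e i))"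
        by (metis cinner_scaleC_right complex_cnj_mult)
      thus ?thesis using that assms(2) cinner_commute by (metis coef_def)
    qed
    thus "(x, y) \<in> Diag \<nu>" by (simp add: mem_Diag)
  qed
  \<comment> \<open>A smaller relation has a larger adjoint: \<open>T\<close> lies in the symmetric
    \<open>Diag \<nu>\<close>, so \<open>Diag \<nu>\<close> lies in the adjoint of \<open>T\<close>,
    which is \<open>T\<close>.\<close>
  have "Diag \<nu> \<subseteq> adjoint_op T"
    using Diag_symmetric[OF assms(2)] sub by (auto simp: adjoint_op_def)
  thus ?thesis using sub adj by auto
qed

text \<open>The composite has its natural domain, so the point is the inclusion from right to left:
  an intermediate vector must be found from x and its image under the squared values.\<close>

lemma Diag_O_Diag:
  "Diag (\<lambda>i. complex_of_real (\<nu> i)) O Diag (\<lambda>i. complex_of_real (\<nu> i)) = Diag (\<lambda>i. complex_of_real ((\<nu> i)\<^sup>2))"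
proof
  show "Diag (\<lambda>i. complex_of_real (\<nu> i)) O Diag (\<lambda>i. complex_of_real (\<nu> i)) \<subseteq> Diag (\<lambda>i. complex_of_real ((\<nu> i)\<^sup>2))"
    by (auto simp: mem_Diag power2_eq_square)
  show "Diag (\<lambda>i. complex_of_real ((\<nu> i)\<^sup>2)) \<subseteq> Diag (\<lambda>i. complex_of_real (\<nu> i)) O Diag (\<lambda>i. complex_of_real (\<nu> i))"
  proof clarify
    fix x z assume xz: "(x, z) \<in> Diag (\<lambda>i. complex_of_real ((\<nu> i)\<^sup>2))"
    have "(\<lambda>i. (cmod (complex_of_real (\<nu> i) * coef x i))\<^sup>2) summable_on I"
    proof (rule summable_on_comparison_test)
      show "(\<lambda>i. (cmod (coef x i))\<^sup>2 + (cmod (coef z i))\<^sup>2) summable_on I"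
        by (intro summable_on_add summable_coef)
      fix i assume "i \<in> I"
      define a where "a = (\<nu> i)\<^sup>2"
      \<comment> \<open>With a the squared value, this bounds the squared intermediate coordinate by
        those of x and z, both of which are summable.\<close>
      have "a * 1 \<le> 1 + a\<^sup>2" using sum_squares_ge_zero[of "a - 1" a] by (simp add: power2_eq_square algebra_simps)
      have "(cmod (complex_of_real (\<nu> i) * coef x i))\<^sup>2 = a * (cmod (coef x i))\<^sup>2"
        by (simp add: norm_mult power_mult_distrib a_def)
      also have "\<dots> \<le> (1 + a\<^sup>2) * (cmod (coef x i))\<^sup>2"
        using \<open>a * 1 \<le> 1 + a\<^sup>2\<close> by (intro mult_right_mono) auto
      also have "\<dots> = (cmod (coef x i))\<^sup>2 + (cmod (coef z i))\<^sup>2"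
        using xz \<open>i \<in> I\<close> by (simp add: mem_Diag norm_mult norm_power power_mult_distrib a_def algebra_simps)
      finally show "(cmod (complex_of_real (\<nu> i) * coef x i))\<^sup>2 \<le> (cmod (coef x i))\<^sup>2 + (cmod (coef z i))\<^sup>2" .
    qed auto
    then obtain y where y: "\<And>i. i \<in> I \<Longrightarrow> coef y i = complex_of_real (\<nu> i) * coef x i"
      using riesz_fischer[of "\<lambda>i. complex_of_real (\<nu> i) * coef x i"] by blast
    have "(x, y) \<in> Diag (\<lambda>i. complex_of_real (\<nu> i))" "(y, z) \<in> Diag (\<lambda>i. complex_of_real (\<nu> i))"
      using y xz by (auto simp: mem_Diag power2_eq_square)
    thus "(x, z) \<in> Diag (\<lambda>i. complex_of_real (\<nu> i)) O Diag (\<lambda>i. complex_of_real (\<nu> i))" by blast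
  qed
qed

lemma positive_op_Diag:
  assumes "\<And>i. i \<in> I \<Longrightarrow> 0 \<le> \<nu> i"
  shows "positive_op (Diag (\<lambda>i. complex_of_real (\<nu> i)))"
  unfolding positive_op_def
proof (intro conjI ballI)
  show "self_adjoint (Diag (\<lambda>i. complex_of_real (\<nu> i)))" by (rule self_adjoint_Diag) simp
  fix p assume "p \<in> Diag (\<lambda>i. complex_of_real (\<nu> i))"
  then obtain x y where p: "p = (x, y)" "(x, y) \<in> Diag (\<lambda>i. complex_of_real (\<nu> i))"
    by (cases p) auto
  have "((\<lambda>i. Re (cnj (coef x i) * coef y i)) has_sum Re (cinner x y)) I"
    by (rule has_sum_Re[OF parseval])
  moreover have "0 \<le> Re (cnj (coef x i) * coef y i)" if "i \<in> I" for i
  proof -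
    have "cnj (coef x i) * coef y i = complex_of_real (\<nu> i * (cmod (coef x i))\<^sup>2)"
    proof -
      have "coef y i = complex_of_real (\<nu> i) * coef x i" using p(2) that by (simp add: mem_Diag)
      thus ?thesis by (simp only: of_real_mult complex_norm_square mult_ac)
    qed
    thus ?thesis using assms[OF that] by simp
  qed
  ultimately show "case p of (x, y) \<Rightarrow> 0 \<le> Re (cinner x y)"
    using has_sum_nonneg p(1) by fastforce
qed

text \<open>Uniqueness: if \<open>R e = y\<close> and \<open>R y = \<nu>\<^sup>2 e\<close>, then \<open>y - \<nu> e\<close> is an eigenvector of \<open>R\<close> for
  the value \<open>- \<nu>\<close>.\<close>

lemma positive_root_eigenvector:
  assumes R: "positive_op R" and "0 \<le> \<nu>" "(u, y) \<in> R" "(y, complex_of_real (\<nu>\<^sup>2) *\<^sub>C u) \<in> R"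
  shows "y = complex_of_real \<nu> *\<^sub>C u"
proof -
  have adj: "adjoint_op R = R" using R by (simp add: positive_op_def self_adjoint_def)
  have pos: "0 \<le> Re (cinner x z)" if "(x, z) \<in> R" for x z
    using R that by (auto simp: positive_op_def)
  have sym: "cinner x z' = cinner z x'" if "(x, z) \<in> R" "(x', z') \<in> R" for x z x' z'
    using adj that unfolding adjoint_op_def by blast
  show ?thesis
  proof (cases "\<nu> = 0")
    \<comment> \<open>Symmetry of \<open>R\<close> on the pairs (u, y) and (y, 0) gives <y, y> = <u,
      0> = 0.\<close>
    case True
    thus ?thesis using sym[OF assms(3,4)] by (simp add: cinner_self_eq_0)
  next
    case False
    define z where "z = y - complex_of_real \<nu> *\<^sub>C u"
    \<comment> \<open>Membership in \<open>R\<close> is shown through the adjoint. Formally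
      \<open>R\<close> sends y - \<nu> u to \<nu>^2 u - \<nu> y, which is - \<nu> (y - \<nu>
      u).\<close>
    have "(z, - complex_of_real \<nu> *\<^sub>C z) \<in> adjoint_op R"
      unfolding adjoint_op_def
    proof clarify
      fix x w assume xw: "(x, w) \<in> R"
      have "cinner z w = complex_of_real (\<nu>\<^sup>2) * cinner u x - complex_of_real \<nu> * cinner y x"
        using sym[OF assms(3) xw] sym[OF assms(4) xw]
        by (simp add: z_def cinner_diff_left cinner_scaleC_left)
      also have "\<dots> = cinner (- complex_of_real \<nu> *\<^sub>C z) x"
        by (simp add: z_def cinner_diff_left cinner_scaleC_left algebra_simps power2_eq_square)
      finally show "cinner z w = cinner (- complex_of_real \<nu> *\<^sub>C z) x" .
    qed
    hence "0 \<le> Re (cinner z (- complex_of_real \<nu> *\<^sub>C z))" using adj pos by blast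
    hence "\<nu> * (norm z)\<^sup>2 \<le> 0"
      by (simp add: cinner_scaleC_right cinner_self cinner_minus_right flip: of_real_power of_real_mult)
    moreover have "\<nu> > 0" using False assms(2) by simp
    ultimately have "z = 0" by (simp add: mult_le_0_iff not_le)
    thus ?thesis by (simp add: z_def)
  qed
qed

text \<open>A competing root \<open>R\<close> is not known to be diagonal. But its square is, so
  each \<open>e i\<close> lies in the domain of \<open>R O R\<close> and thus has an image under
  \<open>R\<close>; positivity makes it an eigenvector, and an eigenbasis determines
  \<open>R\<close>.\<close>

lemma sqrt_op_Diag:
  assumes "\<And>i. i \<in> I \<Longrightarrow> 0 \<le> \<nu> i"
  shows "sqrt_op (Diag (\<lambda>i. complex_of_real ((\<nu> i)\<^sup>2))) = Diag (\<lambda>i. complex_of_real (\<nu> i))"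
  unfolding sqrt_op_def
proof (rule the_equality)
  show "positive_op (Diag (\<lambda>i. complex_of_real (\<nu> i))) \<and>
    Diag (\<lambda>i. complex_of_real (\<nu> i)) O Diag (\<lambda>i. complex_of_real (\<nu> i)) = Diag (\<lambda>i. complex_of_real ((\<nu> i)\<^sup>2))"
    using positive_op_Diag assms Diag_O_Diag by blast
  fix R assume R: "positive_op R \<and> R O R = Diag (\<lambda>i. complex_of_real ((\<nu> i)\<^sup>2))"
  show "R = Diag (\<lambda>i. complex_of_real (\<nu> i))"
  proof (rule self_adjoint_eq_Diag)
    show "self_adjoint R" using R by (simp add: positive_op_def)
    fix i assume i: "i \<in> I"
    hence "(e i, complex_of_real ((\<nu> i)\<^sup>2) *\<^sub>C e i) \<in> R O R" using Diag_basis[OF i] R by metis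
    then obtain y where "(e i, y) \<in> R" "(y, complex_of_real ((\<nu> i)\<^sup>2) *\<^sub>C e i) \<in> R" by blast
    thus "(e i, complex_of_real (\<nu> i) *\<^sub>C e i) \<in> R"
      using positive_root_eigenvector[of R "\<nu> i" "e i" y] R assms[OF i] by blast
  qed simp
qed

lemma abs_op_Diag:
  "abs_op (Diag (\<lambda>i. complex_of_real (\<nu> i))) = Diag (\<lambda>i. complex_of_real \<bar>\<nu> i\<bar>)"
proof -
  have "self_adjoint (Diag (\<lambda>i. complex_of_real (\<nu> i)))" by (rule self_adjoint_Diag) simp
  hence "abs_op (Diag (\<lambda>i. complex_of_real (\<nu> i))) = sqrt_op (Diag (\<lambda>i. complex_of_real (\<bar>\<nu> i\<bar>\<^sup>2)))"
    by (simp add: abs_op_def self_adjoint_def Diag_O_Diag)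
  thus ?thesis by (simp only: sqrt_op_Diag abs_ge_zero)
qed

lemma plus_scalar_Diag: "plus_scalar (Diag \<nu>) z = Diag (\<lambda>i. \<nu> i + z)"
proof -
  have "(x, y) \<in> plus_scalar (Diag \<nu>) z \<longleftrightarrow> (x, y - z *\<^sub>C x) \<in> Diag \<nu>" for x y
    unfolding plus_scalar_def by force
  thus ?thesis by (auto simp: mem_Diag coef_diff coef_scaleC algebra_simps)
qed

lemma converse_Diag:
  assumes "\<And>i. i \<in> I \<Longrightarrow> \<nu> i \<noteq> 0"
  shows "(Diag \<nu>)\<inverse> = Diag (\<lambda>i. inverse (\<nu> i))"
  using assms by (auto simp: mem_Diag field_simps)

text \<open>Bounded diagonal operators are the shifts along the identity; this connects graphs with
  operators given as functions.\<close>

lemma op_graph_wshift_id: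
  assumes "shift_bounded id b"
  shows "op_graph (wshift id b) = Diag b"
proof -
  have "y = wshift id b x" if "(x, y) \<in> Diag b" for x y
    using that by (intro coef_eqI) (simp add: mem_Diag coef_wshift[OF assms])
  thus ?thesis by (auto simp: op_graph_def mem_Diag coef_wshift[OF assms])
qed

section \<open>Compact diagonal operators and the dimension of eigenspaces\<close>

lemma compact_combinations:
  assumes "finite F"
  shows "compact {\<Sum>i\<in>F. c i *\<^sub>C e i |c. \<forall>i\<in>F. cmod (c i) \<le> M}"
  using assms
proof (induction F)
  case empty
  thus ?case by simp
next
  case (insert j F)
  have "{\<Sum>i\<in>insert j F. c i *\<^sub>C e i |c. \<forall>i\<in>insert j F. cmod (c i) \<le> M}
    = {x + y |x y. x \<in> (\<lambda>c. c *\<^sub>C e j) ` cball 0 M \<and> y \<in> {\<Sum>i\<in>F. c i *\<^sub>C e i |c. \<forall>i\<in>F. cmod (c i) \<le> M}}"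
    (is "?L = ?R")
  proof
    show "?L \<subseteq> ?R" using insert.hyps by fastforce
    show "?R \<subseteq> ?L"
    proof clarify
      fix a :: complex and c assume a: "a \<in> cball 0 M" and c: "\<forall>i\<in>F. cmod (c i) \<le> M"
      have "(\<Sum>i\<in>F. (c(j := a)) i *\<^sub>C e i) = (\<Sum>i\<in>F. c i *\<^sub>C e i)"
        using insert.hyps by (intro sum.cong) auto
      hence "a *\<^sub>C e j + (\<Sum>i\<in>F. c i *\<^sub>C e i) = (\<Sum>i\<in>insert j F. (c(j := a)) i *\<^sub>C e i)"
        using insert.hyps by simp
      thus "\<exists>c'. a *\<^sub>C e j + (\<Sum>i\<in>F. c i *\<^sub>C e i) = (\<Sum>i\<in>insert j F. c' i *\<^sub>C e i) \<and>
         (\<forall>i\<in>insert j F. cmod (c' i) \<le> M)"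
        using a c by (intro exI[of _ "c(j := a)"]) auto
    qed
  qed
  moreover have "compact ((\<lambda>c. c *\<^sub>C e j) ` cball 0 M)"
    by (intro compact_continuous_image linear_continuous_on bounded_linear_scaleC_left compact_cball)
  ultimately show ?case using compact_sums[OF _ insert.IH] by simp
qed

lemma shift_bounded_vanishing:
  assumes fin: "\<And>d. d > 0 \<Longrightarrow> finite {i\<in>I. cmod (b i) > d}"
  shows "shift_bounded id b"
proof -
  \<comment> \<open>Only finitely many weights exceed 1; the inserted 1 covers all others and keeps
    the set nonempty.\<close>
  have "cmod (b i) \<le> Max (insert 1 ((\<lambda>i. cmod (b i)) ` {i\<in>I. cmod (b i) > 1}))" if "i \<in> I" for i
    by (cases "cmod (b i) > 1") (use fin[of 1] that in \<open>auto intro!: Max_ge simp: Max_ge_iff not_less\<close>)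
  thus ?thesis unfolding shift_bounded_def by (simp add: inj_on_id) blast
qed

text \<open>Dropping the coordinates whose weight is at most d moves the image of the unit ball by
  at most d; what remains lies in a compact set of finite combinations.\<close>

lemma compact_operator_vanishing:
  assumes fin: "\<And>d. d > 0 \<Longrightarrow> finite {i\<in>I. cmod (b i) > d}"
  shows "compact_operator (wshift id b)"
proof -
  note sb = shift_bounded_vanishing[OF fin, simplified]
  obtain M where M: "\<And>j. j \<in> I \<Longrightarrow> cmod (b j) \<le> M"
    using sb by (auto simp: shift_bounded_def)
  have "\<exists>K. compact K \<and> (\<forall>x\<in>wshift id b ` cball 0 1. \<exists>y\<in>K. dist x y \<le> d)" if "d > 0" for d
  proof -
    define F where "F = {i\<in>I. cmod (b i) > d}"
    define K where "K = {\<Sum>i\<in>F. c i *\<^sub>C e i |c. \<forall>i\<in>F. cmod (c i) \<le> M}"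
    have F: "finite F" "F \<subseteq> I" using fin[OF that] by (auto simp: F_def)
    have "\<exists>y\<in>K. dist (wshift id b x) y \<le> d" if x: "norm x \<le> 1" for x
    proof -
      define y where "y = (\<Sum>i\<in>F. (b i * coef x i) *\<^sub>C e i)"
      have "cmod (b i * coef x i) \<le> M" if "i \<in> F" for i
        using M[of i] cmod_coef_le[of x i] x that F
          mult_mono[of "cmod (b i)" M "cmod (coef x i)" 1]
        by (force simp: norm_mult intro: order_trans[OF norm_ge_zero])
      hence "y \<in> K" by (auto simp: y_def K_def)
      have cy: "coef y i = (if i \<in> F then b i * coef x i else 0)" if "i \<in> I" for i
      proof -
        have "coef y i = (\<Sum>j\<in>F. if i = j then b i * coef x i else 0)"
          unfolding y_def coef_sum using F
          by (intro sum.cong) (auto simp: coef_scaleC coef_basis)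
        thus ?thesis using F by simp
      qed
      have "norm (wshift id b x - y) \<le> d * norm x"
      proof (rule norm_le_if_coef_le)
        fix i assume "i \<in> I"
        thus "cmod (coef (wshift id b x - y) i) \<le> d * cmod (coef x i)"
          using \<open>d > 0\<close> by (auto simp: coef_diff coef_wshift[OF sb] cy F_def norm_mult intro!: mult_right_mono)
      qed (use \<open>d > 0\<close> in simp)
      also have "\<dots> \<le> d" using x \<open>d > 0\<close> by (simp add: mult_left_le)
      finally show ?thesis using \<open>y \<in> K\<close> by (auto simp: dist_norm)
    qed
    thus ?thesis using compact_combinations[OF F(1), of M] unfolding K_def by (intro exI) (auto)
  qed
  hence "compact (closure (wshift id b ` cball 0 1))" by (rule compact_closure_if_approx)
  thus ?thesis using bounded_operator_wshift[OF sb] by (simp add: compact_operator_def)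
qed

text \<open>The coordinates of an eigenvector satisfy (\<nu> i - r) x_i = 0, so only basis vectors
  with value r contribute. As these are finitely many, they span the eigenspace algebraically, which
  is what \<open>vector_space.dim\<close> measures.\<close>

lemma dim_eigenspace:
  assumes "finite {i\<in>I. \<nu> i = r}"
  shows "vector_space.dim scaleC {x. (x, r *\<^sub>C x) \<in> Diag \<nu>} = card {i\<in>I. \<nu> i = r}"
proof -
  define J where "J = {i\<in>I. \<nu> i = r}"
  have J: "finite J" "J \<subseteq> I" using assms by (auto simp: J_def)
  have inj: "inj_on e J"
    using J orthonormal by (intro inj_onI) (metis subset_eq zero_neq_one)
  have "{x. (x, r *\<^sub>C x) \<in> Diag \<nu>} = cvs.span (e ` J)"
  proof (intro equalityI subsetI)
    fix x assume "x \<in> {x. (x, r *\<^sub>C x) \<in> Diag \<nu>}"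
    hence "coef x i = 0" if "i \<in> I - J" for i
      using that by (auto simp: mem_Diag coef_scaleC J_def)
    hence "x = (\<Sum>j\<in>J. coef x j *\<^sub>C e j)"
      by (intro coef_eqI) (use J in \<open>auto simp: coef_sum coef_scaleC coef_basis subset_iff
          if_distrib[of "\<lambda>y. _ * y"] cong: if_cong sum.cong\<close>)
    also have "\<dots> \<in> cvs.span (e ` J)"
      by (intro cvs.span_sum cvs.span_scale cvs.span_base) auto
    finally show "x \<in> cvs.span (e ` J)" .
  next
    have "cvs.subspace {x. (x, r *\<^sub>C x) \<in> Diag \<nu>}"
      unfolding cvs.subspace_def mem_Collect_eq mem_Diag coef_add coef_scaleC coef_zero
      by (intro conjI allI impI ballI) (simp_all only: mem_Collect_eq distrib_left mult.left_commute mult_zero_right)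
    moreover have "e ` J \<subseteq> {x. (x, r *\<^sub>C x) \<in> Diag \<nu>}"
      by (auto simp: J_def mem_Diag coef_scaleC coef_basis)
    ultimately have "cvs.span (e ` J) \<subseteq> {x. (x, r *\<^sub>C x) \<in> Diag \<nu>}"
      by (intro cvs.span_minimal)
    thus "x \<in> {x. (x, r *\<^sub>C x) \<in> Diag \<nu>}" if "x \<in> cvs.span (e ` J)" for x using that by blast
  qed
  moreover have "cvs.independent (e ` J)"
    unfolding cvs.independent_explicit_finite_subsets
  proof (intro allI impI ballI)
    fix S u x assume S: "S \<subseteq> e ` J" "finite S" and z: "(\<Sum>x\<in>S. u x *\<^sub>C x) = 0" and x: "x \<in> S"
    then obtain j where j: "j \<in> J" "x = e j" by auto
    have "coef y j = (if y = x then 1 else 0)" if yS: "y \<in> S" for y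
    proof -
      obtain k where "k \<in> J" "y = e k" using yS S(1) by auto
      thus ?thesis using j J inj by (auto simp: coef_basis inj_on_def)
    qed
    hence "coef (\<Sum>x\<in>S. u x *\<^sub>C x) j = u x"
      using S x by (simp add: coef_sum coef_scaleC if_distrib[of "\<lambda>y. _ * y"] cong: if_cong sum.cong)
    thus "u x = 0" using z by simp
  qed
  ultimately show ?thesis
    by (simp add: cvs.dim_span cvs.dim_eq_card_independent card_image[OF inj] flip: J_def)
qed

end

text \<open>The vectors orthogonal to x form a closed subspace. If it contains the basis, it
  contains everything, in particular x.\<close>

lemma orthonormal_basis_onb:
  assumes "orthonormal_basis I e"
  shows "onb I e"
proof
  show "cinner (e i) (e j) = (if i = j then 1 else 0)" if "i \<in> I" "j \<in> I" for i j
    using assms that by (simp add: orthonormal_basis_def)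
  fix x assume x: "\<And>i. i \<in> I \<Longrightarrow> cinner (e i) x = 0"
  have ex: "cinner x (e i) = 0" if "i \<in> I" for i
    using x[OF that] cinner_commute[of x "e i"] by simp
  have "closed {y. cinner x y = 0}"
    by (intro closed_Collect_eq continuous_intros linear_continuous_on bounded_linear_cinner_right)
  moreover have "{\<Sum>i\<in>F. c i *\<^sub>C e i | F c. finite F \<and> F \<subseteq> I} \<subseteq> {y. cinner x y = 0}"
    using ex by (auto simp: cinner_sum_right cinner_scaleC_right subset_iff intro!: sum.neutral)
  ultimately have "closure {\<Sum>i\<in>F. c i *\<^sub>C e i | F c. finite F \<and> F \<subseteq> I} \<subseteq> {y. cinner x y = 0}"
    by (intro closure_minimal)
  hence "UNIV \<subseteq> {y. cinner x y = 0}"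
    using assms by (simp add: orthonormal_basis_def)
  hence "cinner x x = 0" by blast
  thus "x = 0" by (simp add: cinner_self_eq_0)
qed

section \<open>The derivations of a self-adjoint operator\<close>

text \<open>The graph inherits linearity from the adjoint, whose defining condition is stable under
  sums and multiples of pairs.\<close>

lemma self_adjoint_add:
  assumes "self_adjoint T" "(x, y) \<in> T" "(x', y') \<in> T"
  shows "(x + x', y + y') \<in> T"
proof -
  have adj: "adjoint_op T = T" using assms(1) by (simp add: self_adjoint_def)
  have "(x, y) \<in> adjoint_op T" "(x', y') \<in> adjoint_op T" using assms by (simp_all add: adj)
  hence "(x + x', y + y') \<in> adjoint_op T"
    unfolding adjoint_op_def by (fastforce simp: cinner_add_left)
  thus ?thesis by (simp add: adj)
qed

lemma self_adjoint_scale: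
  assumes "self_adjoint T" "(x, y) \<in> T"
  shows "(c *\<^sub>C x, c *\<^sub>C y) \<in> T"
proof -
  have adj: "adjoint_op T = T" using assms(1) by (simp add: self_adjoint_def)
  have "(x, y) \<in> adjoint_op T" using assms by (simp add: adj)
  hence "(c *\<^sub>C x, c *\<^sub>C y) \<in> adjoint_op T"
    by (auto simp: adjoint_op_def cinner_scaleC_left)
  thus ?thesis by (simp add: adj)
qed

lemma self_adjoint_single_valued:
  assumes "self_adjoint T" "(x, y) \<in> T" "(x, z) \<in> T"
  shows "y = z"
proof -
  have adj: "adjoint_op T = T" and dense: "closure (Domain T) = UNIV"
    using assms(1) by (simp_all add: self_adjoint_def)
  have "(x, y) \<in> adjoint_op T" "(x, z) \<in> adjoint_op T" using assms by (simp_all add: adj)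
  hence "\<forall>u\<in>Domain T. cinner (y - z) u = 0"
    by (fastforce simp: adjoint_op_def cinner_diff_left)
  hence "Domain T \<subseteq> {u. cinner (y - z) u = 0}" by blast
  moreover have "closed {u. cinner (y - z) u = 0}"
    by (intro closed_Collect_eq continuous_intros linear_continuous_on bounded_linear_cinner_right)
  ultimately have "closure (Domain T) \<subseteq> {u. cinner (y - z) u = 0}" by (rule closure_minimal)
  hence "cinner (y - z) (y - z) = 0" using dense by blast
  thus ?thesis by (simp add: cinner_self_eq_0)
qed

lemma commutator_add:
  assumes "self_adjoint T" "(a, a') \<in> commutator T" "(b, b') \<in> commutator T"
  shows "(\<lambda>x. a x + b x, \<lambda>x. a' x + b' x) \<in> commutator T"
proof -
  have "(a x + b x, (a y + b y) + (a' x + b' x)) \<in> T" if "(x, y) \<in> T" for x y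
  proof -
    have "(a x, a y + a' x) \<in> T" "(b x, b y + b' x) \<in> T"
      using assms that by (auto simp: commutator_def)
    from self_adjoint_add[OF assms(1) this] show ?thesis by (simp add: algebra_simps)
  qed
  thus ?thesis using assms(2,3) by (auto simp: commutator_def bounded_operator_plus)
qed

lemma commutator_scale:
  assumes "self_adjoint T" "(a, a') \<in> commutator T"
  shows "(\<lambda>x. c *\<^sub>C a x, \<lambda>x. c *\<^sub>C a' x) \<in> commutator T"
proof -
  have "(c *\<^sub>C a x, c *\<^sub>C a y + c *\<^sub>C a' x) \<in> T" if "(x, y) \<in> T" for x y
  proof -
    have "(a x, a y + a' x) \<in> T" using assms that by (auto simp: commutator_def)
    from self_adjoint_scale[OF assms(1) this] show ?thesis by (simp add: scaleC_add_right)
  qed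
  thus ?thesis using assms(2) by (auto simp: commutator_def bounded_operator_scale)
qed

text \<open>The Leibniz rule. Domains cause no trouble, since b maps the domain of \<open>T\<close>
  into itself and then so does a.\<close>

lemma commutator_mult:
  assumes "(a, a') \<in> commutator T" "(b, b') \<in> commutator T"
  shows "(\<lambda>x. a (b x), \<lambda>x. a' (b x) + a (b' x)) \<in> commutator T"
proof -
  have "(a (b x), a (b y) + (a' (b x) + a (b' x))) \<in> T" if "(x, y) \<in> T" for x y
  proof -
    have "(b x, b y + b' x) \<in> T" using assms that by (auto simp: commutator_def)
    hence "(a (b x), a (b y + b' x) + a' (b x)) \<in> T" using assms(1) unfolding commutator_def by blast
    moreover have "a (b y + b' x) = a (b y) + a (b' x)"
      using assms(1) by (auto simp: commutator_def bounded_operator_add_right)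
    ultimately show ?thesis by (simp add: algebra_simps)
  qed
  thus ?thesis using assms by (auto simp: commutator_def bounded_operator_plus bounded_operator_compose)
qed

lemma commutator_id: "(\<lambda>x. x, \<lambda>x. 0) \<in> commutator T"
  by (auto simp: commutator_def bounded_operator_id bounded_operator_zero)

text \<open>Two bounded extensions agree on the dense domain. The lemma identifies a commutator
  given by mere existence with one that has been computed.\<close>

lemma commutator_unique:
  assumes T: "self_adjoint T" and ab: "(a, b) \<in> commutator T" "(a, b') \<in> commutator T"
  shows "b = b'"
proof
  fix x
  have bl: "bounded_linear b" "bounded_linear b'"
    using ab by (auto simp: commutator_def bounded_operator_def)
  have "Domain T \<subseteq> {x. b x = b' x}"
  proof clarify
    fix x y assume "(x, y) \<in> T"
    hence "(a x, a y + b x) \<in> T" "(a x, a y + b' x) \<in> T" using ab by (auto simp: commutator_def)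
    thus "b x = b' x" using self_adjoint_single_valued[OF T] by fastforce
  qed
  moreover have "closed {x. b x = b' x}"
    by (intro closed_Collect_eq linear_continuous_on bl)
  ultimately have "closure (Domain T) \<subseteq> {x. b x = b' x}" by (rule closure_minimal)
  thus "b x = b' x" using T by (auto simp: self_adjoint_def)
qed

text \<open>A relational power grows at its end, whereas the inductions below strip off the first
  derivative.\<close>

lemma Domain_relpow_Suc: "a \<in> Domain (R ^^ Suc j) \<longleftrightarrow> (\<exists>a'. (a, a') \<in> R \<and> a' \<in> Domain (R ^^ j))"
  by (metis Domain.simps relpow_Suc_D2 relpow_Suc_I2)

lemma Domain_relpow_Suc_subset: "Domain ((R :: 'a rel) ^^ Suc j) \<subseteq> Domain (R ^^ j)"
proof clarify
  fix x y assume "(x, y) \<in> R ^^ Suc j"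
  then obtain z where "(x, z) \<in> R ^^ j" by (blast elim: relpow_Suc_E)
  thus "x \<in> Domain (R ^^ j)" by (rule DomainI)
qed

lemma Domain_commutator_add:
  assumes "self_adjoint T"
  shows "a \<in> Domain (commutator T ^^ j) \<Longrightarrow> b \<in> Domain (commutator T ^^ j) \<Longrightarrow>
    (\<lambda>x. a x + b x) \<in> Domain (commutator T ^^ j)"
proof (induction j arbitrary: a b)
  case (Suc j)
  from Suc.prems obtain a' b' where
    "(a, a') \<in> commutator T" "a' \<in> Domain (commutator T ^^ j)"
    "(b, b') \<in> commutator T" "b' \<in> Domain (commutator T ^^ j)"
    unfolding Domain_relpow_Suc by blast
  thus ?case unfolding Domain_relpow_Suc using commutator_add[OF assms] Suc.IH by blast
qed auto

lemma Domain_commutator_scale: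
  assumes "self_adjoint T"
  shows "a \<in> Domain (commutator T ^^ j) \<Longrightarrow> (\<lambda>x. c *\<^sub>C a x) \<in> Domain (commutator T ^^ j)"
proof (induction j arbitrary: a)
  case (Suc j)
  from Suc.prems obtain a' where "(a, a') \<in> commutator T" "a' \<in> Domain (commutator T ^^ j)"
    unfolding Domain_relpow_Suc by blast
  thus ?case unfolding Domain_relpow_Suc using commutator_scale[OF assms] Suc.IH by blast
qed auto

lemma Domain_commutator_mult:
  assumes "self_adjoint T"
  shows "a \<in> Domain (commutator T ^^ j) \<Longrightarrow> b \<in> Domain (commutator T ^^ j) \<Longrightarrow>
    (\<lambda>x. a (b x)) \<in> Domain (commutator T ^^ j)"
proof (induction j arbitrary: a b)
  case (Suc j)
  from Suc.prems obtain a' b' where ab: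
    "(a, a') \<in> commutator T" "a' \<in> Domain (commutator T ^^ j)"
    "(b, b') \<in> commutator T" "b' \<in> Domain (commutator T ^^ j)"
    unfolding Domain_relpow_Suc by blast
  \<comment> \<open>In the Leibniz rule one factor stays undifferentiated, so both factors are also
    wanted one level lower.\<close>
  have "a \<in> Domain (commutator T ^^ j)"
    by (rule subsetD[OF Domain_relpow_Suc_subset Suc.prems(1)])
  hence 1: "(\<lambda>x. a (b' x)) \<in> Domain (commutator T ^^ j)" using ab(4) by (rule Suc.IH)
  have "b \<in> Domain (commutator T ^^ j)"
    by (rule subsetD[OF Domain_relpow_Suc_subset Suc.prems(2)])
  with ab(2) have 2: "(\<lambda>x. a' (b x)) \<in> Domain (commutator T ^^ j)" by (rule Suc.IH)
  from Domain_commutator_add[OF assms 2 1]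
  show ?case unfolding Domain_relpow_Suc using commutator_mult[OF ab(1,3)] by blast
qed auto

text \<open>If the derivative of a is a multiple of a, then so are all higher ones.\<close>

lemma Domain_commutator_eigenvector:
  assumes "self_adjoint T" "(a, \<lambda>x. s *\<^sub>C a x) \<in> commutator T"
  shows "a \<in> Domain (commutator T ^^ j)"
proof (induction j)
  case (Suc j)
  thus ?case unfolding Domain_relpow_Suc using assms Domain_commutator_scale by blast
qed auto

text \<open>These operators form an algebra, so that regularity can be checked on generators.\<close>

definition smooth_ops :: "'h::complex_hilbert rel \<Rightarrow> ('h \<Rightarrow> 'h) set" where
  "smooth_ops D = {a \<in> OP0 D. \<exists>b\<in>OP0 D. (a, b) \<in> commutator D}"

context
  fixes D :: "'h::complex_hilbert rel"
  assumes D: "self_adjoint D" and absD: "self_adjoint (abs_op D)"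
begin

lemma OP0_add: "a \<in> OP0 D \<Longrightarrow> b \<in> OP0 D \<Longrightarrow> (\<lambda>x. a x + b x) \<in> OP0 D"
  by (simp add: OP0_def bounded_operator_plus Domain_commutator_add[OF absD])

lemma OP0_mult: "a \<in> OP0 D \<Longrightarrow> b \<in> OP0 D \<Longrightarrow> (\<lambda>x. a (b x)) \<in> OP0 D"
  by (simp add: OP0_def bounded_operator_compose Domain_commutator_mult[OF absD])

lemma OP0_scale: "a \<in> OP0 D \<Longrightarrow> (\<lambda>x. c *\<^sub>C a x) \<in> OP0 D"
  by (simp add: OP0_def bounded_operator_scale Domain_commutator_scale[OF absD])

lemma OP0_eigenvector:
  assumes "(a, \<lambda>x. s *\<^sub>C a x) \<in> commutator (abs_op D)"
  shows "a \<in> OP0 D"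
  using Domain_commutator_eigenvector[OF absD assms] assms by (auto simp: OP0_def commutator_def)

lemma OP0_zero: "(\<lambda>x. 0) \<in> OP0 D"
  using commutator_scale[OF absD commutator_id, of 0]
  by (intro OP0_eigenvector[of _ 0]) simp

lemma OP0_id: "(\<lambda>x. x) \<in> OP0 D"
  using commutator_id by (intro OP0_eigenvector[of _ 0]) simp

lemma smooth_ops_add: "a \<in> smooth_ops D \<Longrightarrow> b \<in> smooth_ops D \<Longrightarrow> (\<lambda>x. a x + b x) \<in> smooth_ops D"
  unfolding smooth_ops_def using OP0_add commutator_add[OF D] by blast

lemma smooth_ops_scale: "a \<in> smooth_ops D \<Longrightarrow> (\<lambda>x. c *\<^sub>C a x) \<in> smooth_ops D"
  unfolding smooth_ops_def using OP0_scale commutator_scale[OF D] by blast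

lemma smooth_ops_mult:
  assumes "a \<in> smooth_ops D" "b \<in> smooth_ops D"
  shows "(\<lambda>x. a (b x)) \<in> smooth_ops D"
proof -
  obtain a' b' where ab: "a \<in> OP0 D" "a' \<in> OP0 D" "(a, a') \<in> commutator D"
    "b \<in> OP0 D" "b' \<in> OP0 D" "(b, b') \<in> commutator D"
    using assms unfolding smooth_ops_def by blast
  have "(\<lambda>x. a' (b x) + a (b' x)) \<in> OP0 D"
    by (rule OP0_add[OF OP0_mult[OF ab(2,4)] OP0_mult[OF ab(1,5)]])
  thus ?thesis
    unfolding smooth_ops_def using commutator_mult[OF ab(3,6)] OP0_mult[OF ab(1,4)] by blast
qed

lemma smooth_ops_id: "(\<lambda>x. x) \<in> smooth_ops D"
  unfolding smooth_ops_def using OP0_id OP0_zero commutator_id by blast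

text \<open>Only \<open>OP0 D\<close> is claimed for the generated algebra, as its elements [D, a]
  are not asked to have bounded commutators with \<open>D\<close> again. Uniqueness of commutators
  shows that these generators are the members of \<open>OP0 D\<close> provided by
  \<open>smooth_ops\<close>.\<close>

lemma generated_algebra_smooth_ops:
  assumes "A \<subseteq> smooth_ops D"
  shows "generated_algebra (A \<union> {b. \<exists>a\<in>A. (a, b) \<in> commutator D}) \<subseteq> OP0 D"
proof
  fix c assume "c \<in> generated_algebra (A \<union> {b. \<exists>a\<in>A. (a, b) \<in> commutator D})"
  thus "c \<in> OP0 D"
  proof (induction rule: generated_algebra.induct)
    case (generator c)
    thus ?case
    proof
      assume "c \<in> {b. \<exists>a\<in>A. (a, b) \<in> commutator D}"
      then obtain a where a: "a \<in> A" "(a, c) \<in> commutator D" by blast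
      then obtain b where "b \<in> OP0 D" "(a, b) \<in> commutator D"
        using assms by (auto simp: smooth_ops_def)
      thus ?thesis using commutator_unique[OF D a(2)] by blast
    qed (use assms in \<open>auto simp: smooth_ops_def\<close>)
  next
    case (add a b)
    thus ?case by (intro OP0_add)
  next
    case (mult a b)
    thus ?case by (intro OP0_mult[of a b])
  next
    case (scale a c)
    thus ?case by (intro OP0_scale)
  qed
qed

end

context onb
begin

text \<open>A shift raising the diagonal value by the same s along each of its arrows is an
  eigenvector of the derivation; where the source is missing, both sides vanish.\<close>

lemma commutator_wshift:
  assumes sb: "shift_bounded \<phi> a"
    and sh: "\<And>j. j \<in> I \<Longrightarrow> \<phi> j \<in> I \<Longrightarrow> \<nu> j = \<nu> (\<phi> j) + s"
  shows "(wshift \<phi> a, \<lambda>x. s *\<^sub>C wshift \<phi> a x) \<in> commutator (Diag \<nu>)"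
proof -
  note c = coef_wshift[OF sb]
  have "(wshift \<phi> a x, wshift \<phi> a y + s *\<^sub>C wshift \<phi> a x) \<in> Diag \<nu>" if xy: "(x, y) \<in> Diag \<nu>" for x y
    unfolding mem_Diag
  proof
    fix j assume j: "j \<in> I"
    show "coef (wshift \<phi> a y + s *\<^sub>C wshift \<phi> a x) j = \<nu> j * coef (wshift \<phi> a x) j"
    proof (cases "\<phi> j \<in> I")
      case True
      hence "coef y (\<phi> j) = \<nu> (\<phi> j) * coef x (\<phi> j)" using xy by (simp add: mem_Diag)
      thus ?thesis using sh[OF j True] by (simp add: coef_add coef_scaleC c[OF j] algebra_simps)
    qed (simp add: coef_add coef_scaleC c[OF j] coef_outside)
  qed
  thus ?thesis
    using bounded_operator_wshift[OF sb] by (auto simp: commutator_def bounded_operator_scale)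
qed

end

section \<open>Estimates of the coefficients\<close>

text \<open>\<open>s\<close> is the change of l, so that the three families of coefficients can be
  treated as one; the values meant are -1, 0 and 1.\<close>

definition ladder :: "real \<Rightarrow> real \<Rightarrow> real \<Rightarrow> gen \<Rightarrow> real \<Rightarrow> real \<Rightarrow> real \<Rightarrow> real" where
  "ladder q t s = (if s = - 1 then alpha_minus q t else if s = 0 then alpha_zero q t else alpha_plus q t)"

text \<open>One constant absorbs all others: 2 serves sums of two terms, the next two the upper and
  lower bounds of q-numbers, \<open>1 + inverse q\<close> the factor
  \<open>t - 1 + q powr (2*M)\<close> in the radicand, and the last one the numerator in the
  difference of \<open>coef_beta\<close>.\<close>

locale q_bounds =
  fixes q C :: real
  assumes q: "0 < q" "q < 1"
    and C: "2 \<le> C" "inverse (inverse q - q) \<le> C" "(inverse q - q) / (1 - q) \<le> C"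
      "1 + inverse q \<le> C" "(2 * inverse q + 2 * q) / q \<le> C"
begin

text \<open>Only the exponent \<open>e\<close> matters, \<open>n\<close> merely counts factors; in a
  product both add up. As \<open>q < 1\<close>, a larger exponent is a stronger bound.\<close>

definition qbound :: "nat \<Rightarrow> real \<Rightarrow> real \<Rightarrow> bool" where
  "qbound n e f \<longleftrightarrow> 0 \<le> f \<and> f \<le> C ^ n * q powr e"

lemma qbound_weaken: "qbound n e f \<Longrightarrow> n \<le> n' \<Longrightarrow> e' \<le> e \<Longrightarrow> qbound n' e' f"
  unfolding qbound_def using q C(1)
  by (auto intro!: order_trans[of f "C ^ n * q powr e"] mult_mono power_increasing powr_mono')

lemma qbound_mult:
  assumes "qbound n e f" "qbound n' e' g"
  shows "qbound (n + n') (e + e') (f * g)"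
proof -
  have "f * g \<le> (C ^ n * q powr e) * (C ^ n' * q powr e')"
    using assms C(1) by (intro mult_mono) (auto simp: qbound_def)
  thus ?thesis using assms by (simp add: qbound_def power_add powr_add mult_ac)
qed

lemma qbound_add:
  assumes "qbound n e f" "qbound n e g"
  shows "qbound (Suc n) e (f + g)"
proof -
  have "f + g \<le> 2 * (C ^ n * q powr e)" using assms by (simp add: qbound_def)
  also have "\<dots> \<le> C * (C ^ n * q powr e)" using C(1) by (intro mult_right_mono) auto
  finally show ?thesis using assms by (simp add: qbound_def mult.assoc)
qed

lemma qbound_mono: "qbound n e f \<Longrightarrow> 0 \<le> g \<Longrightarrow> g \<le> f \<Longrightarrow> qbound n e g"
  by (auto simp: qbound_def)

lemma qbound_powr: "qbound 0 e (q powr e)"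
  by (simp add: qbound_def)

lemma qbound_const: "0 \<le> c \<Longrightarrow> c \<le> C \<Longrightarrow> qbound 1 0 c"
  using q by (simp add: qbound_def)

lemma inverse_q_minus_q_pos: "0 < inverse q - q"
  using q one_less_inverse[of q] by linarith

lemma qnum_eq: "qnum q x = inverse (inverse q - q) * (q powr (- x) - q powr x)"
proof -
  have "qnum q x = (q powr (- x) - q powr x) / (inverse q - q)"
    unfolding qnum_def using inverse_q_minus_q_pos by (subst frac_eq_eq) (auto simp: algebra_simps)
  thus ?thesis by (simp add: divide_inverse mult.commute)
qed

lemma qnum_nonneg: "0 \<le> x \<Longrightarrow> 0 \<le> qnum q x"
  using inverse_q_minus_q_pos q by (simp add: qnum_eq powr_mono')

lemma qbound_qnum: "0 \<le> x \<Longrightarrow> qbound 1 (- x) (qnum q x)"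
proof -
  assume "0 \<le> x"
  have "qnum q x \<le> C * q powr (- x)"
    unfolding qnum_eq using C inverse_q_minus_q_pos \<open>0 \<le> x\<close> q by (intro mult_mono) (auto simp: powr_mono')
  thus ?thesis using qnum_nonneg[OF \<open>0 \<le> x\<close>] by (simp add: qbound_def)
qed

text \<open>From 2 x \<ge> 1 follows q^x \<le> q * q^(-x), which leaves the share 1 - q of the
  leading term. The threshold 1/2 is the least argument in a denominator, namely that of [l] at l =
  1/2.\<close>

lemma qnum_lower:
  assumes "1/2 \<le> x"
  shows "q powr (- x) * inverse C \<le> qnum q x"
proof -
  define k where "k = inverse q - q"
  have k: "0 < k" "k / (1 - q) \<le> C" using inverse_q_minus_q_pos C by (auto simp: k_def)
  have "q powr x = q powr (- x) * q powr (2 * x)" by (simp add: powr_add[symmetric])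
  also have "\<dots> \<le> q powr (- x) * q powr 1"
    using q assms by (intro mult_left_mono powr_mono') auto
  finally have 1: "q powr (- x) * (1 - q) \<le> q powr (- x) - q powr x"
    using q by (simp add: right_diff_distrib)
  have "inverse C \<le> (1 - q) / k"
    using k q C(1) by (simp add: field_simps)
  hence "q powr (- x) * inverse C \<le> q powr (- x) * ((1 - q) / k)" by (intro mult_left_mono) auto
  also have "\<dots> \<le> (q powr (- x) - q powr x) / k"
    using divide_right_mono[OF 1, of k] k(1) by simp
  finally show ?thesis by (simp add: qnum_eq k_def divide_inverse mult.commute)
qed

lemma qnum_pos: "1/2 \<le> x \<Longrightarrow> 0 < qnum q x"
  using qnum_lower[of x] q C(1) by (smt (verit) inverse_positive_iff_positive mult_pos_pos powr_gt_zero)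

lemma qbound_inverse_qnum:
  assumes "1/2 \<le> x"
  shows "qbound 1 x (inverse (qnum q x))"
proof -
  have "inverse (qnum q x) \<le> inverse (q powr (- x) * inverse C)"
    using qnum_lower[OF assms] q C(1) by (intro le_imp_inverse_le) auto
  also have "\<dots> = C * q powr x" using q by (simp add: powr_minus)
  finally show ?thesis using qnum_pos[OF assms] by (simp add: qbound_def)
qed

lemma qbound_sqrt:
  assumes "qbound 1 e f"
  shows "qbound 1 (e / 2) (sqrt f)"
proof -
  have "sqrt f \<le> sqrt (C * q powr e)" using assms by (simp add: qbound_def)
  also have "\<dots> = sqrt C * q powr (e / 2)"
    using q by (simp add: real_sqrt_mult powr_half_sqrt[symmetric] powr_powr)
  \<comment> \<open>As \<open>C\<close> is at least 1, sqrt C \<le> C, and a root still counts as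
    one factor.\<close>
  also have "\<dots> \<le> C * q powr (e / 2)"
    using C(1) by (intro mult_right_mono real_le_lsqrt) (auto simp: power2_eq_square)
  finally show ?thesis using assms by (simp add: qbound_def)
qed

lemma qbound_sqrt_qnum: "0 \<le> x \<Longrightarrow> qbound 1 (- x / 2) (sqrt (qnum q x))"
  by (intro qbound_sqrt qbound_qnum)

lemma qbound_inverse_sqrt_qnum: "1/2 \<le> x \<Longrightarrow> qbound 1 (x / 2) (inverse (sqrt (qnum q x)))"
  using qbound_sqrt[OF qbound_inverse_qnum] by (simp add: real_sqrt_inverse)

lemmas qbound_intros = qbound_mult qbound_powr qbound_sqrt_qnum qbound_inverse_sqrt_qnum
  qbound_qnum qbound_inverse_qnum

text \<open>Both roots lie between sqrt a and sqrt a + sqrt x + sqrt y, however small a is.\<close>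

lemma abs_sqrt_diff_le:
  fixes a x y :: real
  assumes "0 \<le> a" "0 \<le> x" "0 \<le> y"
  shows "\<bar>sqrt (a + x) - sqrt (a + y)\<bar> \<le> sqrt x + sqrt y"
proof -
  have "sqrt (a + x) \<le> sqrt a + sqrt x" "sqrt (a + y) \<le> sqrt a + sqrt y"
    using assms by (simp_all add: sqrt_add_le_add_sqrt)
  moreover have "sqrt a \<le> sqrt (a + x)" "sqrt a \<le> sqrt (a + y)" "0 \<le> sqrt x" "0 \<le> sqrt y"
    using assms by simp_all
  ultimately show ?thesis by linarith
qed

text \<open>The two spin components differ only by the term \<open>[l] / [2l]\<close>, which is exponentially small. For
  \<open>t = 1\<close> the radicand itself is small and \<open>sqrt\<close> is not Lipschitz there, hence \<open>abs_sqrt_diff_le\<close>.\<close>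

lemma qbound_coef_alpha_diff:
  assumes t: "0 \<le> t" "t \<le> 1" and N: "N \<in> {1/2, - 1/2}" and l: "1/2 \<le> l"
  shows "qbound 10 (l - 1) \<bar>coef_alpha q t N l - coef_alpha q t (- N) l\<bar>"
proof -
  define u where "u M = q powr (- 2*M) * (qnum q l)\<^sup>2 / (qnum q (2*l))\<^sup>2 * (t - 1 + q powr (2*M))\<^sup>2" for M
  define p where "p = sqrt (qnum q 2) * sqrt (qnum q (l + N)) * sqrt (qnum q (l - N)) * sqrt (qnum q (2*l))
    * inverse (sqrt (qnum q (2*l + 1))) * inverse (qnum q l)"
  have p1: "coef_alpha q t N l = p * sqrt (1 - t + u N)"
    by (simp add: coef_alpha_def p_def u_def field_simps)
  have p2: "coef_alpha q t (- N) l = p * sqrt (1 - t + u (- N))"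
    by (simp add: coef_alpha_def p_def u_def field_simps)
  have lN: "0 \<le> l + N" "0 \<le> l - N" using N l by auto
  \<comment> \<open>The growth in l cancels: the numerator contributes the exponent -1 - l - l, the
    denominator l + 1/2 + l.\<close>
  have p: "qbound 6 (1/2 - 1) p"
    \<comment> \<open>\<open>qbound_weaken\<close> leaves count and exponent open, the product rules
      assemble them factor by factor, and linear inequalities remain.\<close>
    unfolding p_def by (insert l lN, rule qbound_weaken, (rule qbound_intros | (auto simp: field_simps)[1])+)
  \<comment> \<open>The quotient [l] / [2l] yields the exponent l, and \<open>q powr (- M)\<close>
    costs at most 1/2.\<close>
  have su: "qbound 3 (l - 1/2) (sqrt (u M))" if M: "M \<in> {1/2, - 1/2}" for M
  proof -
    have "q powr (2 * M) \<le> q powr (- 1)" using M q by (intro powr_mono') auto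
    hence "\<bar>t - 1 + q powr (2*M)\<bar> \<le> 1 + inverse q"
      using t q by (simp add: powr_minus abs_le_iff) (smt (verit) powr_ge_zero)
    hence c: "qbound 1 0 \<bar>t - 1 + q powr (2*M)\<bar>" using C by (intro qbound_const) auto
    have "q powr (- 2 * M) = (q powr (- M))\<^sup>2"
      using q by (simp add: power2_eq_square flip: powr_add)
    hence "u M = (q powr (- M) * qnum q l * inverse (qnum q (2*l)) * \<bar>t - 1 + q powr (2*M)\<bar>)\<^sup>2"
      by (simp only: u_def power_mult_distrib power2_abs divide_inverse power_inverse)
    moreover have "0 \<le> q powr (- M) * qnum q l * inverse (qnum q (2*l)) * \<bar>t - 1 + q powr (2*M)\<bar>"
      using l qnum_pos[of l] qnum_pos[of "2*l"] by simp
    ultimately have "sqrt (u M) = q powr (- M) * qnum q l * inverse (qnum q (2*l)) * \<bar>t - 1 + q powr (2*M)\<bar>"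
      by (simp only: real_sqrt_unique)
    moreover have "qbound 3 (l - 1/2) \<dots>"
      by (insert l M, rule qbound_weaken, (rule qbound_intros c | (auto simp: field_simps)[1])+)
    ultimately show ?thesis by simp
  qed
  have upos: "0 \<le> u M" for M by (simp add: u_def)
  have "qbound 4 (l - 1/2) (sqrt (u N) + sqrt (u (- N)))"
    using qbound_add[OF su su, of N "- N"] N by auto
  hence d: "qbound 4 (l - 1/2) \<bar>sqrt (1 - t + u N) - sqrt (1 - t + u (- N))\<bar>"
    by (rule qbound_mono) (use abs_sqrt_diff_le[of "1 - t" "u N" "u (- N)"] t upos in auto)
  have "\<bar>coef_alpha q t N l - coef_alpha q t (- N) l\<bar>
      = p * \<bar>sqrt (1 - t + u N) - sqrt (1 - t + u (- N))\<bar>"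
    using p unfolding p1 p2 right_diff_distrib[symmetric] by (simp add: abs_mult qbound_def)
  moreover have "qbound 10 (l - 1) \<dots>"
    by (rule qbound_weaken[OF qbound_mult[OF p d]]) auto
  ultimately show ?thesis by simp
qed

text \<open>The term with the products of q-numbers depends on \<open>N\<close> only through its
  absolute value and cancels. A constant divided by [2l + 2] remains.\<close>

lemma qbound_coef_beta_diff:
  assumes t: "0 \<le> t" "t \<le> 1" and N: "N \<in> {1/2, - 1/2}" and l: "1/2 \<le> l"
  shows "qbound 2 (2 * l + 2) \<bar>coef_beta q t N l - coef_beta q t (- N) l\<bar>"
proof -
  \<comment> \<open>Because of the factor \<open>sgn N\<close>, the difference of the two numerators
    is a sum; moreover [2 |N|] = [1] = 1.\<close>
  define c where "c = ((inverse q + q - q * t) + (inverse q + q - inverse q * t)) / q"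
  have q1: "qnum q 1 = 1" using q inverse_q_minus_q_pos by (simp add: qnum_def powr_minus)
  have "q * t \<le> q" "inverse q * t \<le> inverse q" "0 \<le> q * t" "0 \<le> inverse q * t"
    using t q by (simp_all add: mult_le_cancel_left1 mult_left_le)
  hence "0 \<le> (inverse q + q - q * t) + (inverse q + q - inverse q * t)"
    "(inverse q + q - q * t) + (inverse q + q - inverse q * t) \<le> 2 * inverse q + 2 * q"
    using q inverse_q_minus_q_pos by linarith+
  hence "0 \<le> c" "c \<le> (2 * inverse q + 2 * q) / q"
    unfolding c_def using q by (auto intro: divide_nonneg_pos divide_right_mono simp del: add_divide_distrib)
  hence c: "qbound 1 0 c" using C by (intro qbound_const) auto
  have "\<bar>coef_beta q t N l - coef_beta q t (- N) l\<bar> = c * inverse (qnum q (2 * l + 2))"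
  proof -
    define W where "W = qnum q (2 * l + 2)"
    define Z where "Z = t * (q - inverse q) * (qnum q (1/2) * qnum q (1/2 + 1) - qnum q l * qnum q (l + 1))"
    have W: "0 < W" using l by (simp add: W_def qnum_pos)
    have 1: "coef_beta q t (1/2) l = ((inverse q + q - q * t) + Z) / (q * W)"
      using q by (simp add: coef_beta_def q1 W_def Z_def)
    have 2: "coef_beta q t (- 1/2) l = (- (inverse q + q - inverse q * t) + Z) / (q * W)"
      using q by (simp add: coef_beta_def q1 W_def Z_def powr_minus)
    have 3: "coef_beta q t (1/2) l - coef_beta q t (- 1/2) l = c * inverse W"
      unfolding 1 2 diff_divide_distrib[symmetric] by (simp add: c_def divide_inverse)
    have "0 \<le> c * inverse W" using \<open>0 \<le> c\<close> W by simp
    moreover have "\<bar>coef_beta q t N l - coef_beta q t (- N) l\<bar>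
        = \<bar>coef_beta q t (1/2) l - coef_beta q t (- 1/2) l\<bar>"
    proof -
      from N consider "N = 1/2" | "N = - 1/2" by auto
      thus ?thesis
      proof cases
        case 1
        show ?thesis unfolding 1 by simp
      next
        case 2
        show ?thesis unfolding 2 by (simp add: abs_minus_commute)
      qed
    qed
    ultimately show ?thesis using 3 by (simp add: W_def)
  qed
  moreover have "qbound 2 (2 * l + 2) \<dots>"
    by (insert l, rule qbound_weaken, (rule qbound_mult c qbound_inverse_qnum | (auto simp: field_simps)[1])+)
  ultimately show ?thesis by simp
qed

text \<open>\<open>p\<close> is the factor common to both signs of \<open>N\<close>; the second
  alternative serves the coefficients with a leading minus.\<close>

lemma qbound_abs_diff:
  assumes "a = p * x \<and> b = p * y \<or> a = - (p * x) \<and> b = - (p * y)"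
    and "qbound n e p" "qbound n' e' \<bar>x - y\<bar>"
  shows "qbound (n + n') (e + e') \<bar>a - b\<bar>"
proof -
  have "\<bar>a - b\<bar> = p * \<bar>x - y\<bar>"
    using assms(1,2) by (auto simp: qbound_def abs_mult right_diff_distrib[symmetric] abs_minus_commute)
  thus ?thesis using qbound_mult[OF assms(2,3)] by simp
qed

lemma spinor_index_bounds:
  assumes "(l, m, N) \<in> spinor_index"
  shows "1/2 \<le> l" "- l \<le> m" "m \<le> l" "N \<in> {1/2, - 1/2}"
  using assms by (auto simp: spinor_index_def)

text \<open>Uniformly in m, the factor free of \<open>N\<close> has exponent at least -2, and the
  differences of \<open>coef_alpha\<close> and \<open>coef_beta\<close> contribute at least l - 1
  and 2 l + 2; the values 20 and l - 4 leave room. Existence of the target index keeps the arguments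
  under the roots nonnegative and, for s = -1, the denominator away from 0.\<close>

lemma qbound_ladder_diff:
  assumes t: "0 \<le> t" "t \<le> 1" and s: "s \<in> {- 1, 0, 1}"
    and i: "(l, m, N) \<in> spinor_index" and j: "(l + s, m + gen_index g, N) \<in> spinor_index"
  shows "qbound 20 (l - 4) \<bar>ladder q t s g l m N - ladder q t s g l m (- N)\<bar>"
proof -
  note b = spinor_index_bounds[OF i] spinor_index_bounds[OF j]
  from s consider "s = - 1" | "s = 0" | "s = 1" by blast
  thus ?thesis
  proof cases
    case 1
    have N: "N \<in> {1/2, - 1/2}" and l: "1/2 \<le> l" "1/2 \<le> l - 1" using b 1 by auto
    note d = qbound_coef_alpha_diff[OF t N l(1)]
    show ?thesis
    proof (cases g)
      case Xm
      define p where "p = q powr (- l + m - 1) * sqrt (qnum q (l + m - 1)) * sqrt (qnum q (l + m))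
        * inverse (sqrt (qnum q (2*l - 1))) * inverse (sqrt (qnum q (2*l)))"
      have "qbound 10 (- 2) p"
        unfolding p_def by (insert b 1 Xm, rule qbound_weaken, (rule qbound_intros | (auto simp: field_simps)[1])+)
      from qbound_abs_diff[OF _ this d] show ?thesis
        by (rule qbound_weaken) (auto simp: ladder_def 1 Xm p_def divide_inverse)
    next
      case X0
      define p where "p = q powr m * sqrt (qnum q (l - m)) * sqrt (qnum q (l + m)) * sqrt (qnum q 2)
        * inverse (sqrt (qnum q (2*l - 1))) * inverse (sqrt (qnum q (2*l)))"
      have "qbound 10 (- 2) p"
        unfolding p_def by (insert b 1 X0, rule qbound_weaken, (rule qbound_intros | (auto simp: field_simps)[1])+)
      from qbound_abs_diff[OF _ this d] show ?thesis
        by (rule qbound_weaken) (auto simp: ladder_def 1 X0 p_def divide_inverse)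
    next
      case Xp
      define p where "p = q powr (l + m + 1) * sqrt (qnum q (l - m - 1)) * sqrt (qnum q (l - m))
        * inverse (sqrt (qnum q (2*l - 1))) * inverse (sqrt (qnum q (2*l)))"
      have "qbound 10 (- 2) p"
        unfolding p_def by (insert b 1 Xp, rule qbound_weaken, (rule qbound_intros | (auto simp: field_simps)[1])+)
      from qbound_abs_diff[OF _ this d] show ?thesis
        by (rule qbound_weaken) (auto simp: ladder_def 1 Xp p_def divide_inverse)
    qed
  next
    case 2
    have N: "N \<in> {1/2, - 1/2}" and l: "1/2 \<le> l" using b by auto
    note d = qbound_coef_beta_diff[OF t N l]
    show ?thesis
    proof (cases g)
      case Xm
      define p where "p = q powr m * sqrt (qnum q (l - m + 1)) * sqrt (qnum q (l + m)) * sqrt (qnum q 2)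
        * inverse (qnum q (2*l))"
      have "qbound 10 (- 2) p"
        unfolding p_def by (insert b 2 Xm, rule qbound_weaken, (rule qbound_intros | (auto simp: field_simps)[1])+)
      moreover have "ladder q t s g l m M = p * coef_beta q t M l" for M
        by (simp add: ladder_def 2 Xm p_def divide_inverse)
      ultimately have "qbound (10 + 2) (- 2 + (2 * l + 2)) \<bar>ladder q t s g l m N - ladder q t s g l m (- N)\<bar>"
        using d by (intro qbound_abs_diff[of _ p "coef_beta q t N l" _ "coef_beta q t (- N) l"]) simp_all
      thus ?thesis by (rule qbound_weaken) (use l in auto)
    next
      case X0
      \<comment> \<open>The two products are estimated separately, as the triangle inequality is
        sharp enough. The exponents are -1 and 1.\<close>
      define p1 where "p1 = qnum q (l - m + 1) * qnum q (l + m) * inverse (qnum q (2*l))"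
      define p2 where "p2 = q powr 2 * qnum q (l - m) * qnum q (l + m + 1) * inverse (qnum q (2*l))"
      have p1: "qbound 9 (- 2) p1"
        unfolding p1_def by (insert b 2 X0, rule qbound_weaken, (rule qbound_intros | (auto simp: field_simps)[1])+)
      have p2: "qbound 9 (- 2) p2"
        unfolding p2_def by (insert b 2 X0, rule qbound_weaken, (rule qbound_intros | (auto simp: field_simps)[1])+)
      have "qbound 10 (- 2) (p1 + p2)" using qbound_add[OF p1 p2] by simp
      hence p12: "qbound 10 (- 2) \<bar>p1 - p2\<bar>"
        by (rule qbound_mono) (use p1 p2 in \<open>auto simp: qbound_def\<close>)
      have "qbound (10 + 2) (- 2 + (2 * l + 2)) \<bar>ladder q t s g l m N - ladder q t s g l m (- N)\<bar>"
      \<comment> \<open>The sign of \<open>p1 - p2\<close> varies with m, so its absolute value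
        becomes the common factor and the sign selects the alternative.\<close>
      proof (rule qbound_abs_diff[OF _ p12 d])
        have "ladder q t s g l m M = (p1 - p2) * coef_beta q t M l" for M
          using q by (simp add: ladder_def 2 X0 p1_def p2_def divide_inverse left_diff_distrib)
        thus "ladder q t s g l m N = \<bar>p1 - p2\<bar> * coef_beta q t N l \<and>
            ladder q t s g l m (- N) = \<bar>p1 - p2\<bar> * coef_beta q t (- N) l \<or>
            ladder q t s g l m N = - (\<bar>p1 - p2\<bar> * coef_beta q t N l) \<and>
            ladder q t s g l m (- N) = - (\<bar>p1 - p2\<bar> * coef_beta q t (- N) l)"
          by (simp add: abs_if left_diff_distrib)
      qed
      thus ?thesis by (rule qbound_weaken) (use l in auto)
    next
      case Xp
      define p where "p = q powr (m + 2) * sqrt (qnum q (l - m)) * sqrt (qnum q (l + m + 1)) * sqrt (qnum q 2)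
        * inverse (qnum q (2*l))"
      have "qbound 10 (- 2) p"
        unfolding p_def by (insert b 2 Xp, rule qbound_weaken, (rule qbound_intros | (auto simp: field_simps)[1])+)
      moreover have "ladder q t s g l m M = - (p * coef_beta q t M l)" for M
        by (simp add: ladder_def 2 Xp p_def divide_inverse)
      ultimately have "qbound (10 + 2) (- 2 + (2 * l + 2)) \<bar>ladder q t s g l m N - ladder q t s g l m (- N)\<bar>"
        using d by (intro qbound_abs_diff[of _ p "coef_beta q t N l" _ "coef_beta q t (- N) l"]) simp_all
      thus ?thesis by (rule qbound_weaken) (use l in auto)
    qed
  next
    case 3
    have N: "N \<in> {1/2, - 1/2}" and l: "1/2 \<le> l + 1" using b by auto
    note d = qbound_coef_alpha_diff[OF t N l]
    show ?thesis
    proof (cases g)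
      case Xm
      define p where "p = q powr (l + m) * sqrt (qnum q (l - m + 1)) * sqrt (qnum q (l - m + 2))
        * inverse (sqrt (qnum q (2*l + 1))) * inverse (sqrt (qnum q (2*l + 2)))"
      have "qbound 10 (- 2) p"
        unfolding p_def by (insert b 3 Xm, rule qbound_weaken, (rule qbound_intros | (auto simp: field_simps)[1])+)
      from qbound_abs_diff[OF _ this d] show ?thesis
        by (rule qbound_weaken) (auto simp: ladder_def 3 Xm p_def divide_inverse)
    next
      case X0
      define p where "p = q powr m * sqrt (qnum q (l - m + 1)) * sqrt (qnum q (l + m + 1)) * sqrt (qnum q 2)
        * inverse (sqrt (qnum q (2*l + 1))) * inverse (sqrt (qnum q (2*l + 2)))"
      have "qbound 10 (- 2) p"
        unfolding p_def by (insert b 3 X0, rule qbound_weaken, (rule qbound_intros | (auto simp: field_simps)[1])+)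
      from qbound_abs_diff[OF _ this d] show ?thesis
        by (rule qbound_weaken) (auto simp: ladder_def 3 X0 p_def divide_inverse)
    next
      case Xp
      define p where "p = q powr (- l + m) * sqrt (qnum q (l + m + 1)) * sqrt (qnum q (l + m + 2))
        * inverse (sqrt (qnum q (2*l + 1))) * inverse (sqrt (qnum q (2*l + 2)))"
      have "qbound 10 (- 2) p"
        unfolding p_def by (insert b 3 Xp, rule qbound_weaken, (rule qbound_intros | (auto simp: field_simps)[1])+)
      from qbound_abs_diff[OF _ this d] show ?thesis
        by (rule qbound_weaken) (auto simp: ladder_def 3 Xp p_def divide_inverse)
    qed
  qed
qed

text \<open>Exponential decay beats the eigenvalue: 1 + x \<le> exp x at x = - l * ln q bounds l *
  q^l by 1 / (- ln q). The 2 comes from l + 1/2 \<le> 2 l.\<close>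

lemma qbound_imp_bounded:
  assumes "qbound n (l - 4) f" "1/2 \<le> l"
  shows "(l + 1/2) * f \<le> C ^ n * (2 * q powr (- 4) / (- ln q))"
proof -
  have a: "0 < - ln q" using q by simp
  have "l * (- ln q) \<le> exp (l * (- ln q))" using exp_ge_add_one_self[of "l * (- ln q)"] by linarith
  hence "l * (- ln q) * exp (- (l * (- ln q))) \<le> 1"
    by (simp add: exp_minus field_simps)
  hence "l * (- ln q) * q powr l \<le> 1"
    using q by (simp add: powr_def)
  hence 1: "l * q powr l \<le> 1 / (- ln q)" using a by (simp add: field_simps)
  have "(l + 1/2) * f \<le> (2 * l) * (C ^ n * q powr (l - 4))"
    using assms by (intro mult_mono) (auto simp: qbound_def)
  also have "\<dots> = C ^ n * (2 * q powr (- 4) * (l * q powr l))"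
    using powr_add[of q l "- 4"] by (simp add: mult_ac)
  also have "\<dots> \<le> C ^ n * (2 * q powr (- 4) * (1 / (- ln q)))"
    using 1 C(1) by (intro mult_left_mono) auto
  finally show ?thesis by simp
qed

end

text \<open>The weight l + 1/2 is the eigenvalue of |D| at the source of the shift, so this is the
  estimate behind the commutator with \<open>D\<close>.\<close>

lemma ladder_diff_bounded:
  assumes "0 < q" "q < 1" "0 \<le> t" "t \<le> 1"
  shows "\<exists>K. \<forall>s\<in>{- 1, 0, 1}. \<forall>g l m N. (l, m, N) \<in> spinor_index \<longrightarrow>
    (l + s, m + gen_index g, N) \<in> spinor_index \<longrightarrow>
    (l + 1/2) * \<bar>ladder q t s g l m N - ladder q t s g l m (- N)\<bar> \<le> K"
proof -
  define C where "C = Max {2, inverse (inverse q - q), (inverse q - q) / (1 - q), 1 + inverse q,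
    (2 * inverse q + 2 * q) / q}"
  interpret q_bounds q C
    by unfold_locales (use assms in \<open>auto simp: C_def\<close>)
  show ?thesis
    using qbound_imp_bounded[OF qbound_ladder_diff] assms spinor_index_bounds(1) by blast
qed

section \<open>The *-algebra of the quantum sphere\<close>

lemma free_alg_induct [case_names single add]:
  fixes p :: free_alg
  assumes single: "\<And>w c. P (Poly_Mapping.single w c)"
    and add: "\<And>p p'. P p \<Longrightarrow> P p' \<Longrightarrow> P (p + p')"
  shows "P p"
proof (induction p rule: update_induct)
  case const
  show ?case using single[of undefined 0] by simp
next
  case (update f a b)
  have "Poly_Mapping.update a b f = f + Poly_Mapping.single a b"
    using update.hyps(1)
    by (intro poly_mapping_eqI) (auto simp: lookup_update lookup_add lookup_single in_keys_iff when_def)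
  thus ?case using add[OF update.IH single] by simp
qed

lemma const_1 [simp]: "const 1 = 1"
  by (simp add: const_def)

lemma const_mult: "const (a * b) = const a * const b"
  by (simp add: const_def mult_single)

lemma const_add: "const (a + b) = const a + const b"
  by (simp add: const_def single_add)

lemma const_minus: "const (- a) = - const a"
  by (simp add: const_def single_uminus)

lemma const_mult_single: "const a * Poly_Mapping.single w c = Poly_Mapping.single w (a * c)"
  by (simp add: const_def mult_single)

lemma const_central: "p * const c = const c * p"
proof (induction p rule: free_alg_induct)
  case (single w d)
  show ?case by (simp add: const_def mult_single mult.commute)
qed (simp add: distrib_left distrib_right)

lemma const_left_commute: "p * (const c * p') = const c * (p * p')"
  by (metis const_central mult.assoc)

lemma const_mult_mult: "const a * x * (const b * y) = const (a * b) * (x * y)"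
  by (simp only: const_mult mult.assoc const_left_commute[of x])

text \<open>Summing over a common finite set of words reduces additivity of the involution to
  additivity of coefficients.\<close>

lemma star_free_superset:
  assumes "finite S" "Poly_Mapping.keys p \<subseteq> S"
  shows "star_free q p = (\<Sum>w\<in>S. const (cnj (Poly_Mapping.lookup p w)) * star_letters q (letters w))"
  unfolding star_free_def using assms
  by (intro sum.mono_neutral_left) (auto simp: in_keys_iff const_def)

lemma star_free_add: "star_free q (p + p') = star_free q p + star_free q p'"
proof -
  define S where "S = Poly_Mapping.keys p \<union> Poly_Mapping.keys p'"
  have S: "finite S" "Poly_Mapping.keys p \<subseteq> S" "Poly_Mapping.keys p' \<subseteq> S"
    "Poly_Mapping.keys (p + p') \<subseteq> S"
    using keys_add[of p p'] by (auto simp: S_def)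
  show ?thesis
    unfolding star_free_superset[OF S(1,2)] star_free_superset[OF S(1,3)] star_free_superset[OF S(1,4)]
    by (simp add: lookup_add const_add distrib_right sum.distrib)
qed

lemma star_free_single:
  "star_free q (Poly_Mapping.single w c) = const (cnj c) * star_letters q (letters w)"
  by (subst star_free_superset[of "{w}"]) auto

lemma star_free_0 [simp]: "star_free q 0 = 0"
  by (simp add: star_free_def)

lemma star_free_minus: "star_free q (- p) = - star_free q p"
  using star_free_add[of q p "- p"] by (simp add: eq_neg_iff_add_eq_0 add.commute)

lemma star_free_diff: "star_free q (p - p') = star_free q p - star_free q p'"
  using star_free_add[of q p "- p'"] by (simp add: star_free_minus)

lemma star_free_const: "star_free q (const c) = const (cnj c)"
  by (simp add: const_def star_free_single zero_word_def mult_single)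

lemma star_free_var: "star_free q (var g) = star_gen q g"
  by (simp add: var_def star_free_single)

lemma star_letters_append: "star_letters q (u @ w) = star_letters q w * star_letters q u"
  by (induction u) (simp_all add: mult.assoc)

lemma star_free_mult: "star_free q (p * p') = star_free q p' * star_free q p"
proof (induction p rule: free_alg_induct)
  case (single u c)
  show ?case
  proof (induction p' rule: free_alg_induct)
    case (single w d)
    show ?case
      by (simp add: mult_single star_free_single plus_word_def star_letters_append
          const_mult_mult mult.commute[where 'a = complex])
  qed (simp add: distrib_left distrib_right star_free_add)
qed (simp add: distrib_left distrib_right star_free_add)

lemma star_free_scale: "star_free q (const c * p) = const (cnj c) * star_free q p"
  by (simp add: star_free_mult star_free_const const_central)

lemma star_free_star_gen:
  assumes "q \<noteq> 0"
  shows "star_free q (star_gen q g) = var g"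
proof -
  have "const a * (const b * p) = p" if "a * b = 1" for a b p
    using that by (simp add: mult.assoc[symmetric] const_mult[symmetric])
  thus ?thesis using assms
    by (cases g) (simp_all add: star_free_scale star_free_var flip: of_real_mult)
qed

lemma star_free_star_letters:
  assumes "q \<noteq> 0"
  shows "star_free q (star_letters q w) = Poly_Mapping.single (Word w) 1"
proof (induction w)
  case Nil
  have "star_free q 1 = 1" using star_free_const[of q 1] by simp
  moreover have "Poly_Mapping.single (Word []) 1 = (1::free_alg)" by (metis single_one zero_word_def)
  ultimately show ?case by simp
next
  case (Cons g w)
  thus ?case
    by (simp add: star_free_mult star_free_star_gen[OF assms] var_def mult_single plus_word_def)
qed

lemma star_free_star_free:
  assumes "q \<noteq> 0"
  shows "star_free q (star_free q p) = p"
proof (induction p rule: free_alg_induct)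
  case (single w c)
  show ?case
    by (simp add: star_free_single star_free_scale star_free_star_letters[OF assms] const_mult_single)
qed (simp add: star_free_add)

section \<open>The quotient by the relations and its involution\<close>

lemma ring_free_ring: "ring free_ring"
proof (rule ringI)
  show "abelian_group free_ring"
  proof (rule abelian_groupI)
    show "\<exists>y\<in>carrier free_ring. y \<oplus>\<^bsub>free_ring\<^esub> x = \<zero>\<^bsub>free_ring\<^esub>" if "x \<in> carrier free_ring" for x
      by (rule bexI[of _ "- x"]) (simp_all add: free_ring_def)
  qed (simp_all add: free_ring_def add.assoc add.commute)
  show "Group.monoid free_ring"
    by (rule monoidI) (simp_all add: free_ring_def mult.assoc)
qed (simp_all add: free_ring_def distrib_left distrib_right)

lemma ideal_podles_ideal: "ideal (podles_ideal q t) free_ring"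
  unfolding podles_ideal_def by (rule ring.genideal_ideal[OF ring_free_ring]) (simp add: free_ring_def)

lemma podles_relations_subset: "podles_relations q t \<subseteq> podles_ideal q t"
  unfolding podles_ideal_def by (rule ring.genideal_self[OF ring_free_ring]) (simp add: free_ring_def)

lemma a_inv_free_ring: "\<ominus>\<^bsub>free_ring\<^esub> x = - x"
proof -
  interpret ring free_ring by (rule ring_free_ring)
  show ?thesis by (rule minus_equality) (simp_all add: free_ring_def)
qed

lemma podles_ideal_zero: "0 \<in> podles_ideal q t"
  and podles_ideal_add: "a \<in> podles_ideal q t \<Longrightarrow> b \<in> podles_ideal q t \<Longrightarrow> a + b \<in> podles_ideal q t"
  and podles_ideal_minus: "a \<in> podles_ideal q t \<Longrightarrow> - a \<in> podles_ideal q t"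
  and podles_ideal_mult_left: "a \<in> podles_ideal q t \<Longrightarrow> x * a \<in> podles_ideal q t"
  and podles_ideal_mult_right: "a \<in> podles_ideal q t \<Longrightarrow> a * x \<in> podles_ideal q t"
proof -
  interpret ideal "podles_ideal q t" free_ring by (rule ideal_podles_ideal)
  have simps: "carrier free_ring = UNIV" "(\<otimes>\<^bsub>free_ring\<^esub>) = (*)" "(\<oplus>\<^bsub>free_ring\<^esub>) = (+)" "\<zero>\<^bsub>free_ring\<^esub> = 0"
    by (simp_all add: free_ring_def)
  show "0 \<in> podles_ideal q t" using additive_subgroup.zero_closed[OF additive_subgroup_axioms] by (simp add: simps)
  show "a \<in> podles_ideal q t \<Longrightarrow> b \<in> podles_ideal q t \<Longrightarrow> a + b \<in> podles_ideal q t"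
    using additive_subgroup.a_closed[OF additive_subgroup_axioms] by (simp add: simps)
  show "a \<in> podles_ideal q t \<Longrightarrow> - a \<in> podles_ideal q t"
    using I_l_closed[of a "- 1"] by (simp add: simps)
  show "a \<in> podles_ideal q t \<Longrightarrow> x * a \<in> podles_ideal q t"
    using I_l_closed by (simp add: simps)
  show "a \<in> podles_ideal q t \<Longrightarrow> a * x \<in> podles_ideal q t"
    using I_r_closed by (simp add: simps)
qed

lemma podles_ideal_diff:
  "a \<in> podles_ideal q t \<Longrightarrow> b \<in> podles_ideal q t \<Longrightarrow> a - b \<in> podles_ideal q t"
  using podles_ideal_add[of a q t "- b"] podles_ideal_minus by simp

lemma mem_podles_coset: "x \<in> podles_coset q t p \<longleftrightarrow> x - p \<in> podles_ideal q t"
proof -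
  have "podles_coset q t p = {i + p |i. i \<in> podles_ideal q t}"
    by (auto simp: podles_coset_def a_r_coset_def' free_ring_def)
  thus ?thesis by (auto intro!: exI[of _ "x - p"])
qed

lemma podles_coset_eqI:
  assumes "p - p' \<in> podles_ideal q t"
  shows "podles_coset q t p = podles_coset q t p'"
proof -
  have "x - p \<in> podles_ideal q t \<longleftrightarrow> x - p' \<in> podles_ideal q t" for x
    using podles_ideal_add[OF _ assms, of "x - p"] podles_ideal_diff[OF _ assms, of "x - p'"] by auto
  thus ?thesis by (auto simp: mem_podles_coset)
qed

text \<open>The elements whose star lies in the ideal form an ideal themselves, as
  \<open>star_free\<close> exchanges left and right multiples. So only the relations are to be
  checked: the star exchanges the first two up to a scalar and fixes the last two.\<close>

lemma podles_ideal_star: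
  assumes q: "q \<noteq> 0" and "p \<in> podles_ideal q t"
  shows "star_free q p \<in> podles_ideal q t"
proof -
  define S where "S = {p. star_free q p \<in> podles_ideal q t}"
  define y where "y = var X0 - rconst t"
  have sy: "star_free q y = y" by (simp add: y_def star_free_diff star_free_var star_free_const)
  define r1 where "r1 = var Xm * y - rconst (q\<^sup>2) * y * var Xm"
  define r2 where "r2 = var Xp * y - rconst (inverse (q\<^sup>2)) * y * var Xp"
  have rel: "r1 \<in> podles_ideal q t" "r2 \<in> podles_ideal q t"
    using podles_relations_subset[of q t] by (auto simp: podles_relations_def r1_def r2_def y_def)
  have cc: "const a * (const b * z) = const (a * b) * z" for a b z
    by (simp add: const_mult mult.assoc)
  have p1: "y * (rconst a * z) = rconst a * (y * z)" for a z
    by (rule const_left_commute)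
  have p2: "rconst a * x * (z * rconst b) = rconst (a * b) * (x * z)" for a b x z
    by (simp only: const_central[of z] const_mult_mult of_real_mult)
  have p3: "rconst a * (x - rconst b * z * w) = rconst a * x - rconst (a * b) * (z * w)" for a b x z w
    by (simp only: right_diff_distrib mult.assoc cc of_real_mult)
  have "star_free q r1 = rconst (- inverse q) * (y * var Xp) - rconst (- inverse q * q\<^sup>2) * (var Xp * y)"
    unfolding r1_def star_free_diff star_free_mult star_free_var sy star_free_const
      star_gen.simps p1 p2 complex_cnj_complex_of_real ..
  also have "\<dots> = rconst q * r2"
  proof -
    have "- inverse q * q\<^sup>2 = - q" "q * inverse (q\<^sup>2) = inverse q"
      using q by (simp_all add: power2_eq_square)
    thus ?thesis unfolding r2_def p3 by (simp only: of_real_minus const_minus) simp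
  qed
  finally have s1: "r1 \<in> S" using rel(2) podles_ideal_mult_left by (simp add: S_def)
  have "star_free q r2 = rconst (- q) * (y * var Xm) - rconst (- q * inverse (q\<^sup>2)) * (var Xm * y)"
    unfolding r2_def star_free_diff star_free_mult star_free_var sy star_free_const
      star_gen.simps p1 p2 complex_cnj_complex_of_real ..
  also have "\<dots> = rconst (inverse q) * r1"
  proof -
    have "- q * inverse (q\<^sup>2) = - inverse q" "inverse q * q\<^sup>2 = q"
      using q by (simp_all add: power2_eq_square)
    thus ?thesis unfolding r1_def p3 by (simp only: of_real_minus const_minus) simp
  qed
  finally have s2: "r2 \<in> S" using rel(1) podles_ideal_mult_left by (simp add: S_def)
  \<comment> \<open>The star reverses these two factors, which is harmless since both are
    polynomials in \<open>var X0\<close>.\<close>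
  have comm: "y * (rconst a * var X0 + rconst b) = (rconst a * var X0 + rconst b) * y" for a b
    by (simp add: y_def left_diff_distrib right_diff_distrib distrib_left distrib_right mult.assoc
        const_central[of "var X0"] const_left_commute[of "var X0"] cc
        mult.commute[where 'a = complex] flip: const_mult)
  have sx: "star_free q (rconst a * var X0 + rconst b) = rconst a * var X0 + rconst b" for a b
    by (simp add: star_free_add star_free_scale star_free_const star_free_var)
  \<comment> \<open>The scalars in the stars of \<open>Xm\<close> and \<open>Xp\<close> are - 1/q
    and - q, with product 1.\<close>
  have p4: "const a * x * (const b * z * - const c) = - const c * x * z" if "a * b = 1" for a b c x z
  proof -
    have "const a * x * (const b * z * const c) = const (a * b * c) * (x * z)"
      by (simp only: mult.assoc const_central[of z] const_left_commute[of x] cc)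
    thus ?thesis using that by (simp add: mult.assoc)
  qed
  have s3: "star_free q (- rconst d * var Xm * var Xp) = - rconst d * var Xm * var Xp"
    "star_free q (- rconst d * var Xp * var Xm) = - rconst d * var Xp * var Xm" for d
    unfolding star_free_mult star_free_minus star_free_const star_free_var star_gen.simps
      complex_cnj_complex_of_real
    by (rule p4, use q in \<open>simp flip: of_real_mult\<close>)+
  have fixed: "star_free q r = r \<Longrightarrow> r \<in> podles_relations q t \<Longrightarrow> r \<in> S" for r
    using podles_relations_subset by (auto simp: S_def)
  have "podles_relations q t \<subseteq> S"
  proof
    fix r assume r: "r \<in> podles_relations q t"
    then consider "r = r1" | "r = r2"
      | "r = - rconst (qnum q 2) * var Xm * var Xp + (rconst (q\<^sup>2) * var X0 + rconst t) * y
              - rconst ((qnum q 2)\<^sup>2 * (1 - t))"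
      | "r = - rconst (qnum q 2) * var Xp * var Xm + (rconst (inverse (q\<^sup>2)) * var X0 + rconst t) * y
              - rconst ((qnum q 2)\<^sup>2 * (1 - t))"
      unfolding podles_relations_def r1_def r2_def y_def by blast
    thus "r \<in> S"
    proof cases
      case 3
      show ?thesis
        by (rule fixed[OF _ r]) (simp only: 3 star_free_diff star_free_add[of _ "- _ * _ * _"] s3 star_free_mult[of _ _ y] sy sx comm
            star_free_const complex_cnj_complex_of_real)
    next
      case 4
      show ?thesis
        by (rule fixed[OF _ r]) (simp only: 4 star_free_diff star_free_add[of _ "- _ * _ * _"] s3 star_free_mult[of _ _ y] sy sx comm
            star_free_const complex_cnj_complex_of_real)
    qed (use s1 s2 in auto)
  qed
  moreover have "ideal S free_ring"
  proof (rule idealI[OF ring_free_ring])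
    show "subgroup S (add_monoid free_ring)"
    proof (rule group.subgroupI)
      show "Group.group (add_monoid free_ring)"
        by (rule abelian_group.a_group[OF ring.is_abelian_group[OF ring_free_ring]])
      show "inv\<^bsub>add_monoid free_ring\<^esub> a \<in> S" if "a \<in> S" for a
        using that a_inv_free_ring[of a] by (simp add: a_inv_def S_def star_free_minus podles_ideal_minus)
      show "S \<noteq> {}" using podles_ideal_zero by (auto simp: S_def intro!: exI[of _ 0])
    qed (auto simp: S_def free_ring_def star_free_add podles_ideal_add)
  qed (auto simp: S_def free_ring_def star_free_mult podles_ideal_mult_left podles_ideal_mult_right)
  ultimately have "podles_ideal q t \<subseteq> S"
    unfolding podles_ideal_def by (intro ring.genideal_minimal[OF ring_free_ring])
  thus ?thesis using assms(2) by (auto simp: S_def)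
qed

lemma podles_carrier: "carrier (podles_algebra q t) = range (podles_coset q t)"
  by (auto simp: podles_algebra_def Let_def FactRing_def A_RCOSETS_def' podles_coset_def free_ring_def)

lemma podles_one: "\<one>\<^bsub>podles_algebra q t\<^esub> = podles_coset q t 1"
  by (simp add: podles_algebra_def Let_def FactRing_def podles_coset_def)
    (simp add: free_ring_def)

lemma podles_zero: "\<zero>\<^bsub>podles_algebra q t\<^esub> = podles_coset q t 0"
  by (auto simp: podles_algebra_def Let_def FactRing_def mem_podles_coset)

lemma podles_mult: "podles_coset q t p \<otimes>\<^bsub>podles_algebra q t\<^esub> podles_coset q t p' = podles_coset q t (p * p')"
  and podles_add: "podles_coset q t p \<oplus>\<^bsub>podles_algebra q t\<^esub> podles_coset q t p' = podles_coset q t (p + p')"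
proof -
  have h: "(+>\<^bsub>free_ring\<^esub>) (podles_ideal q t) \<in> ring_hom free_ring (free_ring Quot podles_ideal q t)"
    by (rule ideal.rcos_ring_hom[OF ideal_podles_ideal])
  have c: "x \<in> carrier free_ring" for x by (simp add: free_ring_def)
  show "podles_coset q t p \<otimes>\<^bsub>podles_algebra q t\<^esub> podles_coset q t p' = podles_coset q t (p * p')"
    using ring_hom_mult[OF h c c, of p p'] by (simp add: podles_algebra_def Let_def podles_coset_def)
      (simp add: free_ring_def)
  show "podles_coset q t p \<oplus>\<^bsub>podles_algebra q t\<^esub> podles_coset q t p' = podles_coset q t (p + p')"
    using ring_hom_add[OF h c c, of p p'] by (simp add: podles_algebra_def Let_def podles_coset_def)
      (simp add: free_ring_def)
qed

lemma mem_podles_coset_self: "p \<in> podles_coset q t p"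
  by (simp add: mem_podles_coset podles_ideal_zero)

text \<open>The union over representatives collapses to one coset, because scalar multiplication
  preserves the ideal.\<close>

lemma podles_smult: "c \<odot>\<^bsub>podles_algebra q t\<^esub> podles_coset q t p = podles_coset q t (const c * p)"
proof -
  have "podles_coset q t (const c * x) = podles_coset q t (const c * p)" if "x \<in> podles_coset q t p" for x
    using podles_ideal_mult_left[of "x - p" q t "const c"] that
    by (intro podles_coset_eqI) (simp add: mem_podles_coset right_diff_distrib)
  hence "(\<Union>x\<in>podles_coset q t p. podles_coset q t (const c * x)) = (\<Union>x\<in>podles_coset q t p. podles_coset q t (const c * p))"
    by (intro SUP_cong refl)
  also have "\<dots> = podles_coset q t (const c * p)"
    using mem_podles_coset_self[of p q t] by blast
  finally show ?thesis by (simp add: podles_algebra_def Let_def)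
qed

text \<open>Here independence of the representative rests on the stability of the ideal under the
  involution.\<close>

lemma podles_star:
  assumes "q \<noteq> 0"
  shows "star (podles_algebra q t) (podles_coset q t p) = podles_coset q t (star_free q p)"
proof -
  have "podles_coset q t (star_free q x) = podles_coset q t (star_free q p)" if "x \<in> podles_coset q t p" for x
    using podles_ideal_star[OF assms, of "x - p" t] that
    by (intro podles_coset_eqI) (simp add: mem_podles_coset star_free_diff)
  hence "(\<Union>x\<in>podles_coset q t p. podles_coset q t (star_free q x)) = (\<Union>x\<in>podles_coset q t p. podles_coset q t (star_free q p))"
    by (intro SUP_cong refl)
  also have "\<dots> = podles_coset q t (star_free q p)"
    using mem_podles_coset_self[of p q t] by blast
  finally show ?thesis by (simp add: podles_algebra_def Let_def)
qed

lemma complex_star_algebra_podles: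
  assumes "q \<noteq> 0"
  shows "complex_star_algebra (podles_algebra q t)"
proof -
  note simps = podles_carrier podles_one podles_zero podles_mult podles_add podles_smult podles_star[OF assms]
  show ?thesis
  proof (intro complex_star_algebra.intro ringI abelian_groupI monoidI complex_star_algebra_axioms.intro)
    fix x assume "x \<in> carrier (podles_algebra q t)"
    then obtain p where p: "x = podles_coset q t p" by (auto simp: podles_carrier)
    show "\<exists>y\<in>carrier (podles_algebra q t). y \<oplus>\<^bsub>podles_algebra q t\<^esub> x = \<zero>\<^bsub>podles_algebra q t\<^esub>"
      by (rule bexI[of _ "podles_coset q t (- p)"]) (simp_all add: simps p)
    fix c y assume "y \<in> carrier (podles_algebra q t)"
    then obtain p' where p': "y = podles_coset q t p'" by (auto simp: podles_carrier)
    show "x \<otimes>\<^bsub>podles_algebra q t\<^esub> (c \<odot>\<^bsub>podles_algebra q t\<^esub> y)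
        = c \<odot>\<^bsub>podles_algebra q t\<^esub> (x \<otimes>\<^bsub>podles_algebra q t\<^esub> y)"
      by (simp only: simps p p' const_left_commute[of p])
  qed (auto simp: simps distrib_left distrib_right mult.assoc add.assoc add.commute add.left_commute
      const_add const_mult star_free_star_free[OF assms] star_free_add star_free_mult star_free_const
      const_central[of "star_free q p" for p])
qed

section \<open>The Dirac operator\<close>

text \<open>The eigenvalue of |D|; on \<open>spinor_index\<close> it is a positive integer.\<close>

definition spin_value :: "real \<times> real \<times> real \<Rightarrow> real" where
  "spin_value i = fst i + 1/2"

definition spin_flip :: "real \<times> real \<times> real \<Rightarrow> real \<times> real \<times> real" where
  "spin_flip i = (fst i, fst (snd i), - snd (snd i))"

text \<open>The amounts are subtracted, since \<open>wshift\<close> wants the source of the arrow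
  that ends at \<open>i\<close>.\<close>

definition spin_shift :: "real \<Rightarrow> real \<Rightarrow> real \<times> real \<times> real \<Rightarrow> real \<times> real \<times> real" where
  "spin_shift s r i = (fst i - s, fst (snd i) - r, snd (snd i))"

lemma spinor_index_flip [simp]: "spin_flip i \<in> spinor_index \<longleftrightarrow> i \<in> spinor_index"
  by (cases i) (auto simp: spin_flip_def spinor_index_def)

lemma spinor_index_signs:
  assumes "(l, m, N) \<in> spinor_index"
  shows "(l, m, 1/2) \<in> spinor_index" "(l, m, - 1/2) \<in> spinor_index" "N = 1/2 \<or> N = - 1/2"
  using assms by (auto simp: spinor_index_def)

lemma spin_value_flip [simp]: "spin_value (spin_flip i) = spin_value i"
  by (simp add: spin_flip_def spin_value_def)

lemma spin_flip_shift: "spin_flip (spin_shift s r i) = spin_shift s r (spin_flip i)"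
  by (simp add: spin_flip_def spin_shift_def)

lemma spin_value_ge_1: "i \<in> spinor_index \<Longrightarrow> 1 \<le> spin_value i"
  by (auto simp: spinor_index_def spin_value_def)

definition spinor_enum :: "nat \<times> nat \<times> real \<Rightarrow> real \<times> real \<times> real" where
  "spinor_enum = (\<lambda>(n, k, N). (real n + 1/2, real k - (real n + 1/2), N))"

lemma inj_spinor_enum: "inj_on spinor_enum S"
  by (auto simp: spinor_enum_def inj_on_def)

text \<open>The eigenvalue n + 1 belongs to l = n + 1/2, which admits 2 l + 1 = 2 n + 2 values of m
  and two signs.\<close>

lemma spinor_level:
  "{i \<in> spinor_index. spin_value i = real (Suc n)} = spinor_enum ` ({n} \<times> {..2 * n + 1} \<times> {1/2, - 1/2})"
proof (intro equalityI subsetI)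
  fix i assume "i \<in> {i \<in> spinor_index. spin_value i = real (Suc n)}"
  then obtain k :: nat and N where "i = (real n + 1/2, real k - (real n + 1/2), N)"
    "real k - (real n + 1/2) \<le> real n + 1/2" "N \<in> {1/2, - 1/2}"
    by (auto simp: spinor_index_def spin_value_def)
  moreover from this(2) have "k \<le> 2 * n + 1" by linarith
  ultimately show "i \<in> spinor_enum ` ({n} \<times> {..2 * n + 1} \<times> {1/2, - 1/2})"
    by (force simp: spinor_enum_def)
next
  fix i assume "i \<in> spinor_enum ` ({n} \<times> {..2 * n + 1} \<times> {1/2, - 1/2})"
  then obtain k N where "k \<le> 2 * n + 1" "N \<in> {1/2, - 1/2}" "i = spinor_enum (n, k, N)"
    by (elim imageE SigmaE) blast
  hence i: "i = (real n + 1/2, real k - (real n + 1/2), N)" "k \<le> 2 * n + 1" "N \<in> {1/2, - 1/2}"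
    by (simp_all add: spinor_enum_def)
  have "real k \<le> 2 * real n + 1" using i(2) by linarith
  thus "i \<in> {i \<in> spinor_index. spin_value i = real (Suc n)}"
    using i(1,3) by (auto simp: spinor_index_def spin_value_def)
qed

lemma finite_spinor_level: "finite {i \<in> spinor_index. spin_value i = real (Suc n)}"
  unfolding spinor_level by simp

lemma card_spinor_level: "card {i \<in> spinor_index. spin_value i = real (Suc n)} = 4 * Suc n"
  unfolding spinor_level card_image[OF inj_spinor_enum] by (simp add: card_cartesian_product)

lemma spin_value_Suc:
  assumes "i \<in> spinor_index"
  obtains n where "spin_value i = real (Suc n)"
  using assms by (auto simp: spinor_index_def spin_value_def)

lemma finite_spin_value_le: "finite {i \<in> spinor_index. spin_value i \<le> c}"
proof (rule finite_subset)
  show "{i \<in> spinor_index. spin_value i \<le> c}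
      \<subseteq> (\<Union>n\<le>nat \<lceil>c\<rceil>. {i \<in> spinor_index. spin_value i = real (Suc n)})"
  proof
    fix i assume i: "i \<in> {i \<in> spinor_index. spin_value i \<le> c}"
    then obtain n where n: "spin_value i = real (Suc n)" using spin_value_Suc by blast
    hence "n \<le> nat \<lceil>c\<rceil>" using i by (simp, linarith)
    thus "i \<in> (\<Union>n\<le>nat \<lceil>c\<rceil>. {i \<in> spinor_index. spin_value i = real (Suc n)})" using i n by blast
  qed
qed (use finite_spinor_level in blast)

lemma finite_vanishing:
  assumes "\<And>i. i \<in> spinor_index \<Longrightarrow> cmod (b i) \<le> 1 / spin_value i" "d > 0"
  shows "finite {i \<in> spinor_index. cmod (b i) > d}"
proof (rule finite_subset[OF _ finite_spin_value_le[of "1 / d"]], clarify)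
  fix l m N assume i: "(l, m, N) \<in> spinor_index" and "d < cmod (b (l, m, N))"
  hence "d < 1 / spin_value (l, m, N)" using assms(1) by force
  thus "spin_value (l, m, N) \<le> 1 / d" using spin_value_ge_1[OF i] assms(2) by (simp add: field_simps)
qed

section \<open>Counting the eigenvalues of |D|\<close>

definition inv_bracket :: "real \<Rightarrow> real" where
  "inv_bracket x = 1 / sqrt (x\<^sup>2 + 1)"

lemma inv_bracket_nonneg: "0 \<le> inv_bracket x"
  by (simp add: inv_bracket_def)

lemma inv_bracket_le:
  assumes "0 < x" shows "inv_bracket x \<le> 1 / x"
proof -
  have "x \<le> sqrt (x\<^sup>2 + 1)" by (rule real_le_rsqrt) simp
  thus ?thesis unfolding inv_bracket_def using assms by (intro frac_le) auto
qed

lemma inv_bracket_antimono: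
  assumes "0 \<le> x" "x \<le> y" shows "inv_bracket y \<le> inv_bracket x"
  unfolding inv_bracket_def using assms
  by (intro divide_left_mono real_sqrt_le_mono add_right_mono power_mono mult_pos_pos)
    (auto intro: add_nonneg_pos)

lemma inv_bracket_eq_iff:
  assumes "0 \<le> x" "0 \<le> y" shows "inv_bracket x = inv_bracket y \<longleftrightarrow> x = y"
  using assms by (auto simp: inv_bracket_def power2_eq_iff_nonneg)

text \<open>The eigenvalue \<open>n\<close> of \<open>|D|\<close> has multiplicity \<open>4 n\<close>, so the eigenvalues up to \<open>n\<close> fill the first
  \<open>2 n (n + 1)\<close> places.\<close>

definition level_of :: "nat \<Rightarrow> nat" where
  "level_of k = (LEAST n. k < 2 * n * (n + 1))"

text \<open>A Galois connection, from which the later facts on \<open>level_of\<close> follow; n = k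
  + 1 shows that the minimum exists.\<close>

lemma level_of_le_iff: "level_of k \<le> n \<longleftrightarrow> k < 2 * n * (n + 1)"
proof
  have "k < 2 * Suc k * (Suc k + 1)" by simp
  hence "k < 2 * level_of k * (level_of k + 1)" unfolding level_of_def by (rule LeastI)
  moreover assume "level_of k \<le> n"
  hence "2 * level_of k * (level_of k + 1) \<le> 2 * n * (n + 1)" by (intro mult_le_mono) auto
  ultimately show "k < 2 * n * (n + 1)" by linarith
next
  assume "k < 2 * n * (n + 1)"
  thus "level_of k \<le> n" unfolding level_of_def by (rule Least_le)
qed

lemma level_of_pos: "0 < level_of k"
  using level_of_le_iff[of k 0] by simp

lemma mono_level_of: "j \<le> k \<Longrightarrow> level_of j \<le> level_of k"
  using level_of_le_iff[of k "level_of k"] by (simp add: level_of_le_iff)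

lemma level_of_level: "{k. level_of k = Suc n} = {2 * n * (n + 1)..<2 * Suc n * (Suc n + 1)}"
proof -
  have "level_of k = Suc n \<longleftrightarrow> \<not> level_of k \<le> n \<and> level_of k \<le> Suc n" for k by auto
  thus ?thesis
    by (simp only: level_of_le_iff not_less set_eq_iff mem_Collect_eq atLeastLessThan_iff simp_thms)
qed

lemma card_level_of: "card {k. level_of k = Suc n} = 4 * Suc n"
  unfolding level_of_level by simp

lemma finite_level_of: "finite {k. level_of k = Suc n}"
  unfolding level_of_level by simp

text \<open>At level n one has k < 2 n (n + 1) \<le> (2 n)^2, hence 1 / n \<le> 2 / sqrt k.\<close>

lemma inv_bracket_level_bigo: "(\<lambda>k. inv_bracket (real (level_of k))) \<in> O(\<lambda>k. real k powr (- 1 / 2))"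
proof (rule bigoI)
  show "\<forall>\<^sub>F k in sequentially. norm (inv_bracket (real (level_of k))) \<le> 2 * norm (real k powr (- 1 / 2))"
    \<comment> \<open>The bound fails at k = 0, where \<open>0 powr (- 1 / 2)\<close> is 0 by
      convention.\<close>
    using eventually_gt_at_top[of 0]
  proof eventually_elim
    fix k :: nat assume k: "0 < k"
    define n where "n = level_of k"
    have n: "1 \<le> n" using level_of_pos[of k] by (simp add: n_def)
    have "k < 2 * n * (n + 1)" using level_of_le_iff[of k n] by (simp add: n_def)
    also have "\<dots> \<le> 2 * n * (2 * n)" using n by (intro mult_le_mono) auto
    finally have "real k \<le> real (2 * n * (2 * n))" by (simp only: of_nat_le_iff less_imp_le)
    hence "real k \<le> (2 * real n)\<^sup>2" by (simp add: power2_eq_square)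
    hence "sqrt (real k) \<le> 2 * real n" by (intro real_le_lsqrt) auto
    hence "2 / (2 * real n) \<le> 2 / sqrt (real k)" using k n by (intro divide_left_mono mult_pos_pos) auto
    hence "1 / real n \<le> 2 / sqrt (real k)" by simp
    moreover have "inv_bracket (real n) \<le> 1 / real n" using n by (intro inv_bracket_le) auto
    moreover have "2 * real k powr (- 1 / 2) = 2 / sqrt (real k)"
    proof -
      have "(- 1 / 2 :: real) = - (1 / 2)" by simp
      thus ?thesis by (simp only: powr_minus powr_half_sqrt[OF of_nat_0_le_iff] divide_inverse[of 2])
    qed
    ultimately show "norm (inv_bracket (real (level_of k))) \<le> 2 * norm (real k powr (- 1 / 2))"
      using inv_bracket_nonneg by (simp add: n_def)
  qed
qed

text \<open>\<open>D\<close> is prescribed on basis vectors only; self-adjointness fixes the rest of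
  its graph.\<close>

locale dirac_spinors = onb spinor_index v
  for v :: "real \<times> real \<times> real \<Rightarrow> 'h::complex_hilbert" +
  fixes D :: "'h rel"
  assumes self_adjoint_D: "self_adjoint D"
    and D_basis: "\<And>l m N. (l, m, N) \<in> spinor_index \<Longrightarrow>
           (v (l, m, N), (l + 1/2) *\<^sub>R v (l, m, - N)) \<in> D"
begin

text \<open>Here \<open>N\<close> encodes the sign 2 N of the eigenvalue instead of a spin
  component, so that both bases share one index set.\<close>

definition dirac_vector :: "real \<times> real \<times> real \<Rightarrow> 'h" where
  "dirac_vector = (\<lambda>(l, m, N). (1 / sqrt 2) *\<^sub>R (v (l, m, 1/2) + (2 * N) *\<^sub>R v (l, m, - 1/2)))"

definition dirac_value :: "real \<times> real \<times> real \<Rightarrow> real" where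
  "dirac_value i = 2 * snd (snd i) * spin_value i"

lemma cinner_dirac_vector:
  assumes "(l, m, N) \<in> spinor_index"
  shows "cinner (dirac_vector (l, m, N)) x
    = complex_of_real (1 / sqrt 2) * (coef x (l, m, 1/2) + complex_of_real (2 * N) * coef x (l, m, - 1/2))"
proof -
  have "(l, m, 1/2) \<in> spinor_index" "(l, m, - 1/2) \<in> spinor_index"
    using spinor_index_signs[OF assms] by blast+
  thus ?thesis
    by (simp add: dirac_vector_def coef_def cinner_scaleR_left cinner_add_left)
qed

lemma onb_dirac_vector: "onb spinor_index dirac_vector"
proof
  fix i j :: "real \<times> real \<times> real" assume i: "i \<in> spinor_index" and j: "j \<in> spinor_index"
  obtain l m N l' m' N' where ij: "i = (l, m, N)" "j = (l', m', N')" by (cases i, cases j) auto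
  have N: "N = 1/2 \<or> N = - 1/2" "N' = 1/2 \<or> N' = - 1/2"
    using i j spinor_index_signs(3) unfolding ij by blast+
  have mem: "(l, m, 1/2) \<in> spinor_index" "(l, m, - 1/2) \<in> spinor_index"
    "(l', m', 1/2) \<in> spinor_index" "(l', m', - 1/2) \<in> spinor_index"
    using i j spinor_index_signs unfolding ij by blast+
  define r where "r = complex_of_real (1 / sqrt 2)"
  have s: "r * r = 1 / 2"
    unfolding r_def of_real_mult[symmetric] by (simp add: real_sqrt_mult_self)
  have c: "coef (dirac_vector j) (l, m, M)
      = r * (if (l', m') = (l, m) then (if M = 1/2 then 1 else 0)
        + complex_of_real (2 * N') * (if M = - 1/2 then 1 else 0) else 0)" if "M = 1/2 \<or> M = - 1/2" for M
    using mem that by (auto simp: dirac_vector_def ij coef_scaleR coef_add coef_basis r_def)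
  have "cinner (dirac_vector i) (dirac_vector j)
      = (r * r) * (if (l', m') = (l, m) then 1 + complex_of_real (2 * N) * complex_of_real (2 * N') else 0)"
    unfolding ij(1) cinner_dirac_vector[OF i[unfolded ij(1)]] r_def[symmetric] by (simp add: c algebra_simps)
  also have "\<dots> = (if i = j then 1 else 0)"
    unfolding s ij using N by (elim disjE; simp only:; simp)
  finally show "cinner (dirac_vector i) (dirac_vector j) = (if i = j then 1 else 0)" .
next
  fix x assume x: "\<And>i. i \<in> spinor_index \<Longrightarrow> cinner (dirac_vector i) x = 0"
  have "coef x (l, m, N) = 0" if i: "(l, m, N) \<in> spinor_index" for l m N
  proof -
    have mem: "(l, m, 1/2) \<in> spinor_index" "(l, m, - 1/2) \<in> spinor_index" "N = 1/2 \<or> N = - 1/2"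
      using spinor_index_signs[OF i] by blast+
    \<comment> \<open>The vectors for the two signs test the sum and the difference of the two
      coordinates.\<close>
    have "coef x (l, m, 1/2) + coef x (l, m, - 1/2) = 0" "coef x (l, m, 1/2) - coef x (l, m, - 1/2) = 0"
      using x[OF mem(1)] x[OF mem(2)] unfolding cinner_dirac_vector[OF mem(1)] cinner_dirac_vector[OF mem(2)]
      by simp_all
    hence "coef x (l, m, 1/2) = 0" "coef x (l, m, - 1/2) = 0" by (auto simp: eq_neg_iff_add_eq_0)
    thus ?thesis using mem(3) by (elim disjE) (simp_all only:)
  qed
  hence "x = 0" by (intro coef_eqI) auto
  thus "x = 0" .
qed

sublocale dirac: onb spinor_index dirac_vector
  by (rule onb_dirac_vector)

lemma D_eq_dirac_Diag: "D = dirac.Diag (\<lambda>i. complex_of_real (dirac_value i))"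
proof (rule dirac.self_adjoint_eq_Diag[OF self_adjoint_D])
  fix i :: "real \<times> real \<times> real" assume i: "i \<in> spinor_index"
  obtain l m N where ij: "i = (l, m, N)" by (cases i) auto
  have mem: "(l, m, 1/2) \<in> spinor_index" "(l, m, - 1/2) \<in> spinor_index" "N = 1/2 \<or> N = - 1/2"
    using spinor_index_signs[OF i[unfolded ij]] by blast+
  have "(v (l, m, 1/2), (l + 1/2) *\<^sub>R v (l, m, - 1/2)) \<in> D" "(v (l, m, - 1/2), (l + 1/2) *\<^sub>R v (l, m, 1/2)) \<in> D"
    using D_basis[OF mem(1)] D_basis[OF mem(2)] by simp_all
  from self_adjoint_scale[OF self_adjoint_D self_adjoint_add[OF self_adjoint_D this(1)
      self_adjoint_scale[OF self_adjoint_D this(2), of "complex_of_real (2 * N)"]], of "complex_of_real (1 / sqrt 2)"]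
  have "((1 / sqrt 2) *\<^sub>R (v (l, m, 1/2) + (2 * N) *\<^sub>R v (l, m, - 1/2)),
     (1 / sqrt 2) *\<^sub>R ((l + 1/2) *\<^sub>R v (l, m, - 1/2) + (2 * N) *\<^sub>R (l + 1/2) *\<^sub>R v (l, m, 1/2))) \<in> D"
    by (simp only: scaleR_scaleC[symmetric])
  moreover have "(1 / sqrt 2) *\<^sub>R ((l + 1/2) *\<^sub>R v (l, m, - 1/2) + (2 * N) *\<^sub>R (l + 1/2) *\<^sub>R v (l, m, 1/2))
      = dirac_value i *\<^sub>R (1 / sqrt 2) *\<^sub>R (v (l, m, 1/2) + (2 * N) *\<^sub>R v (l, m, - 1/2))"
  proof -
    define a where "a = l + 1/2"
    have d: "dirac_value i = 2 * N * a" by (simp add: ij dirac_value_def spin_value_def a_def)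
    show ?thesis
      unfolding d a_def[symmetric] using mem(3)
    proof
      assume N: "N = 1/2"
      show "(1 / sqrt 2) *\<^sub>R (a *\<^sub>R v (l, m, - 1/2) + (2 * N) *\<^sub>R a *\<^sub>R v (l, m, 1/2))
        = (2 * N * a) *\<^sub>R (1 / sqrt 2) *\<^sub>R (v (l, m, 1/2) + (2 * N) *\<^sub>R v (l, m, - 1/2))"
        unfolding N by (simp add: scaleR_add_right mult.commute)
    next
      assume N: "N = - 1/2"
      show "(1 / sqrt 2) *\<^sub>R (a *\<^sub>R v (l, m, - 1/2) + (2 * N) *\<^sub>R a *\<^sub>R v (l, m, 1/2))
        = (2 * N * a) *\<^sub>R (1 / sqrt 2) *\<^sub>R (v (l, m, 1/2) + (2 * N) *\<^sub>R v (l, m, - 1/2))"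
        unfolding N by (simp add: scaleR_diff_right mult.commute)
    qed
  qed
  ultimately show "(dirac_vector i, complex_of_real (dirac_value i) *\<^sub>C dirac_vector i) \<in> D"
    by (simp add: dirac_vector_def ij scaleR_scaleC[symmetric])
qed simp

lemma dirac_value_squared:
  assumes "i \<in> spinor_index" shows "(dirac_value i)\<^sup>2 = (spin_value i)\<^sup>2"
proof -
  obtain l m N where i: "i = (l, m, N)" by (cases i) auto
  have "2 * N = 1 \<or> 2 * N = - 1" using spinor_index_signs(3)[OF assms[unfolded i]] by auto
  hence "(2 * N)\<^sup>2 = 1" by (metis power2_eq_1_iff)
  thus ?thesis by (simp only: dirac_value_def i power_mult_distrib[of "2 * N"] fst_conv snd_conv mult_1)
qed

text \<open>Two flips cancel, so the square is diagonal in \<open>v\<close> although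
  \<open>D\<close> is not. Its self-adjointness is seen in the eigenbasis of \<open>D\<close>, and
  then its eigenvectors in \<open>v\<close> determine it.\<close>

lemma D_squared: "D O D = Diag (\<lambda>i. complex_of_real ((spin_value i)\<^sup>2))"
proof (rule self_adjoint_eq_Diag)
  have "D O D = dirac.Diag (\<lambda>i. complex_of_real ((dirac_value i)\<^sup>2))"
    by (simp only: D_eq_dirac_Diag dirac.Diag_O_Diag)
  thus "self_adjoint (D O D)" by (simp only: dirac.self_adjoint_Diag complex_cnj_complex_of_real)
  fix i :: "real \<times> real \<times> real" assume i: "i \<in> spinor_index"
  obtain l m N where ij: "i = (l, m, N)" by (cases i) auto
  have j: "(l, m, - N) \<in> spinor_index" using i spinor_index_flip[of i] by (simp add: ij spin_flip_def)
  have "(v (l, m, N), (l + 1/2) *\<^sub>R v (l, m, - N)) \<in> D" using D_basis i by (simp add: ij)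
  moreover have "((l + 1/2) *\<^sub>R v (l, m, - N), (l + 1/2) *\<^sub>R (l + 1/2) *\<^sub>R v (l, m, N)) \<in> D"
    using self_adjoint_scale[OF self_adjoint_D D_basis[OF j], of "complex_of_real (l + 1/2)"]
    by (simp only: scaleR_scaleC[symmetric] minus_minus)
  ultimately have "(v (l, m, N), (l + 1/2) *\<^sub>R (l + 1/2) *\<^sub>R v (l, m, N)) \<in> D O D" by blast
  thus "(v i, complex_of_real ((spin_value i)\<^sup>2) *\<^sub>C v i) \<in> D O D"
    by (simp add: ij spin_value_def power2_eq_square scaleR_scaleC[symmetric] del: of_real_mult of_real_add)
qed simp

lemma abs_D: "abs_op D = Diag (\<lambda>i. complex_of_real (spin_value i))"
proof -
  have "abs_op D = sqrt_op (D O D)" using self_adjoint_D by (simp add: abs_op_def self_adjoint_def)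
  moreover have "sqrt_op (Diag (\<lambda>i. complex_of_real ((spin_value i)\<^sup>2))) = Diag (\<lambda>i. complex_of_real (spin_value i))"
    by (rule sqrt_op_Diag) (use spin_value_ge_1 in force)
  ultimately show ?thesis by (simp only: D_squared)
qed

lemma self_adjoint_abs_D: "self_adjoint (abs_op D)"
  unfolding abs_D by (rule self_adjoint_Diag) simp

text \<open>This describes \<open>D\<close> in the coordinates in which the shifts act. Forwards,
  the adjoint is tested on basis vectors; backwards, the relation is carried to the eigenbasis,
  where the domain of \<open>D\<close> is known.\<close>

lemma mem_D: "(x, y) \<in> D \<longleftrightarrow> (\<forall>i\<in>spinor_index. coef y i = complex_of_real (spin_value i) * coef x (spin_flip i))"
proof
  assume xy: "(x, y) \<in> D"
  show "\<forall>i\<in>spinor_index. coef y i = complex_of_real (spin_value i) * coef x (spin_flip i)"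
  proof
    fix i :: "real \<times> real \<times> real" assume i: "i \<in> spinor_index"
    obtain l m N where ij: "i = (l, m, N)" by (cases i) auto
    have "(x, y) \<in> adjoint_op D" using xy self_adjoint_D by (simp add: self_adjoint_def)
    hence "cinner x ((l + 1/2) *\<^sub>R v (l, m, - N)) = cinner y (v (l, m, N))"
      using D_basis i unfolding ij adjoint_op_def by blast
    hence "cnj (cinner y (v (l, m, N))) = complex_of_real (l + 1/2) * cnj (cinner x (v (l, m, - N)))"
      by (metis cinner_scaleR_right complex_cnj_complex_of_real complex_cnj_mult)
    hence "cinner (v (l, m, N)) y = complex_of_real (l + 1/2) * cinner (v (l, m, - N)) x"
      by (metis cinner_commute)
    thus "coef y i = complex_of_real (spin_value i) * coef x (spin_flip i)"
      using i spinor_index_flip[of i] by (simp add: coef_def ij spin_value_def spin_flip_def)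
  qed
next
  assume c: "\<forall>i\<in>spinor_index. coef y i = complex_of_real (spin_value i) * coef x (spin_flip i)"
  show "(x, y) \<in> D"
    unfolding D_eq_dirac_Diag dirac.mem_Diag
  proof
    fix i :: "real \<times> real \<times> real" assume i: "i \<in> spinor_index"
    obtain l m N where ij: "i = (l, m, N)" by (cases i) auto
    have mem: "(l, m, 1/2) \<in> spinor_index" "(l, m, - 1/2) \<in> spinor_index" "N = 1/2 \<or> N = - 1/2"
      using spinor_index_signs[OF i[unfolded ij]] by blast+
    have cy: "coef y (l, m, 1/2) = complex_of_real (spin_value i) * coef x (l, m, - 1/2)"
      "coef y (l, m, - 1/2) = complex_of_real (spin_value i) * coef x (l, m, 1/2)"
      using c mem(1,2) by (auto simp: ij spin_value_def spin_flip_def)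
    have E: "dirac.coef z i = complex_of_real (1 / sqrt 2) *
        (coef z (l, m, 1/2) + complex_of_real (2 * N) * coef z (l, m, - 1/2))" for z
      using i cinner_dirac_vector[of l m N z] by (simp only: dirac.coef_def ij if_True)
    have d: "dirac_value i = 2 * N * spin_value i" by (simp add: dirac_value_def ij)
    from mem(3) show "dirac.coef y i = complex_of_real (dirac_value i) * dirac.coef x i"
    proof
      assume N: "N = 1/2"
      show ?thesis unfolding E d cy unfolding N by (simp add: algebra_simps)
    next
      assume N: "N = - 1/2"
      show ?thesis unfolding E d cy unfolding N by (simp add: algebra_simps)
    qed
  qed
qed

section \<open>Compact resolvent and singular values\<close>

lemma compact_resolvent: "\<exists>R. compact_operator R \<and> op_graph R = (plus_scalar D \<i>)\<inverse>"
proof -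
  define b where "b i = inverse (complex_of_real (dirac_value i) + \<i>)" for i
  have nz: "complex_of_real x + \<i> \<noteq> 0" for x by (simp add: complex_eq_iff)
  have "cmod (b i) \<le> 1 / spin_value i" if i: "i \<in> spinor_index" for i
  proof -
    \<comment> \<open>Adding the imaginary unit to the real eigenvalue can only enlarge its
      modulus.\<close>
    have "spin_value i = \<bar>Re (complex_of_real (dirac_value i) + \<i>)\<bar>"
      using dirac_value_squared[OF i] spin_value_ge_1[OF i] by (simp add: power2_eq_iff abs_if) linarith
    also have "\<dots> \<le> cmod (complex_of_real (dirac_value i) + \<i>)" by (rule abs_Re_le_cmod)
    finally show ?thesis
      using spin_value_ge_1[OF i] by (simp add: b_def norm_inverse divide_inverse le_imp_inverse_le)
  qed
  hence fin: "finite {i \<in> spinor_index. cmod (b i) > d}" if "d > 0" for d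
    using finite_vanishing that by blast
  have "(plus_scalar D \<i>)\<inverse> = dirac.Diag b"
    unfolding D_eq_dirac_Diag dirac.plus_scalar_Diag b_def by (rule dirac.converse_Diag) (rule nz)
  thus ?thesis
    using dirac.compact_operator_vanishing[OF fin] dirac.op_graph_wshift_id[OF dirac.shift_bounded_vanishing[OF fin]]
    by auto
qed

lemma summable_D: "summable_triple 2 D"
proof -
  define b where "b i = complex_of_real (inv_bracket (spin_value i))" for i
  have bf: "b = (\<lambda>i. complex_of_real (inv_bracket (spin_value i)))"
    by (rule ext) (rule b_def)
  have "cmod (b i) \<le> 1 / spin_value i" if i: "i \<in> spinor_index" for i
    using inv_bracket_le[of "spin_value i"] inv_bracket_nonneg spin_value_ge_1[OF i] by (simp add: b_def)
  hence fin: "finite {i \<in> spinor_index. cmod (b i) > d}" if "d > 0" for d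
    using finite_vanishing that by blast
  define B where "B = wshift id b"
  have gB: "op_graph B = Diag b"
    unfolding B_def by (rule op_graph_wshift_id[OF shift_bounded_vanishing[OF fin]])
  have "(plus_scalar (D O D) 1)\<inverse> = Diag (\<lambda>i. inverse (complex_of_real ((spin_value i)\<^sup>2) + 1))"
    unfolding D_squared plus_scalar_Diag
  proof (rule converse_Diag)
    fix i
    have "complex_of_real ((spin_value i)\<^sup>2) + 1 = complex_of_real ((spin_value i)\<^sup>2 + 1)" by simp
    also have "\<dots> \<noteq> 0" by (simp only: of_real_eq_0_iff) (metis add_nonneg_eq_0_iff zero_le_power2 zero_le_one zero_neq_one)
    finally show "complex_of_real ((spin_value i)\<^sup>2) + 1 \<noteq> 0" .
  qed
  also have "\<dots> = Diag (\<lambda>i. complex_of_real ((inv_bracket (spin_value i))\<^sup>2))"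
  proof (rule Diag_cong)
    fix i
    have "(sqrt ((spin_value i)\<^sup>2 + 1))\<^sup>2 = (spin_value i)\<^sup>2 + 1" by (rule real_sqrt_pow2) simp
    hence "(inv_bracket (spin_value i))\<^sup>2 = inverse ((spin_value i)\<^sup>2 + 1)"
      by (simp only: inv_bracket_def power_divide power_one inverse_eq_divide)
    thus "inverse (complex_of_real ((spin_value i)\<^sup>2) + 1) = complex_of_real ((inv_bracket (spin_value i))\<^sup>2)"
      by simp
  qed
  finally have "sqrt_op ((plus_scalar (D O D) 1)\<inverse>) = Diag b"
    by (simp only: sqrt_op_Diag inv_bracket_nonneg bf)
  hence gr: "op_graph B = sqrt_op ((plus_scalar (D O D) 1)\<inverse>)" by (simp only: gB)
  have absB: "abs_op (op_graph B) = Diag b"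
    unfolding gB bf abs_op_Diag by (simp only: abs_of_nonneg[OF inv_bracket_nonneg])
  \<comment> \<open>This list takes the value belonging to level n + 1 exactly 4 (n + 1) times, in
    agreement with \<open>card_spinor_level\<close>.\<close>
  define s where "s k = inv_bracket (real (level_of k))" for k
  have "singular_values B s"
    unfolding singular_values_def
  proof (intro conjI allI impI)
    show "decseq s" unfolding decseq_def s_def
      by (auto intro!: inv_bracket_antimono mono_level_of)
    show "0 \<le> s k" for k by (simp add: s_def inv_bracket_nonneg)
    fix r :: real assume r: "r > 0"
    have bi: "b i = complex_of_real r \<longleftrightarrow> inv_bracket (spin_value i) = r" for i
      by (simp only: b_def of_real_eq_iff)
    have "finite {k. s k = r} \<and> finite {i \<in> spinor_index. b i = complex_of_real r} \<and>
      card {k. s k = r} = card {i \<in> spinor_index. b i = complex_of_real r}"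
    \<comment> \<open>Either r belongs to one level only, \<open>inv_bracket\<close> being injective
      on nonnegative arguments, or neither side has an index with value r.\<close>
    proof (cases "\<exists>n. r = inv_bracket (real (Suc n))")
      case True
      then obtain n where n: "r = inv_bracket (real (Suc n))" by blast
      have "{k. s k = r} = {k. level_of k = Suc n}"
        by (auto simp: s_def n inv_bracket_eq_iff simp del: of_nat_Suc)
      moreover have "inv_bracket (spin_value i) = r \<longleftrightarrow> spin_value i = real (Suc n)" if "i \<in> spinor_index" for i
        using spin_value_ge_1[OF that] by (simp add: n inv_bracket_eq_iff del: of_nat_Suc)
      hence "{i \<in> spinor_index. b i = complex_of_real r} = {i \<in> spinor_index. spin_value i = real (Suc n)}"
        unfolding bi by blast
      ultimately show ?thesis
        by (simp only: card_level_of card_spinor_level finite_level_of finite_spinor_level simp_thms)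
    next
      case False
      have "s k \<noteq> r" for k
        using False level_of_pos[of k] unfolding s_def by (metis Suc_pred)
      moreover have "b i \<noteq> complex_of_real r" if "i \<in> spinor_index" for i
        using False spin_value_Suc[OF that] unfolding bi by metis
      ultimately have "{k. s k = r} = {}" "{i \<in> spinor_index. b i = complex_of_real r} = {}" by auto
      thus ?thesis by (simp only: finite.emptyI card.empty simp_thms)
    qed
    thus "finite {k. s k = r}" "card {k. s k = r} =
        vector_space.dim scaleC {x. (x, complex_of_real r *\<^sub>C x) \<in> abs_op (op_graph B)}"
      unfolding absB using dim_eigenspace[of b "complex_of_real r"] by simp_all
  qed
  moreover have "s \<in> O(\<lambda>k. real k powr (- 1 / 2))"
    unfolding s_def by (rule inv_bracket_level_bigo)
  moreover have "compact_operator B" unfolding B_def by (rule compact_operator_vanishing[OF fin])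
  ultimately have "B \<in> dixmier_ideal 2" unfolding dixmier_ideal_def by blast
  thus ?thesis unfolding summable_triple_def using gr by blast
qed

end

section \<open>The action of the quantum sphere on spinors\<close>

text \<open>Weights are indexed by the target of an arrow, whereas \<open>ladder\<close> expects its
  source.\<close>

definition shift_weight :: "real \<Rightarrow> real \<Rightarrow> real \<Rightarrow> gen \<Rightarrow> real \<times> real \<times> real \<Rightarrow> complex" where
  "shift_weight q t s g i =
     complex_of_real (ladder q t s g (fst i - s) (fst (snd i) - gen_index g) (snd (snd i)))"

locale podles_spinors = dirac_spinors v D
  for v :: "real \<times> real \<times> real \<Rightarrow> 'h::complex_hilbert" and D +
  fixes q t :: real and \<pi> :: "free_alg set \<Rightarrow> 'h \<Rightarrow> 'h"
  assumes q: "0 < q" "q < 1" and t: "0 \<le> t" "t \<le> 1"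
    and rep: "spinor_representation q t v \<pi>"
begin

lemma faithful: "faithful_star_representation (podles_algebra q t) \<pi>"
  using rep by (simp add: spinor_representation_def)

lemma pi_bounded: "bounded_operator (\<pi> (podles_coset q t p))"
  using faithful by (auto simp: faithful_star_representation_def star_representation_def podles_carrier)

lemma pi_one: "\<pi> (podles_coset q t 1) = (\<lambda>x. x)"
  using faithful by (simp add: faithful_star_representation_def star_representation_def podles_one)

lemma pi_add: "\<pi> (podles_coset q t (p + p')) = (\<lambda>x. \<pi> (podles_coset q t p) x + \<pi> (podles_coset q t p') x)"
  using faithful
  by (auto simp: faithful_star_representation_def star_representation_def podles_carrier podles_add)

lemma pi_mult: "\<pi> (podles_coset q t (p * p')) = (\<lambda>x. \<pi> (podles_coset q t p) (\<pi> (podles_coset q t p') x))"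
  using faithful
  by (auto simp: faithful_star_representation_def star_representation_def podles_carrier podles_mult)

lemma pi_scale: "\<pi> (podles_coset q t (const c * p)) = (\<lambda>x. c *\<^sub>C \<pi> (podles_coset q t p) x)"
  using faithful
  by (auto simp: faithful_star_representation_def star_representation_def podles_carrier podles_smult)

abbreviation gen_op :: "gen \<Rightarrow> 'h \<Rightarrow> 'h" where
  "gen_op g \<equiv> \<pi> (podles_gen q t g)"

lemma coef_basis_or_zero: "i \<in> spinor_index \<Longrightarrow> coef (basis_or_zero v k) i = (if k = i then 1 else 0)"
  by (auto simp: basis_or_zero_def coef_basis)

text \<open>The representation formula lists the columns of the matrix; here it is read by rows, as
  \<open>wshift\<close> requires. Missing vectors disappear because i ranges over existing
  indices.\<close>

lemma coef_gen_op_basis: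
  assumes "k \<in> spinor_index" "i \<in> spinor_index"
  shows "coef (gen_op g (v k)) i =
    (\<Sum>s\<in>{- 1, 0, 1}. shift_weight q t s g i * (if k = spin_shift s (gen_index g) i then 1 else 0))"
proof -
  obtain l m N where k: "k = (l, m, N)" by (cases k) auto
  have "gen_op g (v (l, m, N)) = (\<Sum>s\<in>{- 1, 0, 1}. ladder q t s g l m N *\<^sub>R
      basis_or_zero v (l + s, m + gen_index g, N))"
  proof -
    have "gen_op g (v (l, m, N)) =
          alpha_minus q t g l m N *\<^sub>R basis_or_zero v (l - 1, m + gen_index g, N)
          + alpha_zero q t g l m N *\<^sub>R basis_or_zero v (l, m + gen_index g, N)
          + alpha_plus q t g l m N *\<^sub>R basis_or_zero v (l + 1, m + gen_index g, N)"
      using rep assms(1) unfolding spinor_representation_def k by blast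
    thus ?thesis by (simp add: ladder_def add.assoc)
  qed
  hence "coef (gen_op g (v k)) i = (\<Sum>s\<in>{- 1, 0, 1}. complex_of_real (ladder q t s g l m N) *
      (if (l + s, m + gen_index g, N) = i then 1 else 0))"
    unfolding k by (simp add: coef_sum coef_scaleR coef_basis_or_zero[OF assms(2)] coef_add)
  also have "\<dots> = (\<Sum>s\<in>{- 1, 0, 1}. shift_weight q t s g i * (if k = spin_shift s (gen_index g) i then 1 else 0))"
    by (intro sum.cong refl) (cases i, auto simp: k spin_shift_def shift_weight_def)
  finally show ?thesis .
qed

text \<open>The weights are matrix entries of the bounded operator \<^term>\<open>gen_op g\<close>, so that only the
  commutator with \<open>D\<close>, which compares the two spin components, requires estimates.\<close>

lemma shift_weight_bounded:
  "\<exists>K. \<forall>s\<in>{- 1, 0, 1}. \<forall>i\<in>spinor_index. spin_shift s (gen_index g) i \<in> spinor_index \<longrightarrow>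
     cmod (shift_weight q t s g i) \<le> K"
proof -
  have "bounded_linear (gen_op g)"
    using pi_bounded[of "var g"] by (simp add: podles_gen_def bounded_operator_def)
  then obtain K where K: "\<And>x. norm (gen_op g x) \<le> norm x * K" using bounded_linear.bounded by blast
  have "cmod (shift_weight q t s g i) \<le> K"
    if s: "s \<in> {- 1, 0, 1}" and i: "i \<in> spinor_index" and k: "spin_shift s (gen_index g) i \<in> spinor_index" for s i
  proof -
    \<comment> \<open>Different s have different sources, so the matrix entry consists of a single
      weight.\<close>
    have inj: "spin_shift s (gen_index g) i = spin_shift s' (gen_index g) i \<longleftrightarrow> s' = s" for s'
      by (auto simp: spin_shift_def)
    have "coef (gen_op g (v (spin_shift s (gen_index g) i))) i = shift_weight q t s g i"
      unfolding coef_gen_op_basis[OF k i] inj using s by auto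
    hence "cmod (shift_weight q t s g i) \<le> norm (gen_op g (v (spin_shift s (gen_index g) i)))"
      using cmod_coef_le by metis
    also have "\<dots> \<le> K" using K[of "v (spin_shift s (gen_index g) i)"] norm_basis[OF k] by simp
    finally show ?thesis .
  qed
  thus ?thesis by blast
qed

definition shift_op :: "real \<Rightarrow> gen \<Rightarrow> 'h \<Rightarrow> 'h" where
  "shift_op s g = wshift (spin_shift s (gen_index g)) (shift_weight q t s g)"

lemma inj_spin_shift: "inj_on (spin_shift s r) S"
  by (auto simp: spin_shift_def inj_on_def prod_eq_iff)

lemma shift_bounded_shift_op:
  "s \<in> {- 1, 0, 1} \<Longrightarrow> shift_bounded (spin_shift s (gen_index g)) (shift_weight q t s g)"
  using shift_weight_bounded[of g] unfolding shift_bounded_def by (blast intro: inj_spin_shift)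

text \<open>A generator mixes three degrees of the derivation and need not be an eigenvector of it,
  but each of these pieces is one.\<close>

lemma gen_op_eq_shift_ops: "gen_op g = (\<lambda>x. shift_op (- 1) g x + shift_op 0 g x + shift_op 1 g x)"
proof (rule bounded_operator_eqI)
  have b: "bounded_operator (shift_op s g)" if "s \<in> {- 1, 0, 1}" for s
    unfolding shift_op_def by (rule bounded_operator_wshift[OF shift_bounded_shift_op[OF that]])
  show "bounded_operator (\<lambda>x. shift_op (- 1) g x + shift_op 0 g x + shift_op 1 g x)"
    by (rule bounded_operator_plus[OF bounded_operator_plus[OF b b] b]) auto
  show "bounded_operator (gen_op g)" using pi_bounded by (simp add: podles_gen_def)
  fix k assume k: "k \<in> spinor_index"
  show "gen_op g (v k) = shift_op (- 1) g (v k) + shift_op 0 g (v k) + shift_op 1 g (v k)"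
  proof (rule coef_eqI)
    fix i assume i: "i \<in> spinor_index"
    have c: "coef (shift_op s g (v k)) i = shift_weight q t s g i * (if k = spin_shift s (gen_index g) i then 1 else 0)"
      if "s \<in> {- 1, 0, 1}" for s
      unfolding shift_op_def coef_wshift[OF shift_bounded_shift_op[OF that] i] coef_basis[OF k] by auto
    show "coef (gen_op g (v k)) i = coef (shift_op (- 1) g (v k) + shift_op 0 g (v k) + shift_op 1 g (v k)) i"
      unfolding coef_gen_op_basis[OF k i] coef_add by (simp add: c)
  qed
qed

lemma shift_op_smooth:
  assumes s: "s \<in> {- 1, 0, 1}"
  shows "shift_op s g \<in> smooth_ops D"
proof -
  define \<phi> where "\<phi> = spin_shift s (gen_index g)"
  define a where "a = shift_weight q t s g"
  \<comment> \<open>Coordinate i of D T x and that of T D x both involve x at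
    \<open>spin_flip (\<phi> i)\<close>; b is the difference of the two factors.\<close>
  define b where "b i = complex_of_real (spin_value i) * a (spin_flip i)
    - complex_of_real (spin_value (\<phi> i)) * a i" for i
  have flip_phi: "spin_flip (\<phi> i) = \<phi> (spin_flip i)" for i
    by (simp add: \<phi>_def spin_flip_shift)
  have val: "spin_value i = spin_value (\<phi> i) + s" for i
    by (simp add: \<phi>_def spin_shift_def spin_value_def)
  have val': "complex_of_real (spin_value i) = complex_of_real (spin_value (\<phi> i)) + complex_of_real s" for i
    unfolding of_real_add[symmetric] val[symmetric] ..
  have sa: "shift_bounded \<phi> a" unfolding \<phi>_def a_def by (rule shift_bounded_shift_op[OF s])
  have op: "shift_op s g = wshift \<phi> a" by (simp add: shift_op_def \<phi>_def a_def)
  obtain K1 where K1: "\<And>i. i \<in> spinor_index \<Longrightarrow> \<phi> i \<in> spinor_index \<Longrightarrow> cmod (a i) \<le> K1"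
    using shift_weight_bounded[of g] s unfolding a_def \<phi>_def by blast
  obtain K2 where K2: "\<And>l m N. (l, m, N) \<in> spinor_index \<Longrightarrow> (l + s, m + gen_index g, N) \<in> spinor_index \<Longrightarrow>
    (l + 1/2) * \<bar>ladder q t s g l m N - ladder q t s g l m (- N)\<bar> \<le> K2"
    using ladder_diff_bounded[OF q t] s by blast
  have "cmod (b i) \<le> K1 + K2" if i: "i \<in> spinor_index" and p: "\<phi> i \<in> spinor_index" for i
  proof -
    obtain l m N where l: "i = (l, m, N)" by (cases i) auto
    \<comment> \<open>Replacing the value at i by the value at the source plus s leaves a bounded
      term and the difference between the two signs, the only place with an unbounded
      factor.\<close>
    have "b i = complex_of_real s * a (spin_flip i)
        + complex_of_real (spin_value (\<phi> i)) * (a (spin_flip i) - a i)"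
      unfolding b_def val[of i] by (simp add: algebra_simps)
    hence "cmod (b i) \<le> cmod (complex_of_real s * a (spin_flip i))
        + cmod (complex_of_real (spin_value (\<phi> i)) * (a (spin_flip i) - a i))"
      by (simp only: norm_triangle_ineq)
    moreover have "cmod (complex_of_real s * a (spin_flip i)) \<le> K1"
    proof -
      have "cmod (a (spin_flip i)) \<le> K1"
        using K1[of "spin_flip i"] i p flip_phi[of i] spinor_index_flip[of "\<phi> i"] by simp
      moreover have "cmod (complex_of_real s * a (spin_flip i)) \<le> cmod (a (spin_flip i))"
        using s by (auto simp: norm_mult)
      ultimately show ?thesis by linarith
    qed
    moreover have "cmod (complex_of_real (spin_value (\<phi> i)) * (a (spin_flip i) - a i)) \<le> K2"
    proof -
      have "(l - s, m - gen_index g, N) \<in> spinor_index" "(l - s + s, m - gen_index g + gen_index g, N) \<in> spinor_index"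
        using i p by (simp_all add: l \<phi>_def spin_shift_def)
      from K2[OF this] have "(l - s + 1/2) * \<bar>ladder q t s g (l - s) (m - gen_index g) N
          - ladder q t s g (l - s) (m - gen_index g) (- N)\<bar> \<le> K2" .
      moreover have "spin_value (\<phi> i) = l - s + 1/2" by (simp add: l \<phi>_def spin_shift_def spin_value_def)
      moreover have "a (spin_flip i) - a i = complex_of_real (ladder q t s g (l - s) (m - gen_index g) (- N)
          - ladder q t s g (l - s) (m - gen_index g) N)"
        by (simp add: a_def shift_weight_def l spin_flip_def)
      ultimately show ?thesis
        using spin_value_ge_1[OF p] by (simp only: norm_mult norm_of_real abs_minus_commute abs_of_nonneg)
    qed
    ultimately show ?thesis by linarith
  qed
  moreover have "inj_on (\<lambda>i. spin_flip (\<phi> i)) spinor_index"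
    by (auto simp: \<phi>_def spin_flip_def spin_shift_def inj_on_def prod_eq_iff)
  ultimately have sb: "shift_bounded (\<lambda>i. spin_flip (\<phi> i)) b"
    unfolding shift_bounded_def spinor_index_flip by blast
  have "(wshift \<phi> a, \<lambda>x. complex_of_real s *\<^sub>C wshift \<phi> a x) \<in> commutator (abs_op D)"
    unfolding abs_D by (rule commutator_wshift[OF sa]) (rule val')
  hence a_OP0: "wshift \<phi> a \<in> OP0 D" by (rule OP0_eigenvector[OF self_adjoint_D self_adjoint_abs_D])
  \<comment> \<open>The flip preserves the eigenvalue of |D|, so [D, T] has the same degree s as
    T.\<close>
  have "(wshift (\<lambda>i. spin_flip (\<phi> i)) b, \<lambda>x. complex_of_real s *\<^sub>C wshift (\<lambda>i. spin_flip (\<phi> i)) b x)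
      \<in> commutator (abs_op D)"
    unfolding abs_D by (rule commutator_wshift[OF sb]) (simp only: spin_value_flip, rule val')
  hence b_OP0: "wshift (\<lambda>i. spin_flip (\<phi> i)) b \<in> OP0 D"
    by (rule OP0_eigenvector[OF self_adjoint_D self_adjoint_abs_D])
  have "(wshift \<phi> a x, wshift \<phi> a y + wshift (\<lambda>i. spin_flip (\<phi> i)) b x) \<in> D" if xy: "(x, y) \<in> D" for x y
    unfolding mem_D
  proof
    fix i assume i: "i \<in> spinor_index"
    hence fi: "spin_flip i \<in> spinor_index" by simp
    have cy: "coef y (\<phi> i) = complex_of_real (spin_value (\<phi> i)) * coef x (spin_flip (\<phi> i))"
    proof (cases "\<phi> i \<in> spinor_index")
      case True
      thus ?thesis using xy unfolding mem_D by blast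
    next
      \<comment> \<open>A source outside the index set stays outside under the flip, so both sides
        are 0.\<close>
      case False
      thus ?thesis using coef_outside spinor_index_flip by simp
    qed
    show "coef (wshift \<phi> a y + wshift (\<lambda>i. spin_flip (\<phi> i)) b x) i
        = complex_of_real (spin_value i) * coef (wshift \<phi> a x) (spin_flip i)"
      unfolding coef_add coef_wshift[OF sa i] coef_wshift[OF sb i] coef_wshift[OF sa fi] cy
      unfolding flip_phi b_def
      by (simp add: algebra_simps)
  qed
  hence "(wshift \<phi> a, wshift (\<lambda>i. spin_flip (\<phi> i)) b) \<in> commutator D"
    using bounded_operator_wshift[OF sa] bounded_operator_wshift[OF sb] by (auto simp: commutator_def)
  thus ?thesis unfolding op smooth_ops_def using a_OP0 b_OP0 by blast
qed

lemma gen_op_smooth: "gen_op g \<in> smooth_ops D"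
  unfolding gen_op_eq_shift_ops
  by (rule smooth_ops_add[OF self_adjoint_D self_adjoint_abs_D
        smooth_ops_add[OF self_adjoint_D self_adjoint_abs_D shift_op_smooth shift_op_smooth] shift_op_smooth]) auto

lemma pi_smooth: "\<pi> (podles_coset q t p) \<in> smooth_ops D"
proof (induction p rule: free_alg_induct)
  case (single w c)
  obtain u where w: "w = Word u" by (cases w)
  have "\<pi> (podles_coset q t (Poly_Mapping.single (Word u) 1)) \<in> smooth_ops D"
  proof (induction u)
    case Nil
    have "Poly_Mapping.single (Word []) 1 = (1::free_alg)" by (metis single_one zero_word_def)
    thus ?case
      using smooth_ops_id[OF self_adjoint_D self_adjoint_abs_D] by (simp only: pi_one)
  next
    case (Cons g u)
    have "Poly_Mapping.single (Word (g # u)) 1 = var g * Poly_Mapping.single (Word u) (1::complex)"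
      by (simp add: var_def mult_single plus_word_def)
    thus ?case
      using smooth_ops_mult[OF self_adjoint_D self_adjoint_abs_D gen_op_smooth[of g] Cons]
      by (simp only: pi_mult podles_gen_def)
  qed
  hence "\<pi> (podles_coset q t (const c * Poly_Mapping.single (Word u) 1)) \<in> smooth_ops D"
    unfolding pi_scale by (rule smooth_ops_scale[OF self_adjoint_D self_adjoint_abs_D])
  thus ?case by (simp only: const_mult_single mult_1_right w)
next
  case (add p p')
  thus ?case unfolding pi_add by (rule smooth_ops_add[OF self_adjoint_D self_adjoint_abs_D])
qed

lemma pi_carrier_smooth: "\<pi> ` carrier (podles_algebra q t) \<subseteq> smooth_ops D"
  using pi_smooth by (auto simp: podles_carrier)

lemma spectral_triple_podles: "spectral_triple (podles_algebra q t) \<pi> D"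
  unfolding spectral_triple_def
proof (intro conjI ballI)
  show "complex_star_algebra (podles_algebra q t)" by (rule complex_star_algebra_podles) (use q in simp)
  show "\<exists>b. (\<pi> a, b) \<in> commutator D" if "a \<in> carrier (podles_algebra q t)" for a
    using pi_carrier_smooth that unfolding smooth_ops_def by blast
qed (rule faithful self_adjoint_D compact_resolvent)+

lemma regular_podles: "regular_triple (podles_algebra q t) \<pi> D"
proof -
  have "{b. \<exists>a\<in>carrier (podles_algebra q t). (\<pi> a, b) \<in> commutator D}
      = {b. \<exists>a\<in>\<pi> ` carrier (podles_algebra q t). (a, b) \<in> commutator D}" by blast
  thus ?thesis
    using generated_algebra_smooth_ops[OF self_adjoint_D self_adjoint_abs_D pi_carrier_smooth]
    by (simp only: regular_triple_def)
qed

end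

theorem proposition8p1:
  fixes q t :: real
    and v :: "real \<times> real \<times> real \<Rightarrow> 'h::complex_hilbert"
    and \<pi> :: "free_alg set \<Rightarrow> 'h \<Rightarrow> 'h"
    and D :: "'h rel"
  assumes "0 < q" and "q < 1" and "0 \<le> t" and "t \<le> 1"
    and "orthonormal_basis spinor_index v"
    and "spinor_representation q t v \<pi>"
    and "self_adjoint D"
    and "\<And>l m N. (l, m, N) \<in> spinor_index \<Longrightarrow>
           (v (l, m, N), (l + 1/2) *\<^sub>R v (l, m, - N)) \<in> D"
  shows "spectral_triple (podles_algebra q t) \<pi> D
       \<and> summable_triple 2 D
       \<and> regular_triple (podles_algebra q t) \<pi> D"
proof -
  interpret podles_spinors v D q t \<pi>
    by (intro podles_spinors.intro dirac_spinors.intro orthonormal_basis_onb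
        dirac_spinors_axioms.intro podles_spinors_axioms.intro assms)
  show ?thesis using spectral_triple_podles summable_D regular_podles by blast
qed

end
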